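(* Let $k$ be a field containing all roots of unity, let $n$ be a positive integer, and let $G$ be a torsion free closed subgroup of $\Sigma_n\ltimes\Gamma_n$, acting on the ring $\mathbb{E}_n$ (with $\Gamma_n$, $\mathbb{E}_n$ and the action as described in the context). Then the ring extension $\mathbb{E}_n^G\subseteq\mathbb{E}_n$ is a Galois ring extension (i.e. an infinite Galois extension).
   Context: "Containing all roots of unity" means that $k$ contains all roots of unity of an algebraic closure of $k$. Rings: $\mathbb{E}_n=\bigcup_s k[t_1^{\pm 1/s},\ldots,t_n^{\pm 1/s}]$, where $s$ ranges over all positive integers if $\mathrm{char}(k)=0$, and over all positive integers prime to $p$ if $\mathrm{char}(k)=p>0$; the union is taken along the evident inclusions for $s_1\mid s_2$, with $(t_i^{1/(ab)})^{b}=t_i^{1/a}$. Groups: $\Gamma_n=\hat{\mathbb{Z}}^n$ if $\mathrm{char}(k)=0$, and $\Gamma_n=\hat{\mathbb{Z}}(p)^n$ if $\mathrm{char}(k)=p>0$, where $\hat{\mathbb{Z}}(p)=\prod_{q\neq p}\mathbb{Z}_q$ is the product of the $q$-Sylow subgroups of $\hat{\mathbb{Z}}$ over primes $q\ne p$. $\Sigma_n$ is the symmetric group, with the discrete topology, acting on $\Gamma_n$ by permuting the factors, and $\Sigma_n\ltimes\Gamma_n$ is the semidirect product with the product topology. Action: fix an isomorphism $\theta$ from $\mathbb{Q}/\mathbb{Z}$ (if $\mathrm{char}(k)=0$), respectively from $\mathbb{Z}_{(p)}/\mathbb{Z}$ with $\mathbb{Z}_{(p)}$ the localization of $\mathbb{Z}$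 at the prime $p$ (if $\mathrm{char}(k)=p>0$), onto the group $\mu_\infty$ of all roots of unity in $k$. The group $\Gamma_n$ acts continuously on $\mathbb{E}_n$ (given the discrete topology) by $k$-algebra automorphisms so that the topological generator $\alpha_i=1$ of the $i$-th factor acts by $\alpha_i\cdot t_i^{1/m}=\theta(1/m)\,t_i^{1/m}$ and $\alpha_i\cdot t_j^{1/m}=t_j^{1/m}$ for $j\neq i$. Together with the action of $\Sigma_n$ on $\mathbb{E}_n$ by permuting the variables $t_1,\dots,t_n$ (and correspondingly their roots $t_i^{1/m}$), this gives an action of $\Sigma_n\ltimes\Gamma_n$ on $\mathbb{E}_n$. $\mathbb{E}_n^G$ is the subring of elements fixed by $G$. Galois ring extension: an $R$-algebra $S_0$ (commutative rings) is strongly separable if it is finitely generated projective as an $R$-module and is separable, i.e. $S_0$ is projective as an $S_0\otimes_R S_0$-module via multiplication. An extension $R\subseteq S$ of connected commutative rings is an (infinite) Galois extension if every finite subset of $S$ is contained in an $R$-subalgebra of $S$ that is strongly separable over $R$, and $R$ is the fixed ring of the group of $R$-algebra automorphisms of $S$. *)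

theory Defs
  imports
    "HOL-Algebra.Algebra"
    "HOL-Algebra.Algebraic_Closure_Type"
    "HOL-Analysis.Function_Topology"
    "HOL-Analysis.Product_Topology"
    "HOL-Library.Poly_Mapping"
    "HOL-Number_Theory.Cong"
begin

section \<open>Modules, strongly separable algebras and Galois extensions\<close>

definition module_hom ::
    "('r, 'x) ring_scheme \<Rightarrow> ('r, 'm, 'y) module_scheme \<Rightarrow> ('r, 'l, 'z) module_scheme \<Rightarrow> ('m \<Rightarrow> 'l) set"
  where "module_hom R M N =
    {h. h \<in> carrier M \<rightarrow> carrier N \<and>
        (\<forall>x\<in>carrier M. \<forall>y\<in>carrier M. h (x \<oplus>\<^bsub>M\<^esub> y) = h x \<oplus>\<^bsub>N\<^esub> h y) \<and>
        (\<forall>r\<in>carrier R. \<forall>x\<in>carrier M. h (r \<odot>\<^bsub>M\<^esub> x) = r \<odot>\<^bsub>N\<^esub> h x)}"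

text \<open>The free module \<open>R\<^sup>(\<^sup>I\<^sup>)\<close> of finitely supported families. A module record in HOL-Algebra
  also carries a multiplication and a unit; these two fields play no role here.\<close>

definition free_module :: "('r, 'x) ring_scheme \<Rightarrow> 'i set \<Rightarrow> ('r, 'i \<Rightarrow> 'r) module"
  where "free_module R I =
    \<lparr>carrier = {f \<in> I \<rightarrow>\<^sub>E carrier R. finite {i \<in> I. f i \<noteq> \<zero>\<^bsub>R\<^esub>}},
     monoid.mult = undefined, one = undefined,
     ring.zero = (\<lambda>i\<in>I. \<zero>\<^bsub>R\<^esub>), add = (\<lambda>f g. \<lambda>i\<in>I. f i \<oplus>\<^bsub>R\<^esub> g i),
     module.smult = (\<lambda>r f. \<lambda>i\<in>I. r \<otimes>\<^bsub>R\<^esub> f i)\<rparr>"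

text \<open>Projective means: a direct summand of a free module. Index sets in the type of the
  elements of \<open>M\<close> suffice, because a direct summand of any free module is also a direct summand
  of the free module on its own elements.\<close>

definition projective_module :: "('r, 'x) ring_scheme \<Rightarrow> ('r, 'm, 'y) module_scheme \<Rightarrow> bool"
  where "projective_module R M \<longleftrightarrow> module R M \<and>
    (\<exists>I :: 'm set. \<exists>\<iota> \<in> module_hom R M (free_module R I). \<exists>\<pi> \<in> module_hom R (free_module R I) M.
       \<forall>x\<in>carrier M. \<pi> (\<iota> x) = x)"

definition finitely_generated_module :: "('r, 'x) ring_scheme \<Rightarrow> ('r, 'm, 'y) module_scheme \<Rightarrow> bool"
  where "finitely_generated_module R M \<longleftrightarrow> module R M \<and>
    (\<exists>B. finite B \<and> B \<subseteq> carrier M \<and>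
       (\<forall>x\<in>carrier M. \<exists>c \<in> B \<rightarrow> carrier R. x = (\<Oplus>\<^bsub>M\<^esub>b\<in>B. c b \<odot>\<^bsub>M\<^esub> b)))"

text \<open>The tensor product \<open>A \<otimes>\<^sub>R B\<close> of two commutative \<open>R\<close>-algebras, as the quotient of the monoid
  ring \<open>\<int>[A \<times> B]\<close> of the multiplicative monoid \<open>A \<times> B\<close>; its additive group is the free abelian
  group on \<open>A \<times> B\<close>. The additive subgroup generated by the bilinearity relations is stable
  under multiplication by pairs, so it coincides with the ideal they generate.\<close>

abbreviation pure_pair :: "'a \<Rightarrow> 'b \<Rightarrow> ('a \<times> 'b) \<Rightarrow>\<^sub>0 int"
  where "pure_pair a b \<equiv> Poly_Mapping.single (a, b) 1"

definition pair_monoid_ring ::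
    "('r, 'a, 'y) module_scheme \<Rightarrow> ('r, 'b, 'z) module_scheme \<Rightarrow> (('a \<times> 'b) \<Rightarrow>\<^sub>0 int) ring"
  where "pair_monoid_ring A B =
    \<lparr>carrier = {f. Poly_Mapping.keys f \<subseteq> carrier A \<times> carrier B},
     monoid.mult = (\<lambda>f g. \<Sum>(a, b)\<in>Poly_Mapping.keys f. \<Sum>(a', b')\<in>Poly_Mapping.keys g.
        Poly_Mapping.single (a \<otimes>\<^bsub>A\<^esub> a', b \<otimes>\<^bsub>B\<^esub> b')
          (Poly_Mapping.lookup f (a, b) * Poly_Mapping.lookup g (a', b'))),
     one = pure_pair \<one>\<^bsub>A\<^esub> \<one>\<^bsub>B\<^esub>, ring.zero = 0, add = (+)\<rparr>"

definition tensor_relations ::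
    "('r, 'x) ring_scheme \<Rightarrow> ('r, 'a, 'y) module_scheme \<Rightarrow> ('r, 'b, 'z) module_scheme \<Rightarrow>
     (('a \<times> 'b) \<Rightarrow>\<^sub>0 int) set"
  where "tensor_relations R A B =
    {pure_pair (a \<oplus>\<^bsub>A\<^esub> a') b - pure_pair a b - pure_pair a' b | a a' b.
       a \<in> carrier A \<and> a' \<in> carrier A \<and> b \<in> carrier B} \<union>
    {pure_pair a (b \<oplus>\<^bsub>B\<^esub> b') - pure_pair a b - pure_pair a b' | a b b'.
       a \<in> carrier A \<and> b \<in> carrier B \<and> b' \<in> carrier B} \<union>
    {pure_pair (r \<odot>\<^bsub>A\<^esub> a) b - pure_pair a (r \<odot>\<^bsub>B\<^esub> b) | r a b.
       r \<in> carrier R \<and> a \<in> carrier A \<and> b \<in> carrier B}"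

definition tensor_algebra ::
    "('r, 'x) ring_scheme \<Rightarrow> ('r, 'a, 'y) module_scheme \<Rightarrow> ('r, 'b, 'z) module_scheme \<Rightarrow>
     (('a \<times> 'b) \<Rightarrow>\<^sub>0 int) set ring"
  where "tensor_algebra R A B =
    pair_monoid_ring A B Quot (Idl\<^bsub>pair_monoid_ring A B\<^esub> (tensor_relations R A B))"

text \<open>The multiplication map \<open>A \<otimes>\<^sub>R A \<rightarrow> A\<close>, first on representatives, then on classes.\<close>

definition multiplication_rep :: "('r, 'a, 'y) module_scheme \<Rightarrow> (('a \<times> 'a) \<Rightarrow>\<^sub>0 int) \<Rightarrow> 'a"
  where "multiplication_rep A f =
    (\<Oplus>\<^bsub>A\<^esub>x\<in>Poly_Mapping.keys f. [Poly_Mapping.lookup f x] \<cdot>\<^bsub>A\<^esub> (fst x \<otimes>\<^bsub>A\<^esub> snd x))"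

definition multiplication_map :: "('r, 'a, 'y) module_scheme \<Rightarrow> (('a \<times> 'a) \<Rightarrow>\<^sub>0 int) set \<Rightarrow> 'a"
  where "multiplication_map A C = the_elem (multiplication_rep A ` C)"

definition multiplication_module ::
    "('r, 'a, 'y) module_scheme \<Rightarrow> ((('a \<times> 'a) \<Rightarrow>\<^sub>0 int) set, 'a) module"
  where "multiplication_module A =
    \<lparr>carrier = carrier A, monoid.mult = monoid.mult A, one = \<one>\<^bsub>A\<^esub>, ring.zero = \<zero>\<^bsub>A\<^esub>, add = add A,
     module.smult = (\<lambda>C a. multiplication_map A C \<otimes>\<^bsub>A\<^esub> a)\<rparr>"

definition separable_algebra :: "('r, 'x) ring_scheme \<Rightarrow> ('r, 'a, 'y) module_scheme \<Rightarrow> bool"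
  where "separable_algebra R A \<longleftrightarrow> algebra R A \<and>
    projective_module (tensor_algebra R A A) (multiplication_module A)"

definition strongly_separable_algebra :: "('r, 'x) ring_scheme \<Rightarrow> ('r, 'a, 'y) module_scheme \<Rightarrow> bool"
  where "strongly_separable_algebra R A \<longleftrightarrow>
    finitely_generated_module R A \<and> projective_module R A \<and> separable_algebra R A"

definition connected_ring :: "('a, 'x) ring_scheme \<Rightarrow> bool"
  where "connected_ring R \<longleftrightarrow> cring R \<and> \<one>\<^bsub>R\<^esub> \<noteq> \<zero>\<^bsub>R\<^esub> \<and>
    (\<forall>e\<in>carrier R. e \<otimes>\<^bsub>R\<^esub> e = e \<longrightarrow> e = \<zero>\<^bsub>R\<^esub> \<or> e = \<one>\<^bsub>R\<^esub>)"

text \<open>A subset \<open>A\<close> of a ring \<open>S\<close>, with scalar multiplication by the multiplication of \<open>S\<close>.\<close>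

definition subalgebra_of :: "('a, 'x) ring_scheme \<Rightarrow> 'a set \<Rightarrow> ('a, 'a) module"
  where "subalgebra_of S A =
    \<lparr>carrier = A, monoid.mult = monoid.mult S, one = \<one>\<^bsub>S\<^esub>, ring.zero = \<zero>\<^bsub>S\<^esub>, add = add S, module.smult = monoid.mult S\<rparr>"

definition algebra_automorphisms :: "('a, 'x) ring_scheme \<Rightarrow> 'a set \<Rightarrow> ('a \<Rightarrow> 'a) set"
  where "algebra_automorphisms S K = {\<phi> \<in> ring_iso S S. \<forall>x\<in>K. \<phi> x = x}"

text \<open>\<open>galois_extension S K\<close>: the extension \<open>K \<subseteq> S\<close> is a (possibly infinite) Galois extension.\<close>

definition galois_extension :: "('a, 'x) ring_scheme \<Rightarrow> 'a set \<Rightarrow> bool"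
  where "galois_extension S K \<longleftrightarrow>
    subcring K S \<and> connected_ring S \<and> connected_ring (S\<lparr>carrier := K\<rparr>) \<and>
    (\<forall>F. finite F \<and> F \<subseteq> carrier S \<longrightarrow>
       (\<exists>S\<^sub>0. subcring S\<^sub>0 S \<and> K \<subseteq> S\<^sub>0 \<and> F \<subseteq> S\<^sub>0 \<and>
             strongly_separable_algebra (S\<lparr>carrier := K\<rparr>) (subalgebra_of S S\<^sub>0))) \<and>
    K = {x \<in> carrier S. \<forall>\<phi>\<in>algebra_automorphisms S K. \<phi> x = x}"

section \<open>The groups\<close>

text \<open>Throughout, \<open>p\<close> is the characteristic of the ground field: zero or a prime. The
  \<open>q\<close>-adic integers are the inverse limit of the groups \<open>\<int>/q\<^sup>j\<close>, with their residues in
  \<open>{0..<q\<^sup>j}\<close>.\<close>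

definition padic_int_group :: "nat \<Rightarrow> (nat \<Rightarrow> int) monoid"
  where "padic_int_group q = (product_group UNIV (\<lambda>j. integer_mod_group (q ^ j)))
    \<lparr>carrier := {a \<in> carrier (product_group UNIV (\<lambda>j. integer_mod_group (q ^ j))).
                  \<forall>i j. i \<le> j \<longrightarrow> a j mod int (q ^ i) = a i}\<rparr>"

definition padic_int_topology :: "nat \<Rightarrow> (nat \<Rightarrow> int) topology"
  where "padic_int_topology q = subtopology
    (product_topology (\<lambda>j. discrete_topology (carrier (integer_mod_group (q ^ j)))) UNIV)
    (carrier (padic_int_group q))"

definition primes_except :: "nat \<Rightarrow> nat set"
  where "primes_except p = {q. Factorial_Ring.prime q \<and> q \<noteq> p}"

text \<open>For prime \<open>p\<close> this is the product of the \<open>\<int>\<^sub>q\<close> with \<open>q \<noteq> p\<close>; for \<open>p = 0\<close> no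
  prime is left out, and it is the profinite completion of \<open>\<int>\<close>, written as the product of its
  Sylow subgroups.\<close>

definition Zhat_group :: "nat \<Rightarrow> (nat \<Rightarrow> nat \<Rightarrow> int) monoid"
  where "Zhat_group p = product_group (primes_except p) padic_int_group"

definition Zhat_topology :: "nat \<Rightarrow> (nat \<Rightarrow> nat \<Rightarrow> int) topology"
  where "Zhat_topology p = product_topology padic_int_topology (primes_except p)"

definition Gamma_group :: "nat \<Rightarrow> nat \<Rightarrow> (nat \<Rightarrow> nat \<Rightarrow> nat \<Rightarrow> int) monoid"
  where "Gamma_group n p = product_group {1..n} (\<lambda>i. Zhat_group p)"

definition Gamma_topology :: "nat \<Rightarrow> nat \<Rightarrow> (nat \<Rightarrow> nat \<Rightarrow> nat \<Rightarrow> int) topology"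
  where "Gamma_topology n p = product_topology (\<lambda>i. Zhat_topology p) {1..n}"

definition permute_factors :: "nat \<Rightarrow> (nat \<Rightarrow> nat) \<Rightarrow> (nat \<Rightarrow> 'b) \<Rightarrow> nat \<Rightarrow> 'b"
  where "permute_factors n \<sigma> a = (\<lambda>i\<in>{1..n}. a (Hilbert_Choice.inv \<sigma> i))"

text \<open>The pair \<open>(\<sigma>, a)\<close> stands for the product \<open>a \<sigma>\<close>, that is, first \<open>\<sigma>\<close> acts, then \<open>a\<close>.\<close>

definition Sigma_Gamma_group ::
    "nat \<Rightarrow> nat \<Rightarrow> ((nat \<Rightarrow> nat) \<times> (nat \<Rightarrow> nat \<Rightarrow> nat \<Rightarrow> int)) monoid"
  where "Sigma_Gamma_group n p =
    \<lparr>carrier = carrier (sym_group n) \<times> carrier (Gamma_group n p),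
     monoid.mult = (\<lambda>(\<sigma>, a) (\<tau>, b).
        (\<sigma> \<otimes>\<^bsub>sym_group n\<^esub> \<tau>, a \<otimes>\<^bsub>Gamma_group n p\<^esub> permute_factors n \<sigma> b)),
     one = (\<one>\<^bsub>sym_group n\<^esub>, \<one>\<^bsub>Gamma_group n p\<^esub>)\<rparr>"

definition Sigma_Gamma_topology ::
    "nat \<Rightarrow> nat \<Rightarrow> ((nat \<Rightarrow> nat) \<times> (nat \<Rightarrow> nat \<Rightarrow> nat \<Rightarrow> int)) topology"
  where "Sigma_Gamma_topology n p =
    prod_topology (discrete_topology (carrier (sym_group n))) (Gamma_topology n p)"

definition torsion_free :: "('a, 'x) monoid_scheme \<Rightarrow> 'a set \<Rightarrow> bool"
  where "torsion_free M G \<longleftrightarrow> (\<forall>g\<in>G. \<forall>m::nat. m > 0 \<and> g [^]\<^bsub>M\<^esub> m = \<one>\<^bsub>M\<^esub> \<longrightarrow> g = \<one>\<^bsub>M\<^esub>)"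

section \<open>Roots of unity\<close>

definition contains_all_roots_of_unity :: "'k::field itself \<Rightarrow> bool"
  where "contains_all_roots_of_unity _ \<longleftrightarrow>
    (\<forall>z :: 'k alg_closure. \<forall>m::nat. m > 0 \<and> z ^ m = 1 \<longrightarrow> z \<in> range to_ac)"

definition roots_of_unity_group :: "'k::field monoid"
  where "roots_of_unity_group =
    \<lparr>carrier = {z. \<exists>m::nat. m > 0 \<and> z ^ m = 1}, monoid.mult = (*), one = 1\<rparr>"

definition prime_to_char :: "nat \<Rightarrow> nat \<Rightarrow> bool"
  where "prime_to_char p m \<longleftrightarrow> m > 0 \<and> (p = 0 \<or> coprime m p)"

text \<open>The additive group of \<open>\<rat>\<close> if \<open>p = 0\<close>, and of \<open>\<int>\<^sub>(\<^sub>p\<^sub>)\<close> if \<open>p\<close> is prime.\<close>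

definition Zloc_group :: "nat \<Rightarrow> rat monoid"
  where "Zloc_group p =
    \<lparr>carrier = {of_int r / of_nat m | r m. prime_to_char p m}, monoid.mult = (+), one = 0\<rparr>"

text \<open>An isomorphism as required for the action, defined on the cosets of \<open>\<int>\<close>, and its
  value at the class of a rational number \<open>x\<close>.\<close>

definition root_isomorphism :: "(rat set \<Rightarrow> 'k::field) \<Rightarrow> bool"
  where "root_isomorphism \<theta> \<longleftrightarrow> \<theta> \<in> iso (Zloc_group CHAR('k) Mod \<int>) roots_of_unity_group"

definition at_class :: "(rat set \<Rightarrow> 'k::field) \<Rightarrow> rat \<Rightarrow> 'k"
  where "at_class \<theta> x = \<theta> (\<int> #>\<^bsub>Zloc_group CHAR('k)\<^esub> x)"

section \<open>The ring and the action\<close>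

text \<open>An exponent vector is a finitely supported function on the indices of the variables,
  and a polynomial with rational exponents is a finitely supported function from exponent
  vectors to coefficients, with the convolution product.\<close>

type_synonym 'k genpoly = "(nat \<Rightarrow>\<^sub>0 rat) \<Rightarrow>\<^sub>0 'k"

text \<open>\<open>k[t\<^sub>1\<^sup>\<plusminus>\<^sup>1\<^sup>/\<^sup>s, \<dots>, t\<^sub>n\<^sup>\<plusminus>\<^sup>1\<^sup>/\<^sup>s]\<close>\<close>

definition laurent_ring :: "nat \<Rightarrow> nat \<Rightarrow> 'k::field genpoly set"
  where "laurent_ring n s = {f. \<forall>v\<in>Poly_Mapping.keys f.
    Poly_Mapping.keys v \<subseteq> {1..n} \<and> (\<forall>i. of_nat s * Poly_Mapping.lookup v i \<in> \<int>)}"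

definition E_ring :: "nat \<Rightarrow> 'k::field genpoly ring"
  where "E_ring n = ring_of_type_algebra
    \<lparr>carrier := \<Union>s\<in>{s. prime_to_char CHAR('k) s}. laurent_ring n s\<rparr>"

definition t_pow :: "nat \<Rightarrow> rat \<Rightarrow> 'k::field genpoly"
  where "t_pow i x = Poly_Mapping.single (Poly_Mapping.single i x) 1"

text \<open>The residue modulo \<open>m\<close> of an element of \<open>Zhat_group p\<close>, for \<open>m\<close> prime to \<open>p\<close>,
  given by the Chinese remainder theorem.\<close>

definition Zhat_residue :: "nat \<Rightarrow> (nat \<Rightarrow> nat \<Rightarrow> int) \<Rightarrow> nat \<Rightarrow> int"
  where "Zhat_residue p a m = (THE c. 0 \<le> c \<and> c < int m \<and>
    (\<forall>q\<in>primes_except p. c mod int (q ^ multiplicity q m) = a q (multiplicity q m)))"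

text \<open>The factor by which an element \<open>a\<close> of the \<open>i\<close>-th copy of \<open>Zhat_group p\<close> multiplies
  \<open>t\<^sub>i\<^sup>x\<close>: since \<open>a\<close> acts continuously and \<open>1\<close> multiplies \<open>t\<^sub>i\<^sup>x\<close> by \<open>\<theta>(x)\<close>, it is \<open>\<theta>(c x)\<close>
  for an integer \<open>c\<close> congruent to \<open>a\<close> modulo the denominator of \<open>x\<close>.\<close>

definition Zhat_character :: "(rat set \<Rightarrow> 'k::field) \<Rightarrow> (nat \<Rightarrow> nat \<Rightarrow> int) \<Rightarrow> rat \<Rightarrow> 'k"
  where "Zhat_character \<theta> a x =
    at_class \<theta> (of_int (Zhat_residue CHAR('k) a (nat (snd (quotient_of x)))) * x)"

definition Gamma_action ::
    "nat \<Rightarrow> (rat set \<Rightarrow> 'k::field) \<Rightarrow> (nat \<Rightarrow> nat \<Rightarrow> nat \<Rightarrow> int) \<Rightarrow> 'k genpoly \<Rightarrow> 'k genpoly"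
  where "Gamma_action n \<theta> a f =
    Poly_Mapping.mapp (\<lambda>v c. (\<Prod>i=1..n. Zhat_character \<theta> (a i) (Poly_Mapping.lookup v i)) * c) f"

text \<open>\<open>\<sigma>\<close> sends \<open>t\<^sub>i\<close> to \<open>t\<^bsub>\<sigma> i\<^esub>\<close>: the coefficient of \<open>\<sigma> f\<close> at \<open>v\<close> is that of \<open>f\<close> at \<open>v \<circ> \<sigma>\<close>.\<close>

definition Sigma_action :: "(nat \<Rightarrow> nat) \<Rightarrow> 'k::field genpoly \<Rightarrow> 'k genpoly"
  where "Sigma_action \<sigma> f = Poly_Mapping.map_key (Poly_Mapping.map_key \<sigma>) f"

definition E_action ::
    "nat \<Rightarrow> (rat set \<Rightarrow> 'k::field) \<Rightarrow> (nat \<Rightarrow> nat) \<times> (nat \<Rightarrow> nat \<Rightarrow> nat \<Rightarrow> int) \<Rightarrow>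
     'k genpoly \<Rightarrow> 'k genpoly"
  where "E_action n \<theta> = (\<lambda>(\<sigma>, a) f. Gamma_action n \<theta> a (Sigma_action \<sigma> f))"

definition fixed_ring ::
    "nat \<Rightarrow> (rat set \<Rightarrow> 'k::field) \<Rightarrow> ((nat \<Rightarrow> nat) \<times> (nat \<Rightarrow> nat \<Rightarrow> nat \<Rightarrow> int)) set \<Rightarrow> 'k genpoly set"
  where "fixed_ring n \<theta> G = {f \<in> carrier (E_ring n). \<forall>g\<in>G. E_action n \<theta> g f = f}"

section \<open>The action is the one required\<close>

text \<open>The remaining facts show that the explicit formulas above satisfy the description of the
  action: \<open>E_action\<close> is an action of the semidirect product, \<open>\<Gamma>\<^sub>n\<close> acts by \<open>k\<close>-linear
  ring homomorphisms, the generator \<open>\<alpha>\<^sub>i = 1\<close> of the \<open>i\<close>-th factor multiplies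
  \<open>t\<^sub>i\<^sup>1\<^sup>/\<^sup>m\<close> by \<open>\<theta>(1/m)\<close> and fixes \<open>t\<^sub>j\<^sup>1\<^sup>/\<^sup>m\<close> for \<open>j \<noteq> i\<close>, and the action of
  \<open>\<Gamma>\<^sub>n\<close> is continuous for the discrete topology on the ring. See \<open>E_action_mult\<close>,
  \<open>Gamma_action_times\<close>, \<open>Gamma_action_scale\<close>, \<open>Gamma_generator_action\<close> and
  \<open>Gamma_action_continuous\<close>.\<close>

lemma prime_to_char_mult:
  "prime_to_char p m \<Longrightarrow> prime_to_char p m' \<Longrightarrow> prime_to_char p (m * m')"
  by (auto simp: prime_to_char_def)

lemma prime_to_char_dvd: "prime_to_char p m \<Longrightarrow> d dvd m \<Longrightarrow> prime_to_char p d"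
  unfolding prime_to_char_def
  by (metis coprime_divisors dvd_refl dvd_pos_nat)

lemma not_prime_to_char_multiplicity:
  assumes "prime_to_char p m" "Factorial_Ring.prime q" "q \<notin> primes_except p"
  shows "multiplicity q m = 0"
proof -
  have "q = p" using assms by (auto simp: primes_except_def)
  then have "p \<noteq> 0" using assms(2) by auto
  then have "coprime m p" using assms(1) by (auto simp: prime_to_char_def)
  then have "\<not> q dvd m" using \<open>q = p\<close> assms(2)
    by (metis coprime_common_divisor_nat dvd_refl not_prime_1)
  then show ?thesis by (simp add: not_dvd_imp_multiplicity_0)
qed

lemma prime_to_char_dvd_int:
  assumes m: "prime_to_char p m"
    and d: "\<And>q. q \<in> primes_except p \<Longrightarrow> int (q ^ multiplicity q m) dvd x"
  shows "int m dvd x"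
proof (cases "x = 0")
  case False
  have "m dvd nat \<bar>x\<bar>"
  proof (rule multiplicity_le_imp_dvd)
    show "m \<noteq> 0" using m by (auto simp: prime_to_char_def)
    fix q :: nat assume q: "Factorial_Ring.prime q"
    show "multiplicity q m \<le> multiplicity q (nat \<bar>x\<bar>)"
    proof (cases "q \<in> primes_except p")
      case True
      have "q ^ multiplicity q m dvd nat \<bar>x\<bar>" using d[OF True]
        by (metis dvd_abs_iff int_dvd_int_iff int_nat_eq abs_ge_zero)
      then show ?thesis using False q
        by (intro multiplicity_geI) (auto simp: prime_gt_Suc_0_nat)
    qed (use not_prime_to_char_multiplicity[OF m q] in auto)
  qed
  then show ?thesis by (metis dvd_abs_iff int_dvd_int_iff int_nat_eq abs_ge_zero)
qed auto

lemma padic_int_memD: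
  assumes "a \<in> carrier (padic_int_group q)" "q > 0"
  shows "0 \<le> a j" "a j < int (q ^ j)" "i \<le> j \<Longrightarrow> a j mod int (q ^ i) = a i"
proof -
  have "a j \<in> carrier (integer_mod_group (q ^ j))"
    using assms by (auto simp: padic_int_group_def)
  then show "0 \<le> a j" "a j < int (q ^ j)" using assms(2)
    by (auto simp: carrier_integer_mod_group)
  show "i \<le> j \<Longrightarrow> a j mod int (q ^ i) = a i"
    using assms by (auto simp: padic_int_group_def)
qed

lemma Zhat_memD: "a \<in> carrier (Zhat_group p) \<Longrightarrow> q \<in> primes_except p \<Longrightarrow>
    a q \<in> carrier (padic_int_group q) \<and> q > 0 \<and> Factorial_Ring.prime q"
  by (auto simp: Zhat_group_def primes_except_def prime_gt_0_nat)

lemma Zhat_residue_unique: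
  assumes m: "prime_to_char p m"
    and "0 \<le> c" "c < int m" "\<And>q. q \<in> primes_except p \<Longrightarrow> c mod int (q ^ multiplicity q m) = u q"
    and "0 \<le> d" "d < int m" "\<And>q. q \<in> primes_except p \<Longrightarrow> d mod int (q ^ multiplicity q m) = u q"
  shows "c = d"
proof -
  have "int m dvd c - d"
    by (rule prime_to_char_dvd_int[OF m]) (metis assms(4,7) mod_eq_dvd_iff)
  then have "c mod int m = d mod int m" by (simp add: mod_eq_dvd_iff)
  then show ?thesis using assms by simp
qed

lemma Zhat_residue:
  assumes a: "a \<in> carrier (Zhat_group p)" and m: "prime_to_char p m"
  shows Zhat_residue_range: "0 \<le> Zhat_residue p a m" "Zhat_residue p a m < int m"
    and Zhat_residue_mod: "\<And>q. q \<in> primes_except p \<Longrightarrow>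
      Zhat_residue p a m mod int (q ^ multiplicity q m) = a q (multiplicity q m)"
proof -
  have m0: "m > 0" using m by (auto simp: prime_to_char_def)
  let ?e = "\<lambda>q. multiplicity q m"
  have "\<exists>x. \<forall>q\<in>prime_factors m. [x = nat (a q (?e q))] (mod q ^ ?e q)"
    by (rule chinese_remainder_nat) (auto simp: in_prime_factors_iff primes_coprime coprime_power_left_iff
      coprime_power_right_iff)
  then obtain x where x: "\<And>q. q \<in> prime_factors m \<Longrightarrow> [x = nat (a q (?e q))] (mod q ^ ?e q)" by auto
  define c where "c = int (x mod m)"
  have c: "c mod int (q ^ ?e q) = a q (?e q)" if q: "q \<in> primes_except p" for q
  proof -
    note aq = Zhat_memD[OF a q]
    note r = padic_int_memD[of "a q" q "?e q"]
    show ?thesis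
    proof (cases "q dvd m")
      case True
      then have "q \<in> prime_factors m" using aq m0 by (auto simp: in_prime_factors_iff)
      then have "x mod q ^ ?e q = nat (a q (?e q)) mod q ^ ?e q" using x by (simp add: cong_def)
      also have "\<dots> = nat (a q (?e q))" using r aq by (simp add: nat_less_iff)
      finally have "x mod m mod q ^ ?e q = nat (a q (?e q))"
        by (simp add: mod_mod_cancel multiplicity_dvd)
      then show ?thesis unfolding c_def using r(1) aq
        by (metis int_nat_eq zmod_int)
    next
      case False
      then have "?e q = 0" by (simp add: not_dvd_imp_multiplicity_0)
      then show ?thesis using r aq by (simp)
    qed
  qed
  have "\<exists>!c. 0 \<le> c \<and> c < int m \<and> (\<forall>q\<in>primes_except p. c mod int (q ^ ?e q) = a q (?e q))"
  proof (rule ex1I[of _ c])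
    show "0 \<le> c \<and> c < int m \<and> (\<forall>q\<in>primes_except p. c mod int (q ^ ?e q) = a q (?e q))"
      using c m0 by (auto simp: c_def)
  next
    fix d assume d: "0 \<le> d \<and> d < int m \<and> (\<forall>q\<in>primes_except p. d mod int (q ^ ?e q) = a q (?e q))"
    show "d = c"
      by (rule Zhat_residue_unique[OF m, where u = "\<lambda>q. a q (?e q)"]) (use d c m0 in \<open>auto simp: c_def\<close>)
  qed
  from theI'[OF this] show "0 \<le> Zhat_residue p a m" "Zhat_residue p a m < int m"
    "\<And>q. q \<in> primes_except p \<Longrightarrow>
      Zhat_residue p a m mod int (q ^ multiplicity q m) = a q (multiplicity q m)"
    unfolding Zhat_residue_def by auto
qed

lemma Zhat_residue_eqI:
  assumes a: "a \<in> carrier (Zhat_group p)" and m: "prime_to_char p m"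
    and c: "\<And>q. q \<in> primes_except p \<Longrightarrow> c mod int (q ^ multiplicity q m) = a q (multiplicity q m)"
  shows "Zhat_residue p a m = c mod int m"
proof (rule Zhat_residue_unique[OF m, where u = "\<lambda>q. a q (multiplicity q m)"])
  have "m > 0" using m by (auto simp: prime_to_char_def)
  then show "0 \<le> c mod int m" "c mod int m < int m" by auto
  fix q assume q: "q \<in> primes_except p"
  show "c mod int m mod int (q ^ multiplicity q m) = a q (multiplicity q m)"
    using c[OF q] by (simp add: mod_mod_cancel multiplicity_dvd flip: of_nat_power)
qed (use Zhat_residue[OF a m] in auto)

lemma Zhat_residue_dvd:
  assumes a: "a \<in> carrier (Zhat_group p)" and m: "prime_to_char p m" and d: "d dvd m"
  shows "Zhat_residue p a d = Zhat_residue p a m mod int d"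
proof (rule Zhat_residue_eqI[OF a prime_to_char_dvd[OF m d]])
  fix q assume q: "q \<in> primes_except p"
  note aq = Zhat_memD[OF a q]
  have le: "multiplicity q d \<le> multiplicity q m"
    using d m by (intro dvd_imp_multiplicity_le) (auto simp: prime_to_char_def)
  have "Zhat_residue p a m mod int (q ^ multiplicity q m) mod int (q ^ multiplicity q d)
      = Zhat_residue p a m mod int (q ^ multiplicity q d)"
    using le by (intro mod_mod_cancel) (simp add: le_imp_power_dvd)
  then show "Zhat_residue p a m mod int (q ^ multiplicity q d) = a q (multiplicity q d)"
    using Zhat_residue(3)[OF a m q] padic_int_memD(3)[OF _ _ le] aq by auto
qed

lemma Zhat_group_mult_apply:
  "q \<in> primes_except p \<Longrightarrow> (a \<otimes>\<^bsub>Zhat_group p\<^esub> b) q j = (a q j + b q j) mod int (q ^ j)"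
  by (auto simp: Zhat_group_def primes_except_def product_group_def padic_int_group_def
     integer_mod_group_def prime_gt_0_nat)

lemma Zhat_group_mult_closed:
  assumes "a \<in> carrier (Zhat_group p)" "b \<in> carrier (Zhat_group p)"
  shows "a \<otimes>\<^bsub>Zhat_group p\<^esub> b \<in> carrier (Zhat_group p)"
proof -
  have "a q \<otimes>\<^bsub>padic_int_group q\<^esub> b q \<in> carrier (padic_int_group q)" if q: "q \<in> primes_except p" for q
  proof -
    have q0: "q > 0" and p: "Factorial_Ring.prime q" using Zhat_memD[OF assms(1) q] by auto
    have ab: "(a q \<otimes>\<^bsub>padic_int_group q\<^esub> b q) j = (a q j + b q j) mod int (q ^ j)" for j
      using q0 by (simp add: padic_int_group_def product_group_def integer_mod_group_def)
    have *: "(a q j + b q j) mod int (q ^ j) mod int (q ^ i) = (a q i + b q i) mod int (q ^ i)"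
      if "i \<le> j" for i j
    proof -
      have "(a q j + b q j) mod int (q ^ j) mod int (q ^ i) = (a q j + b q j) mod int (q ^ i)"
        using that by (intro mod_mod_cancel) (simp add: le_imp_power_dvd)
      also have "\<dots> = (a q j mod int (q ^ i) + b q j mod int (q ^ i)) mod int (q ^ i)"
        by (simp add: mod_add_eq)
      also have "\<dots> = (a q i + b q i) mod int (q ^ i)"
        using that padic_int_memD(3) Zhat_memD[OF assms(1) q] Zhat_memD[OF assms(2) q] by simp
      finally show ?thesis .
    qed
    show ?thesis unfolding padic_int_group_def[of q]
      using * q0 ab by (auto simp: carrier_integer_mod_group padic_int_group_def)
  qed
  then show ?thesis using assms by (auto simp: Zhat_group_def)
qed

lemma Zhat_residue_mult:
  assumes a: "a \<in> carrier (Zhat_group p)" and b: "b \<in> carrier (Zhat_group p)"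
    and m: "prime_to_char p m"
  shows "Zhat_residue p (a \<otimes>\<^bsub>Zhat_group p\<^esub> b) m = (Zhat_residue p a m + Zhat_residue p b m) mod int m"
proof (rule Zhat_residue_eqI[OF Zhat_group_mult_closed[OF a b] m])
  fix q assume q: "q \<in> primes_except p"
  show "(Zhat_residue p a m + Zhat_residue p b m) mod int (q ^ multiplicity q m) =
      (a \<otimes>\<^bsub>Zhat_group p\<^esub> b) q (multiplicity q m)"
    unfolding Zhat_group_mult_apply[OF q] Zhat_residue(3)[OF a m q, symmetric]
      Zhat_residue(3)[OF b m q, symmetric] by (simp only: mod_add_eq)
qed

lemma Zloc_carrier: "x \<in> carrier (Zloc_group p) \<longleftrightarrow> (\<exists>m. prime_to_char p m \<and> of_nat m * x \<in> \<int>)"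
proof
  assume "\<exists>m. prime_to_char p m \<and> of_nat m * x \<in> \<int>"
  then obtain m r where mr: "prime_to_char p m" "of_nat m * x = of_int r" by (auto elim: Ints_cases)
  then have "m > 0" by (simp add: prime_to_char_def)
  then have "x = of_int r / of_nat m" using mr(2) by (simp add: eq_divide_eq mult.commute)
  then show "x \<in> carrier (Zloc_group p)"
    unfolding Zloc_group_def using mr(1) by auto
next
  assume "x \<in> carrier (Zloc_group p)"
  then obtain r m where rm: "x = of_int r / of_nat m" "prime_to_char p m"
    unfolding Zloc_group_def by auto
  then have "m > 0" by (simp add: prime_to_char_def)
  then have "of_nat m * x = of_int r" using rm(1) by simp
  then show "\<exists>m. prime_to_char p m \<and> of_nat m * x \<in> \<int>" using rm(2) by (metis Ints_of_int)
qed

lemma Zloc_common: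
  assumes "x \<in> carrier (Zloc_group p)" "y \<in> carrier (Zloc_group p)"
  obtains m where "prime_to_char p m" "of_nat m * x \<in> \<int>" "of_nat m * y \<in> \<int>"
proof -
  obtain k l where k: "prime_to_char p k" "of_nat k * x \<in> \<int>" and l: "prime_to_char p l" "of_nat l * y \<in> \<int>"
    using assms by (auto simp: Zloc_carrier)
  have "of_nat (k * l) * x \<in> \<int>" "of_nat (k * l) * y \<in> \<int>"
    using Ints_mult[OF Ints_of_nat[of l] k(2)] Ints_mult[OF Ints_of_nat[of k] l(2)] by (auto simp: mult_ac)
  with prime_to_char_mult[OF k(1) l(1)] show ?thesis using that by blast
qed

lemma Zloc_add:
  assumes "x \<in> carrier (Zloc_group p)" "y \<in> carrier (Zloc_group p)"
  shows "x + y \<in> carrier (Zloc_group p)"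
proof -
  obtain m where m: "prime_to_char p m" "of_nat m * x \<in> \<int>" "of_nat m * y \<in> \<int>"
    using Zloc_common[OF assms] .
  have "of_nat m * (x + y) \<in> \<int>" unfolding distrib_left using m(2,3) by (rule Ints_add)
  then show ?thesis unfolding Zloc_carrier using m(1) by blast
qed

lemma Zloc_Ints: "x \<in> \<int> \<Longrightarrow> x \<in> carrier (Zloc_group p)"
  unfolding Zloc_carrier by (rule exI[of _ 1]) (auto simp: prime_to_char_def)

lemma Zloc_int_mult:
  assumes "x \<in> carrier (Zloc_group p)"
  shows "of_int c * x \<in> carrier (Zloc_group p)"
proof -
  obtain m where m: "prime_to_char p m" "of_nat m * x \<in> \<int>" using assms unfolding Zloc_carrier by blast
  have "of_int c * (of_nat m * x) \<in> \<int>" by (rule Ints_mult[OF Ints_of_int m(2)])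
  then have "of_nat m * (of_int c * x) \<in> \<int>" by (simp only: mult.left_commute)
  then show ?thesis unfolding Zloc_carrier using m(1) by blast
qed

lemma Zloc_mult: "x \<otimes>\<^bsub>Zloc_group p\<^esub> y = x + y"
  by (simp add: Zloc_group_def)

lemma Zloc_one: "\<one>\<^bsub>Zloc_group p\<^esub> = 0"
  by (simp add: Zloc_group_def)

lemma Zloc_comm_group: "comm_group (Zloc_group p)"
proof (rule comm_groupI)
  fix x assume x: "x \<in> carrier (Zloc_group p)"
  have "-x \<in> carrier (Zloc_group p)" using Zloc_int_mult[OF x, of "-1"] by simp
  moreover have "- x \<otimes>\<^bsub>Zloc_group p\<^esub> x = \<one>\<^bsub>Zloc_group p\<^esub>" unfolding Zloc_mult Zloc_one by simp
  ultimately show "\<exists>y\<in>carrier (Zloc_group p). y \<otimes>\<^bsub>Zloc_group p\<^esub> x = \<one>\<^bsub>Zloc_group p\<^esub>" by blast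
next
  show "\<one>\<^bsub>Zloc_group p\<^esub> \<in> carrier (Zloc_group p)"
    unfolding Zloc_one by (rule Zloc_Ints) simp
next
  fix x y assume "x \<in> carrier (Zloc_group p)" "y \<in> carrier (Zloc_group p)"
  from Zloc_add[OF this] show "x \<otimes>\<^bsub>Zloc_group p\<^esub> y \<in> carrier (Zloc_group p)" unfolding Zloc_mult .
next
  fix x y z assume "x \<in> carrier (Zloc_group p)" "y \<in> carrier (Zloc_group p)" "z \<in> carrier (Zloc_group p)"
  show "x \<otimes>\<^bsub>Zloc_group p\<^esub> y \<otimes>\<^bsub>Zloc_group p\<^esub> z = x \<otimes>\<^bsub>Zloc_group p\<^esub> (y \<otimes>\<^bsub>Zloc_group p\<^esub> z)"
    unfolding Zloc_mult by (rule add.assoc)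
next
  fix x y assume "x \<in> carrier (Zloc_group p)" "y \<in> carrier (Zloc_group p)"
  show "x \<otimes>\<^bsub>Zloc_group p\<^esub> y = y \<otimes>\<^bsub>Zloc_group p\<^esub> x"
    unfolding Zloc_mult by (rule add.commute)
next
  fix x assume "x \<in> carrier (Zloc_group p)"
  show "\<one>\<^bsub>Zloc_group p\<^esub> \<otimes>\<^bsub>Zloc_group p\<^esub> x = x"
    unfolding Zloc_mult Zloc_one by (rule add_0_left)
qed

lemma Zloc_inv: 
  assumes x: "x \<in> carrier (Zloc_group p)"
  shows "inv\<^bsub>Zloc_group p\<^esub> x = - x"
proof (rule group.inv_equality[OF _ _ x])
  show "group (Zloc_group p)" by (rule comm_group.axioms(2)[OF Zloc_comm_group])
  show "- x \<otimes>\<^bsub>Zloc_group p\<^esub> x = \<one>\<^bsub>Zloc_group p\<^esub>" unfolding Zloc_mult Zloc_one by simp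
  show "- x \<in> carrier (Zloc_group p)" using Zloc_int_mult[OF x, of "-1"] by simp
qed

lemma Ints_normal: "\<int> \<lhd> Zloc_group p"
proof (rule comm_group.subgroup_imp_normal[OF Zloc_comm_group])
  show "subgroup \<int> (Zloc_group p)"
  proof (rule group.subgroupI)
    show "group (Zloc_group p)" by (rule comm_group.axioms(2)[OF Zloc_comm_group])
    show "\<int> \<subseteq> carrier (Zloc_group p)" using Zloc_Ints by blast
    show "\<int> \<noteq> ({} :: rat set)" using Ints_0 by blast
  next
    fix x :: rat assume "x \<in> \<int>"
    then show "inv\<^bsub>Zloc_group p\<^esub> x \<in> \<int>" unfolding Zloc_inv[OF Zloc_Ints[OF \<open>x \<in> \<int>\<close>]] by (rule Ints_minus)
  next
    fix x y :: rat assume "x \<in> \<int>" "y \<in> \<int>"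
    then show "x \<otimes>\<^bsub>Zloc_group p\<^esub> y \<in> \<int>" unfolding Zloc_mult by (rule Ints_add)
  qed
qed

lemma coset_in_Mod: "x \<in> carrier (Zloc_group p) \<Longrightarrow> \<int> #>\<^bsub>Zloc_group p\<^esub> x \<in> carrier (Zloc_group p Mod \<int>)"
  unfolding FactGroup_def RCOSETS_def by auto

lemma at_class_add:
  assumes th: "root_isomorphism (\<theta> :: rat set \<Rightarrow> 'k::field)"
    and x: "x \<in> carrier (Zloc_group CHAR('k))" and y: "y \<in> carrier (Zloc_group CHAR('k))"
  shows "at_class \<theta> (x + y) = at_class \<theta> x * at_class \<theta> y"
proof -
  have h: "\<theta> \<in> hom (Zloc_group CHAR('k) Mod \<int>) roots_of_unity_group"
    using th unfolding root_isomorphism_def iso_def by blast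
  have "(\<int> #>\<^bsub>Zloc_group CHAR('k)\<^esub> x) <#>\<^bsub>Zloc_group CHAR('k)\<^esub> (\<int> #>\<^bsub>Zloc_group CHAR('k)\<^esub> y) = \<int> #>\<^bsub>Zloc_group CHAR('k)\<^esub> (x + y)"
    using normal.rcos_sum[OF Ints_normal x y] unfolding Zloc_mult .
  then have "\<int> #>\<^bsub>Zloc_group CHAR('k)\<^esub> (x + y) = 
     (\<int> #>\<^bsub>Zloc_group CHAR('k)\<^esub> x) \<otimes>\<^bsub>Zloc_group CHAR('k) Mod \<int>\<^esub> (\<int> #>\<^bsub>Zloc_group CHAR('k)\<^esub> y)"
    unfolding FactGroup_def by simp
  then have "at_class \<theta> (x + y) = at_class \<theta> x \<otimes>\<^bsub>roots_of_unity_group\<^esub> at_class \<theta> y"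
    unfolding at_class_def using hom_mult[OF h coset_in_Mod[OF x] coset_in_Mod[OF y]] by simp
  then show ?thesis by (simp add: roots_of_unity_group_def)
qed

lemma at_class_root:
  assumes th: "root_isomorphism (\<theta> :: rat set \<Rightarrow> 'k::field)"
    and x: "x \<in> carrier (Zloc_group CHAR('k))"
  shows "\<exists>m::nat. m > 0 \<and> at_class \<theta> x ^ m = 1" "at_class \<theta> x \<noteq> 0"
proof -
  have h: "\<theta> \<in> hom (Zloc_group CHAR('k) Mod \<int>) roots_of_unity_group"
    using th unfolding root_isomorphism_def iso_def by blast
  show *: "\<exists>m::nat. m > 0 \<and> at_class \<theta> x ^ m = 1"
    using hom_in_carrier[OF h coset_in_Mod[OF x]]
    unfolding at_class_def roots_of_unity_group_def by simp
  then show "at_class \<theta> x \<noteq> 0" by (auto simp: power_0_left)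
qed

lemma at_class_0: "root_isomorphism (\<theta> :: rat set \<Rightarrow> 'k::field) \<Longrightarrow> at_class \<theta> 0 = 1"
  using at_class_add[of \<theta> 0 0] at_class_root(2)[of \<theta> 0] Zloc_Ints[of 0]
  by auto

lemma at_class_Ints:
  assumes th: "root_isomorphism (\<theta> :: rat set \<Rightarrow> 'k::field)" and x: "x \<in> \<int>"
  shows "at_class \<theta> x = 1"
proof -
  have g: "group (Zloc_group CHAR('k))" by (rule comm_group.axioms(2)[OF Zloc_comm_group])
  have s: "subgroup \<int> (Zloc_group CHAR('k))" using Ints_normal normal_imp_subgroup by blast
  have "\<int> #>\<^bsub>Zloc_group CHAR('k)\<^esub> x = \<int>" "\<int> #>\<^bsub>Zloc_group CHAR('k)\<^esub> 0 = \<int>"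
    using group.coset_join2[OF g Zloc_Ints[OF x] s x] group.coset_join2[OF g Zloc_Ints[OF Ints_0] s Ints_0] by blast+
  then show ?thesis using at_class_0[OF th] by (simp add: at_class_def)
qed

lemma Zhat_character_eq:
  fixes \<theta> :: "rat set \<Rightarrow> 'k::field"
  assumes th: "root_isomorphism \<theta>"
    and a: "a \<in> carrier (Zhat_group CHAR('k))"
    and m: "prime_to_char CHAR('k) m" and mx: "of_nat m * x \<in> \<int>"
    and c: "c mod int m = Zhat_residue CHAR('k) a m"
  shows "Zhat_character \<theta> a x = at_class \<theta> (of_int c * x)"
proof -
  obtain r d where rd: "quotient_of x = (r, d)" by force
  have d: "d > 0" "coprime r d" "x = of_int r / of_int d"
    using rd quotient_of_denom_pos quotient_of_coprime quotient_of_div by auto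
  have xZ: "x \<in> carrier (Zloc_group CHAR('k))" using m mx by (auto simp: Zloc_carrier)
  obtain k where "of_nat m * x = of_int k" using mx by (auto elim: Ints_cases)
  then have "of_int (int m * r) = (of_int (k * d) :: rat)" using d by (simp add: field_simps)
  then have "int m * r = k * d" by (simp only: of_int_eq_iff)
  then have "d dvd int m" using d(2) by (metis coprime_commute coprime_dvd_mult_left_iff dvd_triv_right)
  then have dm: "nat d dvd m" using d(1) by (metis int_dvd_int_iff int_nat_eq less_imp_le)
  let ?s = "Zhat_residue CHAR('k) a (nat d)"
  have "?s = c mod int m mod d" using Zhat_residue_dvd[OF a m dm] c d by simp
  also have "\<dots> = c mod d" using \<open>d dvd int m\<close> by (simp add: mod_mod_cancel)
  finally have s: "of_int c = (of_int ?s + of_int (c div d) * of_int d :: rat)"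
    by (metis add.commute div_mult_mod_eq of_int_add of_int_mult)
  have "of_int (c div d) * (of_int d * x) \<in> \<int>" using d by auto
  then have i: "(of_int (c div d) * of_int d) * x \<in> \<int>" by (simp add: mult_ac)
  have "at_class \<theta> (of_int c * x) = at_class \<theta> (of_int ?s * x) * at_class \<theta> (of_int (c div d) * of_int d * x)"
    unfolding s by (subst at_class_add[OF th, symmetric])
      (use xZ i in \<open>auto simp: Zloc_int_mult Zloc_Ints distrib_right\<close>)
  then show ?thesis using at_class_Ints[OF th i] by (simp add: Zhat_character_def rd)
qed

lemma Zhat_character_add:
  fixes \<theta> :: "rat set \<Rightarrow> 'k::field"
  assumes th: "root_isomorphism \<theta>"
    and a: "a \<in> carrier (Zhat_group CHAR('k))"
    and x: "x \<in> carrier (Zloc_group CHAR('k))" and y: "y \<in> carrier (Zloc_group CHAR('k))"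
  shows "Zhat_character \<theta> a (x + y) = Zhat_character \<theta> a x * Zhat_character \<theta> a y"
proof -
  obtain m where m: "prime_to_char CHAR('k) m" "of_nat m * x \<in> \<int>" "of_nat m * y \<in> \<int>"
    using Zloc_common[OF x y] .
  then have "of_nat m * (x + y) \<in> \<int>" by (simp add: distrib_left)
  then show ?thesis
    using m Zhat_character_eq[OF th a m(1), of _ "Zhat_residue CHAR('k) a m"] Zhat_residue(1,2)[OF a m(1)]
    by (simp add: distrib_left at_class_add[OF th] Zloc_int_mult x y)
qed

lemma Zhat_character_mult:
  fixes \<theta> :: "rat set \<Rightarrow> 'k::field"
  assumes th: "root_isomorphism \<theta>"
    and a: "a \<in> carrier (Zhat_group CHAR('k))" and b: "b \<in> carrier (Zhat_group CHAR('k))"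
    and x: "x \<in> carrier (Zloc_group CHAR('k))"
  shows "Zhat_character \<theta> (a \<otimes>\<^bsub>Zhat_group CHAR('k)\<^esub> b) x = Zhat_character \<theta> a x * Zhat_character \<theta> b x"
proof -
  obtain m where m: "prime_to_char CHAR('k) m" "of_nat m * x \<in> \<int>" 
    using x by (auto simp: Zloc_carrier)
  let ?r = "\<lambda>a. Zhat_residue CHAR('k) a m"
  have "Zhat_character \<theta> (a \<otimes>\<^bsub>Zhat_group CHAR('k)\<^esub> b) x = at_class \<theta> (of_int (?r a + ?r b) * x)"
    by (rule Zhat_character_eq[OF th Zhat_group_mult_closed[OF a b] m])
       (simp add: Zhat_residue_mult[OF a b m(1)])
  also have "\<dots> = at_class \<theta> (of_int (?r a) * x) * at_class \<theta> (of_int (?r b) * x)"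
    by (simp add: distrib_right at_class_add[OF th] Zloc_int_mult x)
  also have "\<dots> = Zhat_character \<theta> a x * Zhat_character \<theta> b x"
    using Zhat_character_eq[OF th a m, of "?r a"] Zhat_character_eq[OF th b m, of "?r b"]
      Zhat_residue(1,2)[OF a m(1)] Zhat_residue(1,2)[OF b m(1)] by simp
  finally show ?thesis .
qed

definition Zhat_one :: "nat \<Rightarrow> nat \<Rightarrow> nat \<Rightarrow> int"
  where "Zhat_one p = (\<lambda>q\<in>primes_except p. \<lambda>j. 1 mod int (q ^ j))"

lemma Zhat_one_mem: "Zhat_one p \<in> carrier (Zhat_group p)"
  by (auto simp: Zhat_one_def Zhat_group_def padic_int_group_def primes_except_def
     carrier_integer_mod_group prime_gt_0_nat mod_mod_cancel le_imp_power_dvd simp flip: of_nat_power)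

lemma Zhat_character_one:
  fixes \<theta> :: "rat set \<Rightarrow> 'k::field"
  assumes th: "root_isomorphism \<theta>" and x: "x \<in> carrier (Zloc_group CHAR('k))"
  shows "Zhat_character \<theta> (Zhat_one CHAR('k)) x = at_class \<theta> x"
proof -
  obtain m where m: "prime_to_char CHAR('k) m" "of_nat m * x \<in> \<int>" 
    using x by (auto simp: Zloc_carrier)
  have "Zhat_residue CHAR('k) (Zhat_one CHAR('k)) m = 1 mod int m"
    by (rule Zhat_residue_eqI[OF Zhat_one_mem m(1)]) (simp add: Zhat_one_def)
  then show ?thesis using Zhat_character_eq[OF th Zhat_one_mem m, of 1] by simp
qed

lemma E_carrier:
  "(f :: 'k::field genpoly) \<in> carrier (E_ring n) \<longleftrightarrow>
    (\<forall>v\<in>Poly_Mapping.keys f. Poly_Mapping.keys v \<subseteq> {1..n} \<and>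
       (\<forall>i. Poly_Mapping.lookup v i \<in> carrier (Zloc_group CHAR('k))))" (is "?L \<longleftrightarrow> ?R")
proof
  assume ?L
  then show ?R by (auto simp: E_ring_def laurent_ring_def Zloc_carrier)
next
  assume R: ?R
  define D where "D = (\<Union>v\<in>Poly_Mapping.keys f. Poly_Mapping.lookup v ` Poly_Mapping.keys v)"
  have fin: "finite D" by (auto simp: D_def)
  have D: "x \<in> carrier (Zloc_group CHAR('k))" if "x \<in> D" for x using R that by (auto simp: D_def)
  have "finite A \<Longrightarrow> A \<subseteq> D \<Longrightarrow> \<exists>s. prime_to_char CHAR('k) s \<and> (\<forall>x\<in>A. of_nat s * x \<in> \<int>)" for A
  proof (induction A rule: finite_induct)
    case empty
    show ?case by (rule exI[of _ 1]) (simp add: prime_to_char_def)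
  next
    case (insert x A)
    then obtain s where s: "prime_to_char CHAR('k) s" "\<forall>x\<in>A. of_nat s * x \<in> \<int>" by auto
    obtain m where m: "prime_to_char CHAR('k) m" "of_nat m * x \<in> \<int>"
      using D[of x] insert.prems unfolding Zloc_carrier by auto
    have "of_nat (s * m) * y \<in> \<int>" if "y \<in> insert x A" for y
    proof (cases "y = x")
      case True
      then show ?thesis using Ints_mult[OF Ints_of_nat[of s] m(2)] by (simp add: mult.assoc)
    next
      case False
      then have "of_nat s * y \<in> \<int>" using that s(2) by auto
      from Ints_mult[OF Ints_of_nat[of m] this] show ?thesis by (simp add: mult_ac)
    qed
    then show ?case using prime_to_char_mult[OF s(1) m(1)] by blast
  qed
  from this[OF fin] obtain s where s: "prime_to_char CHAR('k) s" "\<forall>x\<in>D. of_nat s * x \<in> \<int>" by auto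
  have "of_nat s * Poly_Mapping.lookup v i \<in> \<int>" if "v \<in> Poly_Mapping.keys f" for v i
  proof (cases "i \<in> Poly_Mapping.keys v")
    case True
    then show ?thesis using s(2) that by (auto simp: D_def)
  qed (simp add: in_keys_iff)
  then show ?L using R s(1) by (auto simp: E_ring_def laurent_ring_def)
qed

definition Gamma_character :: "nat \<Rightarrow> (rat set \<Rightarrow> 'k::field) \<Rightarrow> (nat \<Rightarrow> nat \<Rightarrow> nat \<Rightarrow> int) \<Rightarrow> (nat \<Rightarrow>\<^sub>0 rat) \<Rightarrow> 'k"
  where "Gamma_character n \<theta> a v = (\<Prod>i=1..n. Zhat_character \<theta> (a i) (Poly_Mapping.lookup v i))"

lemma lookup_Gamma_action: "Poly_Mapping.lookup (Gamma_action n \<theta> a f) v = Gamma_character n \<theta> a v * Poly_Mapping.lookup f v"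
  by (simp add: Gamma_action_def Gamma_character_def Poly_Mapping.lookup_mapp when_def in_keys_iff)

lemma Gamma_action_plus: "Gamma_action n \<theta> a (f + g) = Gamma_action n \<theta> a f + Gamma_action n \<theta> a g"
  by (rule poly_mapping_eqI) (simp add: lookup_Gamma_action lookup_add distrib_left)

lemma Gamma_action_scale:
  "Gamma_action n \<theta> a (Poly_Mapping.map ((*) c) f) = Poly_Mapping.map ((*) c) (Gamma_action n \<theta> a f)"
  by (rule poly_mapping_eqI) (simp add: lookup_Gamma_action Poly_Mapping.map.rep_eq when_def mult_ac)

lemma Gamma_action_single: "Gamma_action n \<theta> a (Poly_Mapping.single v c) = Poly_Mapping.single v (Gamma_character n \<theta> a v * c)"
  by (rule poly_mapping_eqI) (simp add: lookup_Gamma_action lookup_single when_def)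

lemma Gamma_action_sum: "Gamma_action n \<theta> a (sum f A) = (\<Sum>x\<in>A. Gamma_action n \<theta> a (f x))"
proof (induction A rule: infinite_finite_induct)
  case (insert x A)
  then show ?case by (simp add: Gamma_action_plus)
qed (auto intro!: poly_mapping_eqI simp: lookup_Gamma_action)

lemma sum_monomials: "f = (\<Sum>v\<in>Poly_Mapping.keys f. Poly_Mapping.single v (Poly_Mapping.lookup f v))"
proof -
  have *: "finite I \<Longrightarrow> Poly_Mapping.lookup (\<Sum>v\<in>I. Poly_Mapping.single v (Poly_Mapping.lookup f v)) w = (if w \<in> I then Poly_Mapping.lookup f w else 0)" for I w
    by (induction I rule: finite_induct) (auto simp: lookup_single lookup_add when_def)
  show ?thesis by (rule poly_mapping_eqI) (simp add: * in_keys_iff)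
qed

lemma Gamma_character_add:
  fixes \<theta> :: "rat set \<Rightarrow> 'k::field"
  assumes th: "root_isomorphism \<theta>"
    and a: "a \<in> carrier (Gamma_group n CHAR('k))"
    and v: "\<And>i. Poly_Mapping.lookup v i \<in> carrier (Zloc_group CHAR('k))" and w: "\<And>i. Poly_Mapping.lookup w i \<in> carrier (Zloc_group CHAR('k))"
  shows "Gamma_character n \<theta> a (v + w) = Gamma_character n \<theta> a v * Gamma_character n \<theta> a w"
proof -
  have "a i \<in> carrier (Zhat_group CHAR('k))" if "i \<in> {1..n}" for i
    using a that unfolding Gamma_group_def by auto
  then show ?thesis unfolding Gamma_character_def
    by (simp add: lookup_add Zhat_character_add[OF th _ v w] prod.distrib)
qed

lemma Gamma_character_mult:
  fixes \<theta> :: "rat set \<Rightarrow> 'k::field"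
  assumes th: "root_isomorphism \<theta>"
    and a: "a \<in> carrier (Gamma_group n CHAR('k))" and b: "b \<in> carrier (Gamma_group n CHAR('k))"
    and v: "\<And>i. Poly_Mapping.lookup v i \<in> carrier (Zloc_group CHAR('k))"
  shows "Gamma_character n \<theta> (a \<otimes>\<^bsub>Gamma_group n CHAR('k)\<^esub> b) v = Gamma_character n \<theta> a v * Gamma_character n \<theta> b v"
proof -
  have m: "a i \<in> carrier (Zhat_group CHAR('k))" "b i \<in> carrier (Zhat_group CHAR('k))" if "i \<in> {1..n}" for i
    using a b that unfolding Gamma_group_def by auto
  have "(a \<otimes>\<^bsub>Gamma_group n CHAR('k)\<^esub> b) i = a i \<otimes>\<^bsub>Zhat_group CHAR('k)\<^esub> b i" if "i \<in> {1..n}" for i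
    using that unfolding Gamma_group_def by simp
  then show ?thesis unfolding Gamma_character_def
    by (simp add: Zhat_character_mult[OF th m v] prod.distrib)
qed

lemma Gamma_action_times:
  fixes \<theta> :: "rat set \<Rightarrow> 'k::field"
  assumes th: "root_isomorphism \<theta>"
    and a: "a \<in> carrier (Gamma_group n CHAR('k))"
    and f: "f \<in> carrier (E_ring n)" and g: "g \<in> carrier (E_ring n)"
  shows "Gamma_action n \<theta> a (f * g) = Gamma_action n \<theta> a f * Gamma_action n \<theta> a g"
proof -
  let ?m = "\<lambda>f v. Poly_Mapping.single v (Poly_Mapping.lookup f v)"
  have fg: "f * g = (\<Sum>v\<in>Poly_Mapping.keys f. \<Sum>w\<in>Poly_Mapping.keys g. ?m f v * ?m g w)"
    unfolding sum_product[symmetric] by (simp flip: sum_monomials)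
  have "Gamma_action n \<theta> a (f * g) = (\<Sum>v\<in>Poly_Mapping.keys f. \<Sum>w\<in>Poly_Mapping.keys g.
      Gamma_action n \<theta> a (?m f v * ?m g w))"
    unfolding fg by (simp only: Gamma_action_sum)
  also have "\<dots> = (\<Sum>v\<in>Poly_Mapping.keys f. \<Sum>w\<in>Poly_Mapping.keys g.
      Gamma_action n \<theta> a (?m f v) * Gamma_action n \<theta> a (?m g w))"
  proof (intro sum.cong refl)
    fix v w assume v: "v \<in> Poly_Mapping.keys f" and w: "w \<in> Poly_Mapping.keys g"
    have "Gamma_character n \<theta> a (v + w) = Gamma_character n \<theta> a v * Gamma_character n \<theta> a w"
      by (rule Gamma_character_add[OF th a]) (use f g v w in \<open>unfold E_carrier, blast+\<close>)
    then show "Gamma_action n \<theta> a (?m f v * ?m g w) = Gamma_action n \<theta> a (?m f v) * Gamma_action n \<theta> a (?m g w)"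
      by (simp add: mult_single Gamma_action_single mult_ac)
  qed
  also have "\<dots> = Gamma_action n \<theta> a (\<Sum>v\<in>Poly_Mapping.keys f. ?m f v) * Gamma_action n \<theta> a (\<Sum>w\<in>Poly_Mapping.keys g. ?m g w)"
    by (simp add: Gamma_action_sum sum_product)
  finally show ?thesis by (simp flip: sum_monomials)
qed

lemma inj_map_key:
  assumes "bij \<sigma>"
  shows "inj (Poly_Mapping.map_key \<sigma> :: (nat \<Rightarrow>\<^sub>0 rat) \<Rightarrow> _)"
proof (rule injI)
  fix v w :: "nat \<Rightarrow>\<^sub>0 rat" assume eq: "Poly_Mapping.map_key \<sigma> v = Poly_Mapping.map_key \<sigma> w"
  have "Poly_Mapping.lookup v i = Poly_Mapping.lookup w i" for i
  proof -
    obtain j where "i = \<sigma> j" using assms by (meson bij_pointE)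
    then show ?thesis using arg_cong[OF eq, of "\<lambda>v. Poly_Mapping.lookup v j"] assms
      by (simp add: map_key.rep_eq bij_is_inj)
  qed
  then show "v = w" by (rule poly_mapping_eqI)
qed

lemma lookup_Sigma_action:
  assumes "bij \<sigma>"
  shows "Poly_Mapping.lookup (Sigma_action \<sigma> f) v = Poly_Mapping.lookup f (Poly_Mapping.map_key \<sigma> v)"
  unfolding Sigma_action_def using inj_map_key[OF assms] by (simp add: map_key.rep_eq)

lemma Sigma_Gamma_commute:
  assumes s: "\<sigma> permutes {1..n}"
  shows "Sigma_action \<sigma> (Gamma_action n \<theta> b f) = Gamma_action n \<theta> (permute_factors n \<sigma> b) (Sigma_action \<sigma> f)"
proof (rule poly_mapping_eqI)
  fix v
  have bij: "bij \<sigma>" using s by (rule permutes_bij)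
  have "Gamma_character n \<theta> (permute_factors n \<sigma> b) v = (\<Prod>i\<in>{1..n}. Zhat_character \<theta> (b (Hilbert_Choice.inv \<sigma> i)) (Poly_Mapping.lookup v i))"
    by (simp add: Gamma_character_def permute_factors_def)
  also have "\<dots> = (\<Prod>i\<in>{1..n}. Zhat_character \<theta> (b (Hilbert_Choice.inv \<sigma> (\<sigma> i))) (Poly_Mapping.lookup v (\<sigma> i)))"
    by (rule prod.reindex_bij_betw[symmetric]) (rule permutes_imp_bij[OF s])
  also have "\<dots> = Gamma_character n \<theta> b (Poly_Mapping.map_key \<sigma> v)"
    using bij by (simp add: Gamma_character_def map_key.rep_eq bij_is_inj)
  finally show "Poly_Mapping.lookup (Sigma_action \<sigma> (Gamma_action n \<theta> b f)) v =
      Poly_Mapping.lookup (Gamma_action n \<theta> (permute_factors n \<sigma> b) (Sigma_action \<sigma> f)) v"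
    by (simp add: lookup_Gamma_action lookup_Sigma_action[OF bij])
qed

lemma Sigma_action_closed:
  assumes s: "\<sigma> permutes {1..n}" and f: "(f :: 'k::field genpoly) \<in> carrier (E_ring n)"
  shows "Sigma_action \<sigma> f \<in> carrier (E_ring n)"
proof -
  have bij: "bij \<sigma>" using s by (rule permutes_bij)
  show ?thesis unfolding E_carrier
  proof (intro ballI conjI allI subsetI)
    fix v assume "v \<in> Poly_Mapping.keys (Sigma_action \<sigma> f)"
    then have v: "Poly_Mapping.map_key \<sigma> v \<in> Poly_Mapping.keys f"
      by (simp add: in_keys_iff lookup_Sigma_action[OF bij])
    have l: "Poly_Mapping.lookup (Poly_Mapping.map_key \<sigma> v) j = Poly_Mapping.lookup v (\<sigma> j)" for j
      using bij by (simp add: map_key.rep_eq bij_is_inj)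
    fix i
    obtain j where j: "i = \<sigma> j" using bij by (meson bij_pointE)
    show "Poly_Mapping.lookup v i \<in> carrier (Zloc_group CHAR('k))"
      using v f l[of j] j unfolding E_carrier by metis
    assume "i \<in> Poly_Mapping.keys v"
    then have "j \<in> Poly_Mapping.keys (Poly_Mapping.map_key \<sigma> v)" by (simp add: in_keys_iff l j)
    then have "j \<in> {1..n}" using v f unfolding E_carrier by blast
    then show "i \<in> {1..n}" using permutes_in_image[OF s] j by blast
  qed
qed

theorem E_action_mult:
  fixes \<theta> :: "rat set \<Rightarrow> 'k::field"
  assumes th: "root_isomorphism \<theta>"
    and g: "g \<in> carrier (Sigma_Gamma_group n CHAR('k))" and h: "h \<in> carrier (Sigma_Gamma_group n CHAR('k))"
    and f: "f \<in> carrier (E_ring n)"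
  shows "E_action n \<theta> (g \<otimes>\<^bsub>Sigma_Gamma_group n CHAR('k)\<^esub> h) f = E_action n \<theta> g (E_action n \<theta> h f)"
proof -
  obtain \<sigma> a \<tau> b where gh: "g = (\<sigma>, a)" "h = (\<tau>, b)" by force
  have s: "\<sigma> permutes {1..n}" and t: "\<tau> permutes {1..n}"
    and a: "a \<in> carrier (Gamma_group n CHAR('k))" and b: "b \<in> carrier (Gamma_group n CHAR('k))"
    using g h unfolding gh Sigma_Gamma_group_def sym_group_def by auto
  note bs = permutes_bij[OF s] note bt = permutes_bij[OF t]
  have pb: "permute_factors n \<sigma> b \<in> carrier (Gamma_group n CHAR('k))"
    using b permutes_in_image[OF permutes_inv[OF s]] unfolding Gamma_group_def permute_factors_def
    by (auto simp: PiE_iff)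
  have comp: "Sigma_action (\<sigma> \<circ> \<tau>) f = Sigma_action \<sigma> (Sigma_action \<tau> f)"
    by (rule poly_mapping_eqI)
      (simp add: lookup_Sigma_action bs bt bij_comp map_key_compose bij_is_inj)
  have "Gamma_action n \<theta> (a \<otimes>\<^bsub>Gamma_group n CHAR('k)\<^esub> permute_factors n \<sigma> b) F =
      Gamma_action n \<theta> a (Gamma_action n \<theta> (permute_factors n \<sigma> b) F)" if F: "F \<in> carrier (E_ring n)" for F
  proof (rule poly_mapping_eqI)
    fix v
    show "Poly_Mapping.lookup (Gamma_action n \<theta> (a \<otimes>\<^bsub>Gamma_group n CHAR('k)\<^esub> permute_factors n \<sigma> b) F) v =
      Poly_Mapping.lookup (Gamma_action n \<theta> a (Gamma_action n \<theta> (permute_factors n \<sigma> b) F)) v"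
    proof (cases "v \<in> Poly_Mapping.keys F")
      case True
      then have "\<And>i. Poly_Mapping.lookup v i \<in> carrier (Zloc_group CHAR('k))" using F unfolding E_carrier by blast
      from Gamma_character_mult[OF th a pb this] show ?thesis by (simp add: lookup_Gamma_action mult.assoc)
    qed (simp add: lookup_Gamma_action in_keys_iff)
  qed
  from this[OF Sigma_action_closed[OF s Sigma_action_closed[OF t f]]] show ?thesis
    unfolding gh E_action_def Sigma_Gamma_group_def sym_group_def
    by (simp add: comp Sigma_Gamma_commute[OF s])
qed

definition Gamma_generator :: "nat \<Rightarrow> nat \<Rightarrow> nat \<Rightarrow> nat \<Rightarrow> nat \<Rightarrow> nat \<Rightarrow> int"
  where "Gamma_generator n p i = (\<lambda>l\<in>{1..n}. if l = i then Zhat_one p else \<one>\<^bsub>Zhat_group p\<^esub>)"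

theorem Gamma_generator_action:
  fixes \<theta> :: "rat set \<Rightarrow> 'k::field"
  assumes th: "root_isomorphism \<theta>" and i: "i \<in> {1..n}" and j: "j \<in> {1..n}"
    and m: "prime_to_char CHAR('k) m"
  shows "Gamma_action n \<theta> (Gamma_generator n CHAR('k) i) (t_pow j (1 / of_nat m)) =
     Poly_Mapping.single 0 (if i = j then at_class \<theta> (1 / of_nat m) else 1) * t_pow j (1 / of_nat m)"
proof -
  let ?x = "1 / of_nat m :: rat"
  have x: "?x \<in> carrier (Zloc_group CHAR('k))"
    using m by (auto simp: Zloc_carrier prime_to_char_def intro!: exI[of _ m])
  have z0: "Zhat_character \<theta> a 0 = 1" for a
    using at_class_0[OF th] by (simp add: Zhat_character_def)
  have idm: "\<one>\<^bsub>Zhat_group CHAR('k)\<^esub> \<in> carrier (Zhat_group CHAR('k))"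
    by (auto simp: Zhat_group_def primes_except_def padic_int_group_def carrier_integer_mod_group prime_gt_0_nat)
  have res: "Zhat_residue CHAR('k) \<one>\<^bsub>Zhat_group CHAR('k)\<^esub> m = 0 mod int m"
    by (rule Zhat_residue_eqI[OF idm m])
       (simp add: Zhat_group_def padic_int_group_def)
  have one: "Zhat_character \<theta> \<one>\<^bsub>Zhat_group CHAR('k)\<^esub> ?x = 1"
    using Zhat_character_eq[OF th idm m, of ?x 0] res at_class_0[OF th] m
    by (simp add: prime_to_char_def)
  have "Gamma_character n \<theta> (Gamma_generator n CHAR('k) i) (Poly_Mapping.single j ?x) =
     (\<Prod>l\<in>{1..n}. if l = j then (if i = j then at_class \<theta> ?x else 1) else 1)"
    unfolding Gamma_character_def Gamma_generator_def
    by (intro prod.cong refl) (auto simp: lookup_single when_def z0 one Zhat_character_one[OF th x])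
  also have "\<dots> = (if i = j then at_class \<theta> ?x else 1)" using j by simp
  finally show ?thesis by (simp add: t_pow_def Gamma_action_single mult_single)
qed

lemma topspace_Zhat: "topspace (Zhat_topology p) = carrier (Zhat_group p)"
proof -
  have "topspace (padic_int_topology q) = carrier (padic_int_group q)" for q
    unfolding padic_int_topology_def padic_int_group_def by auto
  then show ?thesis unfolding Zhat_topology_def Zhat_group_def by simp
qed

lemma topspace_Gamma: "topspace (Gamma_topology n p) = carrier (Gamma_group n p)"
  unfolding Gamma_topology_def Gamma_group_def by (simp add: topspace_Zhat)

lemma topspace_Sigma_Gamma: "topspace (Sigma_Gamma_topology n p) = carrier (Sigma_Gamma_group n p)"
  unfolding Sigma_Gamma_topology_def Sigma_Gamma_group_def by (simp add: topspace_Gamma)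

lemma continuous_component:
  assumes i: "i \<in> {1..n}" and q: "q \<in> primes_except p"
  shows "continuous_map (Gamma_topology n p) (discrete_topology (carrier (integer_mod_group (q ^ j)))) (\<lambda>a. a i q j)"
proof -
  have 1: "continuous_map (Gamma_topology n p) (Zhat_topology p) (\<lambda>a. a i)"
    unfolding Gamma_topology_def by (rule continuous_map_product_projection[OF i])
  have 2: "continuous_map (Zhat_topology p) (padic_int_topology q) (\<lambda>a. a q)"
    unfolding Zhat_topology_def by (rule continuous_map_product_projection[OF q])
  have 3: "continuous_map (padic_int_topology q) (discrete_topology (carrier (integer_mod_group (q ^ j)))) (\<lambda>a. a j)"
    unfolding padic_int_topology_def
    by (rule continuous_map_from_subtopology, rule continuous_map_product_projection) simp
  show ?thesis using continuous_map_compose[OF continuous_map_compose[OF 1 2] 3] by (simp add: o_def)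
qed

theorem Gamma_action_continuous:
  fixes \<theta> :: "rat set \<Rightarrow> 'k::field"
  assumes th: "root_isomorphism \<theta>" and f: "f \<in> carrier (E_ring n)"
  shows "openin (Gamma_topology n CHAR('k)) {a \<in> carrier (Gamma_group n CHAR('k)). Gamma_action n \<theta> a f = h}"
proof -
  obtain s where s: "prime_to_char CHAR('k) s" and fs: "f \<in> laurent_ring n s"
    using f unfolding E_ring_def by auto
  then have s0: "s > 0" by (simp add: prime_to_char_def)
  define Q where "Q = {q \<in> prime_factors s. q \<in> primes_except CHAR('k)}"
  have finQ: "finite Q" by (auto simp: Q_def)
  define nb where "nb a = {b \<in> carrier (Gamma_group n CHAR('k)).
      \<forall>(i, q)\<in>{1..n} \<times> Q. b i q (multiplicity q s) = a i q (multiplicity q s)}" for a :: "nat \<Rightarrow> nat \<Rightarrow> nat \<Rightarrow> int"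
  have nbo: "openin (Gamma_topology n CHAR('k)) (nb a)" for a
  proof -
    have 1: "openin (Gamma_topology n CHAR('k)) {b \<in> carrier (Gamma_group n CHAR('k)).
      b i q (multiplicity q s) = a i q (multiplicity q s)}" if iq: "i \<in> {1..n}" "q \<in> Q" for i q
    proof -
      have q: "q \<in> primes_except CHAR('k)" using iq by (auto simp: Q_def)
      let ?j = "multiplicity q s"
      let ?U = "carrier (integer_mod_group (q ^ ?j)) \<inter> {a i q ?j}"
      have "openin (Gamma_topology n CHAR('k)) {b \<in> topspace (Gamma_topology n CHAR('k)). b i q ?j \<in> ?U}"
        by (rule openin_continuous_map_preimage[OF continuous_component[OF iq(1) q]]) simp
      moreover have "b i q ?j \<in> carrier (integer_mod_group (q ^ ?j))" if "b \<in> topspace (Gamma_topology n CHAR('k))" for b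
        using continuous_map_image_subset_topspace[OF continuous_component[OF iq(1) q, where j="?j"]] that by auto
      then have "{b \<in> topspace (Gamma_topology n CHAR('k)). b i q ?j \<in> ?U} =
          {b \<in> carrier (Gamma_group n CHAR('k)). b i q ?j = a i q ?j}"
        unfolding topspace_Gamma by auto
      ultimately show ?thesis by simp
    qed
    show ?thesis
    proof (cases "{1..n} \<times> Q = {}")
      case True
      have "nb a = carrier (Gamma_group n CHAR('k))" unfolding nb_def using True by blast
      then show ?thesis using openin_topspace[of "Gamma_topology n CHAR('k)"] by (simp add: topspace_Gamma)
    next
      case False
      have "openin (Gamma_topology n CHAR('k)) (\<Inter>(i, q)\<in>{1..n} \<times> Q. {b \<in> carrier (Gamma_group n CHAR('k)).
        b i q (multiplicity q s) = a i q (multiplicity q s)})"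
        by (rule openin_INT2) (use 1 False finQ in auto)
      moreover have "(\<Inter>(i, q)\<in>{1..n} \<times> Q. {b \<in> carrier (Gamma_group n CHAR('k)).
        b i q (multiplicity q s) = a i q (multiplicity q s)}) = nb a"
        unfolding nb_def using False by blast
      ultimately show ?thesis by simp
    qed
  qed
  have same: "Gamma_action n \<theta> b f = Gamma_action n \<theta> a f"
    if a: "a \<in> carrier (Gamma_group n CHAR('k))" and b: "b \<in> nb a" for a b
  proof (rule poly_mapping_eqI)
    fix v
    have b': "b \<in> carrier (Gamma_group n CHAR('k))" using b by (simp add: nb_def)
    show "Poly_Mapping.lookup (Gamma_action n \<theta> b f) v = Poly_Mapping.lookup (Gamma_action n \<theta> a f) v"
    proof (cases "v \<in> Poly_Mapping.keys f")
      case True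
      have "Zhat_character \<theta> (b i) (Poly_Mapping.lookup v i) = Zhat_character \<theta> (a i) (Poly_Mapping.lookup v i)" if i: "i \<in> {1..n}" for i
      proof -
        have ai: "a i \<in> carrier (Zhat_group CHAR('k))" and bi: "b i \<in> carrier (Zhat_group CHAR('k))"
          using a b' i unfolding Gamma_group_def by auto
        have sv: "of_nat s * Poly_Mapping.lookup v i \<in> \<int>" using fs True unfolding laurent_ring_def by blast
        have "Zhat_residue CHAR('k) (b i) s = Zhat_residue CHAR('k) (a i) s mod int s"
        proof (rule Zhat_residue_eqI[OF bi s])
          fix q assume q: "q \<in> primes_except CHAR('k)"
          show "Zhat_residue CHAR('k) (a i) s mod int (q ^ multiplicity q s) = b i q (multiplicity q s)"
          proof (cases "q \<in> Q")
            case True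
            then have "b i q (multiplicity q s) = a i q (multiplicity q s)" using b i unfolding nb_def by blast
            then show ?thesis using Zhat_residue(3)[OF ai s q] by simp
          next
            case False
            then have "\<not> q dvd s" using q s0 unfolding Q_def primes_except_def by (auto simp: in_prime_factors_iff)
            then have "multiplicity q s = 0" by (simp add: not_dvd_imp_multiplicity_0)
            then show ?thesis using Zhat_memD[OF bi q] padic_int_memD(1,2)[of "b i q" q 0] by simp
          qed
        qed
        then show ?thesis
          using Zhat_character_eq[OF th bi s sv, of "Zhat_residue CHAR('k) (a i) s"]
            Zhat_character_eq[OF th ai s sv, of "Zhat_residue CHAR('k) (a i) s"] Zhat_residue(1,2)[OF ai s]
          by simp
      qed
      then show ?thesis unfolding lookup_Gamma_action Gamma_character_def by simp
    qed (simp add: lookup_Gamma_action in_keys_iff)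
  qed
  let ?S = "{a \<in> carrier (Gamma_group n CHAR('k)). Gamma_action n \<theta> a f = h}"
  have "\<exists>T. openin (Gamma_topology n CHAR('k)) T \<and> a \<in> T \<and> T \<subseteq> ?S" if a: "a \<in> ?S" for a
  proof (intro exI conjI)
    show "openin (Gamma_topology n CHAR('k)) (nb a)" by (rule nbo)
    show "a \<in> nb a" using a unfolding nb_def by blast
    show "nb a \<subseteq> ?S"
    proof
      fix b assume b: "b \<in> nb a"
      then have "b \<in> carrier (Gamma_group n CHAR('k))" unfolding nb_def by blast
      moreover have "Gamma_action n \<theta> b f = h" using same[OF _ b] a by simp
      ultimately show "b \<in> ?S" by blast
    qed
  qed
  then show ?thesis by (subst openin_subopen) blast
qed

end

theory Submission
  imports Defs
begin

text \<open>Write \<open>E\<close> for the ring of Laurent polynomials with fractional exponents. The proof has an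
algebraic and a topological half.

Suppose first that the elements of \<open>G\<close> act on a \<open>G\<close>-stable subring \<open>L\<close> of \<open>E\<close> through finitely
many maps, and that for each \<open>g\<close> that moves \<open>L\<close> there are \<open>x\<^sub>i, y\<^sub>i \<in> L\<close> with
\<open>\<Sum> x\<^sub>i y\<^sub>i = 1\<close> and \<open>\<Sum> x\<^sub>i g(y\<^sub>i) = 0\<close>. Multiplying these relations over the finitely many maps
gives one family with \<open>\<Sum> x\<^sub>i g(y\<^sub>i) = \<delta>\<close>, where \<open>\<delta>\<close> is \<open>1\<close> if \<open>g\<close> is trivial on \<open>L\<close> and \<open>0\<close>
otherwise: this is the criterion of Chase, Harrison and Rosenberg for a Galois extension with finite
group. Let \<open>S\<close> be the ring of all \<open>x \<in> E\<close> on which the action of \<open>g\<close> depends only on its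
restriction to \<open>L\<close>; it contains \<open>L\<close> and the fixed ring \<open>K\<close>. With the trace \<open>tr\<close> of the finite
quotient, \<open>z = \<Sum> tr(y\<^sub>i z) x\<^sub>i\<close> is a dual basis of \<open>S\<close> over \<open>K\<close>, and \<open>\<Sum> x\<^sub>i \<otimes> y\<^sub>i\<close> is a
separability idempotent. So \<open>S\<close> is strongly separable over \<open>K\<close>
(\<open>strongly_separable_algebraI\<close>, \<open>strongly_separable_over_fixed\<close>).

Here \<open>L\<close> is \<open>k[t\<^sub>1\<^sup>\<plusminus>\<^sup>1\<^sup>/\<^sup>s, \<dots>, t\<^sub>n\<^sup>\<plusminus>\<^sup>1\<^sup>/\<^sup>s]\<close> for a suitable \<open>s\<close>. The relation for \<open>g\<close>
exists as soon as some power of \<open>g\<close> multiplies a monomial \<open>y = t\<^sup>v\<close> of \<open>L\<close> by a scalar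
\<open>\<chi> \<noteq> 1\<close>: then \<open>y - g\<^sup>m y = (1 - \<chi>) t\<^sup>v\<close> is a unit of \<open>L\<close>, and it is the sum of the telescoping
differences \<open>g\<^sup>j y - g(g\<^sup>j y)\<close> for \<open>j < m\<close>, so dividing by it gives the relation. An element of \<open>\<Gamma>\<^sub>n\<close> scales monomials, so if it moves \<open>L\<close> then it satisfies this
with \<open>m = 1\<close>. If \<open>g \<in> G\<close> permutes the variables nontrivially, then \<open>g\<^sup>m \<in> \<Gamma>\<^sub>n\<close> for \<open>m = n!\<close>, and
\<open>g\<^sup>m \<noteq> 1\<close> because \<open>G\<close> is torsion free; as \<open>\<Gamma>\<^sub>n\<close> acts faithfully, \<open>g\<^sup>m\<close> scales some monomial, whose
denominator depends on \<open>g\<close>. That one denominator serves all such \<open>g\<close> is a matter of compactness: they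
form a closed subset of the compact space \<open>\<Sigma>\<^sub>n \<ltimes> \<Gamma>\<^sub>n\<close>, and the condition for a given monomial is open
(\<open>uniform_denominator\<close>). Every admissible \<open>s\<close> divisible by this denominator is suitable, and every finite subset
of \<open>E\<close> is contained in \<open>L\<close> for one of these \<open>s\<close>.\<close>

section \<open>Subrings of a commutative ring\<close>

abbreviation ring_on :: "'a::comm_ring_1 set \<Rightarrow> 'a ring"
  where "ring_on A \<equiv> ring_of_type_algebra\<lparr>carrier := A\<rparr>"

abbreviation algebra_on :: "'a::comm_ring_1 set \<Rightarrow> ('a, 'a) module"
  where "algebra_on A \<equiv> subalgebra_of ring_of_type_algebra A"

lemma ring_of_type_algebra_simps [simp]:
  "carrier ring_of_type_algebra = UNIV" "x \<otimes>\<^bsub>ring_of_type_algebra\<^esub> y = x * y"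
  "\<one>\<^bsub>ring_of_type_algebra\<^esub> = 1" "x \<oplus>\<^bsub>ring_of_type_algebra\<^esub> y = x + y" "\<zero>\<^bsub>ring_of_type_algebra\<^esub> = 0"
  by (simp_all add: ring_of_type_algebra_def)

lemma ring_on_carrier: "carrier (ring_on A) = A"
  by simp

lemma algebra_on_simps [simp]:
  "carrier (algebra_on A) = A" "x \<otimes>\<^bsub>algebra_on A\<^esub> y = x * y" "\<one>\<^bsub>algebra_on A\<^esub> = 1"
  "x \<oplus>\<^bsub>algebra_on A\<^esub> y = x + y" "\<zero>\<^bsub>algebra_on A\<^esub> = 0" "r \<odot>\<^bsub>algebra_on A\<^esub> x = r * x"
  by (simp_all add: ring_of_type_algebra_def subalgebra_of_def)

definition is_subring :: "'a::comm_ring_1 set \<Rightarrow> bool"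
  where "is_subring A \<longleftrightarrow> 1 \<in> A \<and> (\<forall>x\<in>A. \<forall>y\<in>A. x - y \<in> A \<and> x * y \<in> A)"

lemma is_subringD:
  assumes "is_subring A"
  shows is_subring_1: "1 \<in> A" and is_subring_0: "0 \<in> A"
    and is_subring_diff: "\<And>x y. x \<in> A \<Longrightarrow> y \<in> A \<Longrightarrow> x - y \<in> A"
    and is_subring_mult: "\<And>x y. x \<in> A \<Longrightarrow> y \<in> A \<Longrightarrow> x * y \<in> A"
    and is_subring_minus: "\<And>x. x \<in> A \<Longrightarrow> - x \<in> A"
    and is_subring_add: "\<And>x y. x \<in> A \<Longrightarrow> y \<in> A \<Longrightarrow> x + y \<in> A"
proof -
  show 1: "1 \<in> A" and d: "\<And>x y. x \<in> A \<Longrightarrow> y \<in> A \<Longrightarrow> x - y \<in> A"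
    and "\<And>x y. x \<in> A \<Longrightarrow> y \<in> A \<Longrightarrow> x * y \<in> A"
    using assms by (auto simp: is_subring_def)
  show 0: "0 \<in> A" using d[OF 1 1] by simp
  show m: "- x \<in> A" if "x \<in> A" for x using d[OF 0 that] by simp
  show "x + y \<in> A" if "x \<in> A" "y \<in> A" for x y using d[OF that(1) m[OF that(2)]] by simp
qed

lemma is_subring_sum: "is_subring A \<Longrightarrow> (\<And>i. i \<in> I \<Longrightarrow> f i \<in> A) \<Longrightarrow> sum f I \<in> A"
  by (induction I rule: infinite_finite_induct) (auto simp: is_subringD)

lemma is_subring_of_int: "is_subring A \<Longrightarrow> of_int c \<in> A"
  by (induction c rule: int_induct[of _ 0]) (auto simp: is_subringD)

lemma is_subring_of_int_mult: "is_subring A \<Longrightarrow> x \<in> A \<Longrightarrow> of_int c * x \<in> A"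
  by (simp add: is_subring_mult is_subring_of_int)

lemma cring_ring_on: "is_subring A \<Longrightarrow> cring (ring_on A)"
proof (rule cringI)
  assume A: "is_subring A"
  note D = is_subringD[OF A]
  show "abelian_group (ring_on A)"
  proof (rule abelian_groupI)
    fix x assume "x \<in> carrier (ring_on A)"
    then show "\<exists>y\<in>carrier (ring_on A). y \<oplus>\<^bsub>ring_on A\<^esub> x = \<zero>\<^bsub>ring_on A\<^esub>"
      using D(5) by (intro bexI[of _ "-x"]) auto
  qed (auto simp: D add_ac)
  show "Group.comm_monoid (ring_on A)"
    by (rule comm_monoidI) (auto simp: D mult_ac)
qed (auto simp: distrib_right)

lemma cring_algebra_on: "is_subring A \<Longrightarrow> cring (algebra_on A)"
proof (rule cringI)
  assume A: "is_subring A"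
  note D = is_subringD[OF A]
  show "abelian_group (algebra_on A)"
  proof (rule abelian_groupI)
    fix x assume "x \<in> carrier (algebra_on A)"
    then show "\<exists>y\<in>carrier (algebra_on A). y \<oplus>\<^bsub>algebra_on A\<^esub> x = \<zero>\<^bsub>algebra_on A\<^esub>"
      using D(5) by (intro bexI[of _ "-x"]) auto
  qed (auto simp: D add_ac)
  show "Group.comm_monoid (algebra_on A)"
    by (rule comm_monoidI) (auto simp: D mult_ac)
qed (auto simp: distrib_right)

lemma subcring_ring_on:
  assumes A: "is_subring A" and B: "is_subring B" and BA: "B \<subseteq> A"
  shows "subcring B (ring_on A)"
proof -
  interpret cring "ring_on A" by (rule cring_ring_on[OF A])
  show ?thesis
  proof (rule subcringI, rule subringI)
    fix h assume h: "h \<in> B"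
    then have "\<ominus>\<^bsub>ring_on A\<^esub> h = - h"
      using BA is_subring_minus[OF B] by (intro minus_equality) auto
    then show "\<ominus>\<^bsub>ring_on A\<^esub> h \<in> B" using is_subring_minus[OF B h] by simp
  qed (use BA is_subringD[OF B] in \<open>auto simp: mult.commute\<close>)
qed

lemma finsum_algebra_on:
  assumes A: "is_subring A" and f: "\<And>x. x \<in> J \<Longrightarrow> f x \<in> A"
  shows "(\<Oplus>\<^bsub>algebra_on A\<^esub>x\<in>J. f x) = (\<Sum>x\<in>J. f x)"
proof -
  have am: "abelian_monoid (algebra_on A)"
    using cring_algebra_on[OF A] by (simp add: cring_def ring_def abelian_group_def)
  show ?thesis using f
  proof (induction J rule: infinite_finite_induct)
    case (infinite J)
    then show ?case by (subst abelian_monoid.finsum_infinite[OF am]) auto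
  next
    case empty
    show ?case by (subst abelian_monoid.finsum_empty[OF am]) auto
  next
    case (insert x J)
    then show ?case by (subst abelian_monoid.finsum_insert[OF am]) auto
  qed
qed

lemma add_pow_algebra_on:
  assumes A: "is_subring A" and x: "x \<in> A"
  shows "add_pow (algebra_on A) (c :: int) x = of_int c * x"
proof -
  interpret cring "algebra_on A" by (rule cring_algebra_on[OF A])
  have nat: "add_pow (algebra_on A) n x = of_nat n * x" for n :: nat
    by (induction n) (auto simp: distrib_right add.commute)
  have m: "\<ominus>\<^bsub>algebra_on A\<^esub> y = - y" if "y \<in> A" for y
    using that is_subring_minus[OF A] by (intro minus_equality) auto
  have n: "of_nat n * x \<in> A" for n using is_subring_of_int_mult[OF A x, of "int n"] by simp
  show ?thesis
  proof (cases "c \<ge> 0")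
    case True
    then show ?thesis by (simp add: add_pow_int_ge nat)
  next
    case False
    then have "add_pow (algebra_on A) c x = \<ominus>\<^bsub>algebra_on A\<^esub> (of_nat (nat (- c)) * x)"
      using add_pow_int_lt[of c "algebra_on A" x] unfolding nat by simp
    also have "\<dots> = of_int c * x" using False by (simp only: m[OF n]) simp
    finally show ?thesis .
  qed
qed

section \<open>The tensor square of an extension of commutative rings\<close>

text \<open>The multiplication of the monoid ring whose quotient is the tensor square, on the whole type. Its laws
hold without reference to carriers.\<close>

definition pair_times :: "(('a::comm_ring_1 \<times> 'a) \<Rightarrow>\<^sub>0 int) \<Rightarrow> (('a \<times> 'a) \<Rightarrow>\<^sub>0 int) \<Rightarrow> (('a \<times> 'a) \<Rightarrow>\<^sub>0 int)"
  where "pair_times f g = (\<Sum>x\<in>Poly_Mapping.keys f. \<Sum>y\<in>Poly_Mapping.keys g.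
    Poly_Mapping.single (fst x * fst y, snd x * snd y) (Poly_Mapping.lookup f x * Poly_Mapping.lookup g y))"

lemma pair_times_superset:
  assumes "finite I" "finite J" "Poly_Mapping.keys f \<subseteq> I" "Poly_Mapping.keys g \<subseteq> J"
  shows "pair_times f g = (\<Sum>x\<in>I. \<Sum>y\<in>J.
    Poly_Mapping.single (fst x * fst y, snd x * snd y) (Poly_Mapping.lookup f x * Poly_Mapping.lookup g y))"
proof -
  let ?s = "\<lambda>x y. Poly_Mapping.single (fst x * fst y, snd x * snd y) (Poly_Mapping.lookup f x * Poly_Mapping.lookup g y)"
  have "pair_times f g = (\<Sum>x\<in>Poly_Mapping.keys f. \<Sum>y\<in>J. ?s x y)"
    unfolding pair_times_def
    by (intro sum.cong refl sum.mono_neutral_left assms) (simp add: in_keys_iff)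
  also have "\<dots> = (\<Sum>x\<in>I. \<Sum>y\<in>J. ?s x y)"
    by (intro sum.mono_neutral_left assms) (simp add: in_keys_iff)
  finally show ?thesis .
qed

lemma pair_times_commute: "pair_times f g = pair_times g f"
  unfolding pair_times_def by (subst sum.swap) (simp add: mult.commute)

lemma pair_times_add_left: "pair_times (f + f') g = pair_times f g + pair_times f' g"
proof -
  let ?I = "Poly_Mapping.keys f \<union> Poly_Mapping.keys f'" let ?J = "Poly_Mapping.keys g"
  have "Poly_Mapping.keys (f + f') \<subseteq> ?I" by (rule Poly_Mapping.keys_add)
  then have "pair_times (f + f') g = (\<Sum>x\<in>?I. \<Sum>y\<in>?J.
    Poly_Mapping.single (fst x * fst y, snd x * snd y) (Poly_Mapping.lookup (f + f') x * Poly_Mapping.lookup g y))"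
    by (intro pair_times_superset) auto
  moreover have "pair_times f g = (\<Sum>x\<in>?I. \<Sum>y\<in>?J.
    Poly_Mapping.single (fst x * fst y, snd x * snd y) (Poly_Mapping.lookup f x * Poly_Mapping.lookup g y))"
    by (intro pair_times_superset) auto
  moreover have "pair_times f' g = (\<Sum>x\<in>?I. \<Sum>y\<in>?J.
    Poly_Mapping.single (fst x * fst y, snd x * snd y) (Poly_Mapping.lookup f' x * Poly_Mapping.lookup g y))"
    by (intro pair_times_superset) auto
  ultimately show ?thesis
    by (simp only: lookup_add distrib_right single_add sum.distrib)
qed

lemma pair_times_single:
  "pair_times (Poly_Mapping.single (a, b) c) (Poly_Mapping.single (a', b') c') = Poly_Mapping.single (a * a', b * b') (c * c')"
  by (subst pair_times_superset[of "{(a, b)}" "{(a', b')}"]) simp_all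

lemma pair_times_add_right: "pair_times f (g + g') = pair_times f g + pair_times f g'"
  by (simp add: pair_times_commute[of f] pair_times_add_left)

lemma pair_times_0 [simp]: "pair_times 0 g = 0" "pair_times f 0 = 0"
  by (simp_all add: pair_times_def)

lemma pair_times_diff_left: "pair_times (f - f') g = pair_times f g - pair_times f' g"
  using pair_times_add_left[of "f - f'" f' g] by simp

lemma pair_times_diff_right: "pair_times f (g - g') = pair_times f g - pair_times f g'"
  using pair_times_add_right[of f "g - g'" g'] by simp

lemma pair_times_1: "pair_times (pure_pair 1 1) f = f"
proof -
  have "Poly_Mapping.keys f \<subseteq> UNIV" by simp
  then show ?thesis
    by (induction f rule: frag_induction) (auto simp: pair_times_single pair_times_diff_right)
qed

lemma pair_times_assoc: "pair_times (pair_times f g) h = pair_times f (pair_times g h)"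
proof -
  have "Poly_Mapping.keys f \<subseteq> UNIV" by simp
  then show ?thesis
  proof (induction f rule: frag_induction)
    case (one x)
    have "Poly_Mapping.keys g \<subseteq> UNIV" by simp
    then show ?case
    proof (induction g rule: frag_induction)
      case (one y)
      have "Poly_Mapping.keys h \<subseteq> UNIV" by simp
      then show ?case
        by (induction h rule: frag_induction; cases x; cases y)
           (auto simp: pair_times_single pair_times_diff_right mult.assoc)
    qed (simp_all add: pair_times_diff_left pair_times_diff_right)
  qed (simp_all add: pair_times_diff_left)
qed

lemma keys_add_subset:
  "Poly_Mapping.keys f \<subseteq> I \<Longrightarrow> Poly_Mapping.keys g \<subseteq> I \<Longrightarrow> Poly_Mapping.keys (f + g) \<subseteq> I"
  using Poly_Mapping.keys_add[of f g] by (rule order_trans) simp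

lemma keys_diff_subset:
  fixes f g :: "'b \<Rightarrow>\<^sub>0 int"
  shows "Poly_Mapping.keys f \<subseteq> I \<Longrightarrow> Poly_Mapping.keys g \<subseteq> I \<Longrightarrow> Poly_Mapping.keys (f - g) \<subseteq> I"
  using Poly_Mapping.keys_diff[of f g] by (rule order_trans) simp

lemma keys_pair_times:
  assumes "is_subring A" "Poly_Mapping.keys f \<subseteq> A \<times> A" "Poly_Mapping.keys g \<subseteq> A \<times> A"
  shows "Poly_Mapping.keys (pair_times f g) \<subseteq> A \<times> A"
proof
  fix z assume "z \<in> Poly_Mapping.keys (pair_times f g)"
  then obtain x y where "x \<in> Poly_Mapping.keys f" "y \<in> Poly_Mapping.keys g"
    and "z = (fst x * fst y, snd x * snd y)"
    unfolding pair_times_def by (auto dest!: subsetD[OF keys_sum] split: if_splits)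
  then show "z \<in> A \<times> A" using assms is_subring_mult by fastforce
qed

abbreviation pair_ring :: "'a::comm_ring_1 set \<Rightarrow> (('a \<times> 'a) \<Rightarrow>\<^sub>0 int) ring"
  where "pair_ring A \<equiv> pair_monoid_ring (algebra_on A) (algebra_on A)"

lemma pair_ring_simps [simp]:
  "carrier (pair_ring A) = {f. Poly_Mapping.keys f \<subseteq> A \<times> A}" "f \<otimes>\<^bsub>pair_ring A\<^esub> g = pair_times f g"
  "\<one>\<^bsub>pair_ring A\<^esub> = pure_pair 1 1" "f \<oplus>\<^bsub>pair_ring A\<^esub> g = f + g" "\<zero>\<^bsub>pair_ring A\<^esub> = 0"
  by (simp_all add: pair_monoid_ring_def pair_times_def case_prod_beta)

lemma cring_pair_ring:
  assumes A: "is_subring A" shows "cring (pair_ring A)"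
proof (rule cringI)
  show "abelian_group (pair_ring A)"
  proof (rule abelian_groupI)
    fix f assume "f \<in> carrier (pair_ring A)"
    then show "\<exists>g\<in>carrier (pair_ring A). g \<oplus>\<^bsub>pair_ring A\<^esub> f = \<zero>\<^bsub>pair_ring A\<^esub>"
      by (intro bexI[of _ "- f"]) auto
  qed (simp_all add: add_ac keys_add_subset)
  show "Group.comm_monoid (pair_ring A)"
  proof (rule comm_monoidI)
    fix f g assume "f \<in> carrier (pair_ring A)" "g \<in> carrier (pair_ring A)"
    then show "f \<otimes>\<^bsub>pair_ring A\<^esub> g \<in> carrier (pair_ring A)"
      using keys_pair_times[OF A] by simp
    show "f \<otimes>\<^bsub>pair_ring A\<^esub> g = g \<otimes>\<^bsub>pair_ring A\<^esub> f"
      by (simp add: pair_times_commute[of f g])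
  qed (simp_all add: is_subring_1[OF A] pair_times_1 pair_times_assoc)
qed (simp add: pair_times_add_left)

lemma ominus_pair_ring:
  assumes A: "is_subring A" and f: "f \<in> carrier (pair_ring A)"
  shows "\<ominus>\<^bsub>pair_ring A\<^esub> f = - f"
proof -
  interpret cring "pair_ring A" by (rule cring_pair_ring[OF A])
  show ?thesis using f by (intro minus_equality) auto
qed

lemma multiplication_rep_sum:
  assumes A: "is_subring A" and f: "Poly_Mapping.keys f \<subseteq> A \<times> A"
  shows "multiplication_rep (algebra_on A) f =
    (\<Sum>x\<in>Poly_Mapping.keys f. of_int (Poly_Mapping.lookup f x) * (fst x * snd x))"
proof -
  have mem: "fst x * snd x \<in> A" if "x \<in> Poly_Mapping.keys f" for x
    using that f is_subring_mult[OF A] by auto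
  have "multiplication_rep (algebra_on A) f =
      (\<Oplus>\<^bsub>algebra_on A\<^esub>x\<in>Poly_Mapping.keys f. of_int (Poly_Mapping.lookup f x) * (fst x * snd x))"
    unfolding multiplication_rep_def
  proof (rule abelian_monoid.finsum_cong')
    show "abelian_monoid (algebra_on A)"
      using cring_algebra_on[OF A] by (simp add: cring_def ring_def abelian_group_def)
  qed (use mem in \<open>auto simp: add_pow_algebra_on[OF A] is_subring_of_int_mult[OF A]\<close>)
  also have "\<dots> = (\<Sum>x\<in>Poly_Mapping.keys f. of_int (Poly_Mapping.lookup f x) * (fst x * snd x))"
    by (rule finsum_algebra_on[OF A]) (rule is_subring_of_int_mult[OF A mem])
  finally show ?thesis .
qed

definition mult_out :: "(('a::comm_ring_1 \<times> 'a) \<Rightarrow>\<^sub>0 int) \<Rightarrow> 'a"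
  where "mult_out f = (\<Sum>x\<in>Poly_Mapping.keys f. of_int (Poly_Mapping.lookup f x) * (fst x * snd x))"

lemma mult_out_superset:
  assumes "finite I" "Poly_Mapping.keys f \<subseteq> I"
  shows "mult_out f = (\<Sum>x\<in>I. of_int (Poly_Mapping.lookup f x) * (fst x * snd x))"
  unfolding mult_out_def using assms by (intro sum.mono_neutral_left) (simp_all add: in_keys_iff)

lemma mult_out_single [simp]: "mult_out (Poly_Mapping.single (a, b) c) = of_int c * (a * b)"
  by (subst mult_out_superset[of "{(a, b)}"]) simp_all

lemma mult_out_0 [simp]: "mult_out 0 = 0"
  by (simp add: mult_out_def)

lemma mult_out_add: "mult_out (f + g) = mult_out f + mult_out g"
proof -
  let ?I = "Poly_Mapping.keys f \<union> Poly_Mapping.keys g"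
  have "mult_out (f + g) = (\<Sum>x\<in>?I. of_int (Poly_Mapping.lookup (f + g) x) * (fst x * snd x))"
    by (rule mult_out_superset) (simp_all add: Poly_Mapping.keys_add)
  moreover have "mult_out f = (\<Sum>x\<in>?I. of_int (Poly_Mapping.lookup f x) * (fst x * snd x))"
    by (rule mult_out_superset) simp_all
  moreover have "mult_out g = (\<Sum>x\<in>?I. of_int (Poly_Mapping.lookup g x) * (fst x * snd x))"
    by (rule mult_out_superset) simp_all
  ultimately show ?thesis by (simp add: lookup_add distrib_right sum.distrib)
qed

lemma mult_out_diff: "mult_out (f - g) = mult_out f - mult_out g"
  using mult_out_add[of "f - g" g] by (simp add: algebra_simps)

lemma mult_out_times: "mult_out (pair_times f g) = mult_out f * mult_out g"
proof -
  have "Poly_Mapping.keys f \<subseteq> UNIV" by simp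
  then show ?thesis
  proof (induction f rule: frag_induction)
    case (one x)
    have "Poly_Mapping.keys g \<subseteq> UNIV" by simp
    then show ?case
      by (induction g rule: frag_induction; cases x)
         (auto simp: pair_times_single pair_times_diff_right mult_out_diff mult_ac right_diff_distrib)
  qed (simp_all add: pair_times_diff_left mult_out_diff left_diff_distrib)
qed

lemma mult_out_closed:
  assumes A: "is_subring A" and f: "Poly_Mapping.keys f \<subseteq> A \<times> A"
  shows "mult_out f \<in> A"
  unfolding mult_out_def using f
  by (intro is_subring_sum[OF A] is_subring_of_int_mult[OF A] is_subring_mult[OF A]) auto

text \<open>The kernel of a ring homomorphism is an ideal. So \<open>mult_out\<close> vanishes on the ideal generated by the
tensor relations as soon as it vanishes on the relations.\<close>

lemma mult_out_hom:
  assumes A: "is_subring A"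
  shows "mult_out \<in> ring_hom (pair_ring A) (algebra_on A)"
  by (rule ring_hom_memI) (auto simp: mult_out_closed[OF A] mult_out_times mult_out_add)

abbreviation tensor_ideal :: "'a::comm_ring_1 set \<Rightarrow> 'a set \<Rightarrow> (('a \<times> 'a) \<Rightarrow>\<^sub>0 int) set"
  where "tensor_ideal K A \<equiv> Idl\<^bsub>pair_ring A\<^esub> (tensor_relations (ring_on K) (algebra_on A) (algebra_on A))"

abbreviation tensor_square :: "'a::comm_ring_1 set \<Rightarrow> 'a set \<Rightarrow> (('a \<times> 'a) \<Rightarrow>\<^sub>0 int) set ring"
  where "tensor_square K A \<equiv> tensor_algebra (ring_on K) (algebra_on A) (algebra_on A)"

lemma tensor_relations_subset:
  assumes A: "is_subring A" and KA: "K \<subseteq> A"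
  shows "tensor_relations (ring_on K) (algebra_on A) (algebra_on A) \<subseteq> carrier (pair_ring A)"
proof
  have pure: "Poly_Mapping.keys (pure_pair a b) \<subseteq> A \<times> A" if "a \<in> A" "b \<in> A" for a b
    using that by simp
  fix f assume "f \<in> tensor_relations (ring_on K) (algebra_on A) (algebra_on A)"
  then have "Poly_Mapping.keys f \<subseteq> A \<times> A"
    unfolding tensor_relations_def
    by (elim UnE CollectE exE conjE; hypsubst; intro keys_diff_subset pure)
       (use KA is_subring_add[OF A] is_subring_mult[OF A] in auto)
  then show "f \<in> carrier (pair_ring A)" by simp
qed

lemma
  assumes A: "is_subring A" and KA: "K \<subseteq> A"
  shows ideal_tensor_ideal: "ideal (tensor_ideal K A) (pair_ring A)"
    and tensor_relations_ideal: "tensor_relations (ring_on K) (algebra_on A) (algebra_on A) \<subseteq> tensor_ideal K A"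
    and tensor_ideal_kernel: "f \<in> tensor_ideal K A \<Longrightarrow> mult_out f = 0"
proof -
  interpret P: cring "pair_ring A" by (rule cring_pair_ring[OF A])
  interpret B: cring "algebra_on A" by (rule cring_algebra_on[OF A])
  note sub = tensor_relations_subset[OF A KA]
  show "ideal (tensor_ideal K A) (pair_ring A)" by (rule P.genideal_ideal[OF sub])
  show "tensor_relations (ring_on K) (algebra_on A) (algebra_on A) \<subseteq> tensor_ideal K A"
    by (rule P.genideal_self[OF sub])
  have "ring_hom_ring (pair_ring A) (algebra_on A) mult_out"
    by (rule ring_hom_ringI2[OF P.ring_axioms B.ring_axioms mult_out_hom[OF A]])
  then have "ideal (a_kernel (pair_ring A) (algebra_on A) mult_out) (pair_ring A)"
    by (rule ring_hom_ring.kernel_is_ideal)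
  moreover have "tensor_relations (ring_on K) (algebra_on A) (algebra_on A) \<subseteq>
      a_kernel (pair_ring A) (algebra_on A) mult_out"
  proof
    fix f assume f: "f \<in> tensor_relations (ring_on K) (algebra_on A) (algebra_on A)"
    then have "mult_out f = 0"
      unfolding tensor_relations_def by (auto simp: mult_out_diff distrib_left distrib_right mult_ac)
    then show "f \<in> a_kernel (pair_ring A) (algebra_on A) mult_out"
      using f sub unfolding a_kernel_def' by auto
  qed
  ultimately have "tensor_ideal K A \<subseteq> a_kernel (pair_ring A) (algebra_on A) mult_out"
    by (rule P.genideal_minimal)
  then show "mult_out f = 0" if "f \<in> tensor_ideal K A"
    using that unfolding a_kernel_def' by auto
qed

locale ring_extension =
  fixes K A :: "'a::comm_ring_1 set"
  assumes K: "is_subring K" and A: "is_subring A" and KA: "K \<subseteq> A"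
begin

abbreviation "P \<equiv> pair_ring A"
abbreviation "I \<equiv> tensor_ideal K A"
abbreviation "T \<equiv> tensor_square K A"
abbreviation "M \<equiv> multiplication_module (algebra_on A)"
abbreviation "tclass f \<equiv> I +>\<^bsub>P\<^esub> f"

lemma P_cring: "cring P" by (rule cring_pair_ring[OF A])
lemma I_ideal: "ideal I P" by (rule ideal_tensor_ideal[OF A KA])

lemma T_def: "T = P Quot I"
  by (simp add: tensor_algebra_def)

lemma T_cring: "cring T"
  unfolding T_def by (rule ideal.quotient_is_cring[OF I_ideal P_cring])

lemma I_keys: "f \<in> I \<Longrightarrow> Poly_Mapping.keys f \<subseteq> A \<times> A"
  using additive_subgroup.a_subset[OF ideal.axioms(1)[OF I_ideal]] by auto

lemma I_0: "0 \<in> I"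
  using additive_subgroup.zero_closed[OF ideal.axioms(1)[OF I_ideal]] by simp

lemma I_add: "f \<in> I \<Longrightarrow> g \<in> I \<Longrightarrow> f + g \<in> I"
  using additive_subgroup.a_closed[OF ideal.axioms(1)[OF I_ideal]] by simp

lemma I_minus:
  assumes "f \<in> I" shows "- f \<in> I"
proof -
  interpret cring P by (rule P_cring)
  have "inv\<^bsub>add_monoid P\<^esub> f \<in> I"
    using subgroup.m_inv_closed[OF additive_subgroup.a_subgroup[OF ideal.axioms(1)[OF I_ideal]] assms] .
  then show ?thesis
    using ominus_pair_ring[OF A, of f] I_keys[OF assms] by (simp add: a_inv_def)
qed

lemma I_mult: "f \<in> I \<Longrightarrow> Poly_Mapping.keys g \<subseteq> A \<times> A \<Longrightarrow> pair_times g f \<in> I"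
  using ideal.I_l_closed[OF I_ideal, of f g] by simp

text \<open>Equality in the tensor square is handled on representatives: computations with finite sums of pure
tensors are then computations in an abelian group modulo a subgroup, and cosets enter only in the
statements about modules.\<close>

definition tcong :: "(('a \<times> 'a) \<Rightarrow>\<^sub>0 int) \<Rightarrow> (('a \<times> 'a) \<Rightarrow>\<^sub>0 int) \<Rightarrow> bool" (infix "\<doteq>" 50)
  where "f \<doteq> g \<longleftrightarrow> f - g \<in> I"

lemma tcong_refl [simp]: "f \<doteq> f"
  by (simp add: tcong_def I_0)

lemma tcong_sym: "f \<doteq> g \<Longrightarrow> g \<doteq> f"
  unfolding tcong_def using I_minus[of "f - g"] by simp

lemma tcong_trans [trans]: "f \<doteq> g \<Longrightarrow> g \<doteq> h \<Longrightarrow> f \<doteq> h"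
  unfolding tcong_def using I_add[of "f - g" "g - h"] by simp

lemma tcong_add: "f \<doteq> g \<Longrightarrow> f' \<doteq> g' \<Longrightarrow> f + f' \<doteq> g + g'"
  unfolding tcong_def using I_add[of "f - g" "f' - g'"] by (simp add: algebra_simps)

lemma tcong_diff: "f \<doteq> g \<Longrightarrow> f' \<doteq> g' \<Longrightarrow> f - f' \<doteq> g - g'"
  unfolding tcong_def using I_add[of "f - g" "-(f' - g')"] I_minus[of "f' - g'"]
  by (simp add: algebra_simps)

lemma tcong_sum: "(\<And>i. i \<in> J \<Longrightarrow> f i \<doteq> g i) \<Longrightarrow> sum f J \<doteq> sum g J"
  by (induction J rule: infinite_finite_induct) (auto intro: tcong_add)

lemma tcong_mult: "f \<doteq> g \<Longrightarrow> Poly_Mapping.keys h \<subseteq> A \<times> A \<Longrightarrow> pair_times h f \<doteq> pair_times h g"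
  unfolding tcong_def using I_mult[of "f - g" h] by (simp add: pair_times_diff_right)

lemma pure_add_left: "a \<in> A \<Longrightarrow> a' \<in> A \<Longrightarrow> b \<in> A \<Longrightarrow> pure_pair (a + a') b \<doteq> pure_pair a b + pure_pair a' b"
  unfolding tcong_def diff_diff_eq[symmetric]
  by (rule subsetD[OF tensor_relations_ideal[OF A KA]]) (unfold tensor_relations_def ring_on_carrier algebra_on_simps, blast)

lemma pure_add_right: "a \<in> A \<Longrightarrow> b \<in> A \<Longrightarrow> b' \<in> A \<Longrightarrow> pure_pair a (b + b') \<doteq> pure_pair a b + pure_pair a b'"
  unfolding tcong_def diff_diff_eq[symmetric]
  by (rule subsetD[OF tensor_relations_ideal[OF A KA]]) (unfold tensor_relations_def ring_on_carrier algebra_on_simps, blast)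

lemma pure_scale: "r \<in> K \<Longrightarrow> a \<in> A \<Longrightarrow> b \<in> A \<Longrightarrow> pure_pair (r * a) b \<doteq> pure_pair a (r * b)"
  unfolding tcong_def
  by (rule subsetD[OF tensor_relations_ideal[OF A KA]]) (unfold tensor_relations_def ring_on_carrier algebra_on_simps, blast)

lemma pure_0_left: "b \<in> A \<Longrightarrow> pure_pair 0 b \<doteq> 0"
  using pure_add_left[of 0 0 b] is_subring_0[OF A] I_minus[of "- pure_pair 0 b"]
  by (simp add: tcong_def)

lemma pure_0_right: "a \<in> A \<Longrightarrow> pure_pair a 0 \<doteq> 0"
  using pure_add_right[of a 0 0] is_subring_0[OF A] I_minus[of "- pure_pair a 0"]
  by (simp add: tcong_def)

lemma pure_sum_left:
  assumes b: "b \<in> A" and f: "\<And>i. i \<in> J \<Longrightarrow> f i \<in> A"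
  shows "pure_pair (sum f J) b \<doteq> (\<Sum>i\<in>J. pure_pair (f i) b)"
  using f
proof (induction J rule: infinite_finite_induct)
  case (insert i J)
  have "pure_pair (sum f (insert i J)) b \<doteq> pure_pair (f i) b + pure_pair (sum f J) b"
    using insert pure_add_left[of "f i" "sum f J" b] b is_subring_sum[OF A, of J f] by auto
  also have "\<dots> \<doteq> pure_pair (f i) b + (\<Sum>i\<in>J. pure_pair (f i) b)"
    using insert by (intro tcong_add) auto
  finally show ?case using insert.hyps by simp
qed (simp_all add: pure_0_left b)

lemma pure_sum_right:
  assumes a: "a \<in> A" and f: "\<And>i. i \<in> J \<Longrightarrow> f i \<in> A"
  shows "pure_pair a (sum f J) \<doteq> (\<Sum>i\<in>J. pure_pair a (f i))"
  using f
proof (induction J rule: infinite_finite_induct)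
  case (insert i J)
  have "pure_pair a (sum f (insert i J)) \<doteq> pure_pair a (f i) + pure_pair a (sum f J)"
    using insert pure_add_right[of a "f i" "sum f J"] a is_subring_sum[OF A, of J f] by auto
  also have "\<dots> \<doteq> pure_pair a (f i) + (\<Sum>i\<in>J. pure_pair a (f i))"
    using insert by (intro tcong_add) auto
  finally show ?case using insert.hyps by simp
qed (simp_all add: pure_0_right a)

lemma pure_diff_left:
  assumes "a \<in> A" "a' \<in> A" "b \<in> A"
  shows "pure_pair (a - a') b \<doteq> pure_pair a b - pure_pair a' b"
  using tcong_diff[OF tcong_sym[OF pure_add_left[of "a - a'" a' b]] tcong_refl[of "pure_pair a' b"]]
    assms is_subring_diff[OF A] by simp

lemma tclass_eq:
  assumes "Poly_Mapping.keys f \<subseteq> A \<times> A" "Poly_Mapping.keys g \<subseteq> A \<times> A" "f \<doteq> g"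
  shows "tclass f = tclass g"
proof -
  interpret cring P by (rule P_cring)
  have "f \<ominus>\<^bsub>P\<^esub> g = f - g"
    unfolding a_minus_def using assms(2) by (simp add: ominus_pair_ring[OF A])
  then show ?thesis
    using quotient_eq_iff_same_a_r_cos[OF I_ideal, of f g] assms by (simp add: tcong_def)
qed

lemma tclass_hom: "(\<lambda>f. tclass f) \<in> ring_hom P T"
  unfolding T_def by (rule ideal.rcos_ring_hom[OF I_ideal])

lemma tclass_mult: "Poly_Mapping.keys f \<subseteq> A \<times> A \<Longrightarrow> Poly_Mapping.keys g \<subseteq> A \<times> A \<Longrightarrow>
    tclass f \<otimes>\<^bsub>T\<^esub> tclass g = tclass (pair_times f g)"
  using ring_hom_mult[OF tclass_hom, of f g] by simp

lemma tclass_add: "Poly_Mapping.keys f \<subseteq> A \<times> A \<Longrightarrow> Poly_Mapping.keys g \<subseteq> A \<times> A \<Longrightarrow>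
    tclass f \<oplus>\<^bsub>T\<^esub> tclass g = tclass (f + g)"
  using ring_hom_add[OF tclass_hom, of f g] by simp

lemma tclass_one: "\<one>\<^bsub>T\<^esub> = tclass (pure_pair 1 1)"
  using ring_hom_one[OF tclass_hom] by simp

lemma tclass_closed: "Poly_Mapping.keys f \<subseteq> A \<times> A \<Longrightarrow> tclass f \<in> carrier T"
  using ring_hom_closed[OF tclass_hom, of f] by simp

lemma T_cases:
  assumes "t \<in> carrier T"
  obtains f where "Poly_Mapping.keys f \<subseteq> A \<times> A" "t = tclass f"
  using assms unfolding T_def FactRing_def A_RCOSETS_def' by auto

lemma multiplication_map_tclass:
  assumes f: "Poly_Mapping.keys f \<subseteq> A \<times> A"
  shows "multiplication_map (algebra_on A) (tclass f) = mult_out f"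
proof -
  have "tclass f = (\<lambda>i. i + f) ` I" unfolding a_r_coset_def' by auto
  moreover have "multiplication_rep (algebra_on A) (i + f) = mult_out f" if "i \<in> I" for i
    using that I_keys[OF that] f keys_add_subset[of i "A \<times> A" f]
    by (simp add: multiplication_rep_sum[OF A] mult_out_def[symmetric] mult_out_add tensor_ideal_kernel[OF A KA])
  ultimately have "multiplication_rep (algebra_on A) ` tclass f = {mult_out f}"
    using I_0 by (auto simp: image_image intro!: rev_image_eqI[of 0])
  then show ?thesis by (simp add: multiplication_map_def)
qed

lemma multiplication_module_simps [simp]:
  "carrier M = A" "x \<oplus>\<^bsub>M\<^esub> y = x + y" "\<zero>\<^bsub>M\<^esub> = 0"
  "c \<odot>\<^bsub>M\<^esub> x = multiplication_map (algebra_on A) c * x"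
  by (simp_all add: multiplication_module_def)

lemma module_multiplication_module: "Module.module T M"
proof (rule moduleI)
  show "cring T" by (rule T_cring)
  show "abelian_group M"
  proof (rule abelian_groupI)
    fix x assume "x \<in> carrier M"
    then show "\<exists>y\<in>carrier M. y \<oplus>\<^bsub>M\<^esub> x = \<zero>\<^bsub>M\<^esub>"
      using is_subring_minus[OF A] by (intro bexI[of _ "- x"]) auto
  qed (auto simp: is_subringD[OF A])
qed (auto elim!: T_cases simp: multiplication_map_tclass tclass_add tclass_mult tclass_one
       keys_add_subset keys_pair_times[OF A] is_subringD[OF A] mult_out_add mult_out_times
       mult_out_closed[OF A] distrib_left distrib_right mult.assoc)

end

section \<open>A criterion for strong separability\<close>

lemma module_homI:
  assumes "\<And>x. x \<in> carrier M \<Longrightarrow> h x \<in> carrier N"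
    and "\<And>x y. x \<in> carrier M \<Longrightarrow> y \<in> carrier M \<Longrightarrow> h (x \<oplus>\<^bsub>M\<^esub> y) = h x \<oplus>\<^bsub>N\<^esub> h y"
    and "\<And>r x. r \<in> carrier R \<Longrightarrow> x \<in> carrier M \<Longrightarrow> h (r \<odot>\<^bsub>M\<^esub> x) = r \<odot>\<^bsub>N\<^esub> h x"
  shows "h \<in> module_hom R M N"
  using assms by (auto simp: module_hom_def)

lemma free_module_simps [simp]:
  "carrier (free_module R J) = {f \<in> J \<rightarrow>\<^sub>E carrier R. finite {i \<in> J. f i \<noteq> \<zero>\<^bsub>R\<^esub>}}"
  "f \<oplus>\<^bsub>free_module R J\<^esub> g = (\<lambda>i\<in>J. f i \<oplus>\<^bsub>R\<^esub> g i)"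
  "r \<odot>\<^bsub>free_module R J\<^esub> f = (\<lambda>i\<in>J. r \<otimes>\<^bsub>R\<^esub> f i)"
  by (simp_all add: free_module_def)

context ring_extension
begin

lemma algebra_extension: "algebra (ring_on K) (algebra_on A)"
  unfolding algebra_def module_def module_axioms_def algebra_axioms_def
  using cring_ring_on[OF K] cring_algebra_on[OF A] KA
  by (auto simp: cring_def ring_def is_subring_mult[OF A] algebra_simps)

lemma module_extension: "Module.module (ring_on K) (algebra_on A)"
  using algebra_extension by (simp add: algebra_def)

text \<open>An element \<open>e\<close> as in the hypotheses is a separability idempotent. It splits the multiplication
\<open>A \<otimes> A \<rightarrow> A\<close> by \<open>s \<mapsto> (s \<otimes> 1) e\<close>, which is linear over \<open>A \<otimes> A\<close> because \<open>(1 \<otimes> b) e = (b \<otimes> 1) e\<close>.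
So \<open>A\<close> is a direct summand of the free module of rank one.\<close>

lemma separable_algebraI:
  assumes e: "Poly_Mapping.keys e \<subseteq> A \<times> A" and e1: "mult_out e = 1"
    and comm: "\<And>z. z \<in> A \<Longrightarrow> pair_times (pure_pair z 1) e \<doteq> pair_times (pure_pair 1 z) e"
  shows "separable_algebra (ring_on K) (algebra_on A)"
proof -
  define j where "j s = pair_times (pure_pair s 1) e" for s
  have pure: "Poly_Mapping.keys (pure_pair a b) \<subseteq> A \<times> A" if "a \<in> A" "b \<in> A" for a b
    using that by simp
  note A1 = is_subring_1[OF A]
  have j_keys: "Poly_Mapping.keys (j s) \<subseteq> A \<times> A" if "s \<in> A" for s
    unfolding j_def by (intro keys_pair_times[OF A] pure that e A1)
  have mult_e: "pair_times f e \<doteq> pair_times g e"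
    if "f \<doteq> g" for f g
    using tcong_mult[OF that e] by (simp add: pair_times_commute[of _ e])
  have j_diff: "j (s - s') \<doteq> j s - j s'" if "s \<in> A" "s' \<in> A" for s s'
  proof -
    have "j (s - s') \<doteq> pair_times (pure_pair s 1 - pure_pair s' 1) e"
      unfolding j_def by (intro mult_e pure_diff_left that A1)
    then show ?thesis by (simp add: j_def pair_times_diff_left)
  qed
  have j_add: "j (s + s') \<doteq> j s + j s'" if "s \<in> A" "s' \<in> A" for s s'
  proof -
    have "j (s + s') \<doteq> pair_times (pure_pair s 1 + pure_pair s' 1) e"
      unfolding j_def by (intro mult_e pure_add_left that A1)
    then show ?thesis by (simp add: j_def pair_times_add_left)
  qed
  have j_mult: "j (mult_out f * s) \<doteq> pair_times f (j s)"
    if f: "Poly_Mapping.keys f \<subseteq> A \<times> A" and s: "s \<in> A" for f s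
  proof -
    have "j (mult_out f * s) \<doteq> pair_times f (j s) \<and> mult_out f \<in> A" using f
    proof (induction f rule: frag_induction)
      case zero
      show ?case using pure_0_left[OF A1] mult_e[of "pure_pair 0 1" 0] is_subring_0[OF A]
        by (simp add: j_def)
    next
      case (one x)
      then obtain a b where x: "x = (a, b)" and ab: "a \<in> A" "b \<in> A" by auto
      have "pair_times (frag_of x) (j s) = pair_times (pure_pair (a * s) 1) (pair_times (pure_pair 1 b) e)"
        by (simp add: x j_def pair_times_assoc[symmetric] pair_times_single)
      moreover have "pair_times (pure_pair (a * s) 1) (pair_times (pure_pair b 1) e) \<doteq>
          pair_times (pure_pair (a * s) 1) (pair_times (pure_pair 1 b) e)"
        by (intro tcong_mult comm ab pure is_subring_mult[OF A] s A1)
      moreover have "j (mult_out (frag_of x) * s) = pair_times (pure_pair (a * s) 1) (pair_times (pure_pair b 1) e)"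
        by (simp add: x j_def pair_times_assoc[symmetric] pair_times_single mult_ac)
      ultimately show ?case using ab is_subring_mult[OF A] by (simp add: x)
    next
      case (diff f g)
      have "j (mult_out (f - g) * s) \<doteq> j (mult_out f * s) - j (mult_out g * s)"
        using diff j_diff[of "mult_out f * s" "mult_out g * s"] is_subring_mult[OF A] s
        by (simp add: mult_out_diff left_diff_distrib)
      also have "\<dots> \<doteq> pair_times f (j s) - pair_times g (j s)"
        using diff by (intro tcong_diff) auto
      also have "\<dots> = pair_times (f - g) (j s)"
        by (rule pair_times_diff_left[symmetric])
      finally show ?case using diff is_subring_diff[OF A] by (simp add: mult_out_diff)
    qed
    then show ?thesis ..
  qed
  \<comment> \<open>The free module of rank one, with index set \<open>{1}\<close>.\<close>
  define \<iota> where "\<iota> s = (\<lambda>_\<in>{1::'a}. tclass (j s))" for s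
  define \<pi> where "\<pi> f = multiplication_map (algebra_on A) (f (1::'a))" for f
  have "\<iota> \<in> module_hom T M (free_module T {1::'a})"
  proof (rule module_homI)
    fix s assume "s \<in> carrier M"
    then show "\<iota> s \<in> carrier (free_module T {1::'a})"
      using tclass_closed[OF j_keys] by (auto simp: \<iota>_def)
  next
    fix s s' assume s: "s \<in> carrier M" "s' \<in> carrier M"
    have "tclass (j (s + s')) = tclass (j s + j s')"
      using s by (intro tclass_eq j_add j_keys keys_add_subset is_subring_add[OF A]) auto
    then show "\<iota> (s \<oplus>\<^bsub>M\<^esub> s') = \<iota> s \<oplus>\<^bsub>free_module T {1::'a}\<^esub> \<iota> s'"
      using s unfolding \<iota>_def free_module_simps
      by (intro restrict_ext) (simp add: tclass_add j_keys)
  next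
    fix t s assume t: "t \<in> carrier T" and s: "s \<in> carrier M"
    obtain f where f: "Poly_Mapping.keys f \<subseteq> A \<times> A" "t = tclass f" using T_cases[OF t] .
    have "tclass (j (mult_out f * s)) = tclass (pair_times f (j s))"
      using s f by (intro tclass_eq j_mult j_keys keys_pair_times[OF A] is_subring_mult[OF A]
        mult_out_closed[OF A]) auto
    then show "\<iota> (t \<odot>\<^bsub>M\<^esub> s) = t \<odot>\<^bsub>free_module T {1::'a}\<^esub> \<iota> s"
      using s f unfolding \<iota>_def free_module_simps
      by (intro restrict_ext) (simp add: tclass_mult j_keys multiplication_map_tclass)
  qed
  moreover have "\<pi> \<in> module_hom T (free_module T {1::'a}) M"
  proof (rule module_homI)
    fix f assume "f \<in> carrier (free_module T {1::'a})"
    then have "f 1 \<in> carrier T" by auto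
    then show "\<pi> f \<in> carrier M"
      by (rule T_cases) (simp add: \<pi>_def multiplication_map_tclass mult_out_closed[OF A])
  next
    fix f g assume "f \<in> carrier (free_module T {1::'a})" "g \<in> carrier (free_module T {1::'a})"
    then have "f 1 \<in> carrier T" "g 1 \<in> carrier T" by auto
    then show "\<pi> (f \<oplus>\<^bsub>free_module T {1::'a}\<^esub> g) = \<pi> f \<oplus>\<^bsub>M\<^esub> \<pi> g"
      by (elim T_cases) (simp add: \<pi>_def multiplication_map_tclass tclass_add keys_add_subset mult_out_add)
  next
    fix t f assume "t \<in> carrier T" "f \<in> carrier (free_module T {1::'a})"
    then have "t \<in> carrier T" "f 1 \<in> carrier T" by auto
    then show "\<pi> (t \<odot>\<^bsub>free_module T {1::'a}\<^esub> f) = t \<odot>\<^bsub>M\<^esub> \<pi> f"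
      by (elim T_cases) (simp add: \<pi>_def multiplication_map_tclass tclass_mult
        keys_pair_times[OF A] mult_out_times)
  qed
  moreover have "\<pi> (\<iota> s) = s" if "s \<in> carrier M" for s
    using that by (simp add: \<iota>_def \<pi>_def multiplication_map_tclass j_keys) (simp add: j_def mult_out_times e1)
  ultimately have "projective_module T M"
    unfolding projective_module_def using module_multiplication_module by blast
  then show ?thesis by (simp add: separable_algebra_def algebra_extension)
qed

text \<open>The functionals \<open>z \<mapsto> tr (y b * z)\<close> and the elements \<open>b\<close> form a dual basis, so \<open>A\<close> is finitely
generated projective. The element \<open>\<Sum> b \<otimes> y b\<close> is a separability idempotent: expand \<open>z b\<close> in the
dual basis, move the coefficients, which lie in \<open>K\<close>, across the tensor sign, and collect them with
the second expansion.\<close>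

theorem strongly_separable_algebraI:
  assumes B: "finite B" "B \<subseteq> A" and y: "\<And>b. b \<in> B \<Longrightarrow> y b \<in> A"
    and tr: "\<And>z. z \<in> A \<Longrightarrow> tr z \<in> K"
    and tr_add: "\<And>z w. z \<in> A \<Longrightarrow> w \<in> A \<Longrightarrow> tr (z + w) = tr z + tr w"
    and tr_mult: "\<And>r z. r \<in> K \<Longrightarrow> z \<in> A \<Longrightarrow> tr (r * z) = r * tr z"
    and dual: "\<And>z. z \<in> A \<Longrightarrow> (\<Sum>b\<in>B. tr (y b * z) * b) = z"
    and dual': "\<And>z. z \<in> A \<Longrightarrow> (\<Sum>b\<in>B. tr (z * b) * y b) = z"
    and one: "(\<Sum>b\<in>B. b * y b) = 1"
  shows "strongly_separable_algebra (ring_on K) (algebra_on A)"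
proof -
  have trm: "tr (y b * z) \<in> K" if "b \<in> B" "z \<in> A" for b z
    using that y is_subring_mult[OF A] tr by blast
  have fg: "finitely_generated_module (ring_on K) (algebra_on A)"
    unfolding finitely_generated_module_def
  proof (intro conjI exI[of _ B] ballI module_extension)
    fix x assume "x \<in> carrier (algebra_on A)"
    then have x: "x \<in> A" by simp
    show "\<exists>c\<in>B \<rightarrow> carrier (ring_on K). x = (\<Oplus>\<^bsub>algebra_on A\<^esub>b\<in>B. c b \<odot>\<^bsub>algebra_on A\<^esub> b)"
    proof (intro bexI[of _ "\<lambda>b. tr (y b * x)"])
      have "(\<Oplus>\<^bsub>algebra_on A\<^esub>b\<in>B. tr (y b * x) * b) = (\<Sum>b\<in>B. tr (y b * x) * b)"
        using trm[OF _ x] KA B is_subring_mult[OF A] by (intro finsum_algebra_on[OF A]) blast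
      then show "x = (\<Oplus>\<^bsub>algebra_on A\<^esub>b\<in>B. tr (y b * x) \<odot>\<^bsub>algebra_on A\<^esub> b)"
        using dual[OF x] by simp
    qed (use trm[OF _ x] in auto)
  qed (use B in auto)
  have "projective_module (ring_on K) (algebra_on A)"
  proof -
    define \<iota> where "\<iota> z = (\<lambda>b\<in>B. tr (y b * z))" for z
    define \<pi> where "\<pi> f = (\<Sum>b\<in>B. f b * b)" for f :: "'a \<Rightarrow> 'a"
    have "\<iota> \<in> module_hom (ring_on K) (algebra_on A) (free_module (ring_on K) B)"
    proof (rule module_homI)
      fix z w assume "z \<in> carrier (algebra_on A)" "w \<in> carrier (algebra_on A)"
      then show "\<iota> (z \<oplus>\<^bsub>algebra_on A\<^esub> w) = \<iota> z \<oplus>\<^bsub>free_module (ring_on K) B\<^esub> \<iota> w"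
        using y by (auto simp: \<iota>_def fun_eq_iff distrib_left tr_add is_subring_mult[OF A])
    next
      fix r z assume rz: "r \<in> carrier (ring_on K)" "z \<in> carrier (algebra_on A)"
      then have "tr (y b * (r * z)) = r * tr (y b * z)" if "b \<in> B" for b
        using tr_mult[of r "y b * z"] y[OF that] is_subring_mult[OF A] by (simp add: mult.left_commute)
      then show "\<iota> (r \<odot>\<^bsub>algebra_on A\<^esub> z) = r \<odot>\<^bsub>free_module (ring_on K) B\<^esub> \<iota> z"
        by (auto simp: \<iota>_def fun_eq_iff)
    qed (use trm B in \<open>auto simp: \<iota>_def\<close>)
    moreover have "\<pi> \<in> module_hom (ring_on K) (free_module (ring_on K) B) (algebra_on A)"
    proof (rule module_homI)
      fix f assume "f \<in> carrier (free_module (ring_on K) B)"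
      then show "\<pi> f \<in> carrier (algebra_on A)"
        using KA B by (auto simp: \<pi>_def intro!: is_subring_sum[OF A] is_subring_mult[OF A])
    qed (auto simp: \<pi>_def distrib_right sum.distrib sum_distrib_left mult.assoc)
    moreover have "\<pi> (\<iota> z) = z" if "z \<in> carrier (algebra_on A)" for z
      using dual that by (simp add: \<iota>_def \<pi>_def)
    ultimately show ?thesis
      unfolding projective_module_def using module_extension by blast
  qed
  moreover have "separable_algebra (ring_on K) (algebra_on A)"
  proof (rule separable_algebraI)
    let ?e = "\<Sum>b\<in>B. pure_pair b (y b)"
    have e_keys: "Poly_Mapping.keys (\<Sum>b\<in>C. pure_pair b (y b)) \<subseteq> A \<times> A" if "C \<subseteq> B" for C
      using that B y by (intro order_trans[OF keys_sum]) fastforce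
    show "Poly_Mapping.keys ?e \<subseteq> A \<times> A" by (rule e_keys) simp
    have "mult_out (\<Sum>b\<in>C. pure_pair b (y b)) = (\<Sum>b\<in>C. b * y b)" for C
      by (induction C rule: infinite_finite_induct) (simp_all add: mult_out_add)
    then show "mult_out ?e = 1" using one by simp
    fix z assume z: "z \<in> A"
    have e_left: "pair_times (pure_pair a c) (\<Sum>b\<in>C. pure_pair b (y b)) = (\<Sum>b\<in>C. pure_pair (a * b) (c * y b))" for a c C
      by (induction C rule: infinite_finite_induct) (simp_all add: pair_times_add_right pair_times_single)
    define k where "k b c = tr (y c * (z * b))" for b c
    have k: "k b c \<in> K" if "b \<in> B" "c \<in> B" for b c
      unfolding k_def using trm that z B is_subring_mult[OF A] by blast
    have zb: "z * b = (\<Sum>c\<in>B. k b c * c)" if "b \<in> B" for b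
      unfolding k_def using that z B dual[of "z * b"] is_subring_mult[OF A] by auto
    have "pair_times (pure_pair z 1) ?e = (\<Sum>b\<in>B. pure_pair (\<Sum>c\<in>B. k b c * c) (y b))"
      by (simp add: e_left zb)
    also have "\<dots> \<doteq> (\<Sum>b\<in>B. \<Sum>c\<in>B. pure_pair (k b c * c) (y b))"
      using k KA B y by (intro tcong_sum pure_sum_left is_subring_mult[OF A]) auto
    also have "\<dots> \<doteq> (\<Sum>b\<in>B. \<Sum>c\<in>B. pure_pair c (k b c * y b))"
      using k B y by (intro tcong_sum pure_scale) auto
    also have "\<dots> = (\<Sum>c\<in>B. \<Sum>b\<in>B. pure_pair c (k b c * y b))"
      by (rule sum.swap)
    also have "\<dots> \<doteq> (\<Sum>c\<in>B. pure_pair c (\<Sum>b\<in>B. k b c * y b))"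
      using k KA B y by (intro tcong_sum tcong_sym[OF pure_sum_right] is_subring_mult[OF A]) auto
    also have "\<dots> = pair_times (pure_pair 1 z) ?e"
    proof -
      have "(\<Sum>b\<in>B. k b c * y b) = z * y c" if "c \<in> B" for c
        using dual'[of "y c * z"] y[OF that] z is_subring_mult[OF A] by (simp add: k_def mult_ac)
      then show ?thesis by (simp add: e_left)
    qed
    finally show "pair_times (pure_pair z 1) ?e \<doteq> pair_times (pure_pair 1 z) ?e" .
  qed
  ultimately show ?thesis using fg by (simp add: strongly_separable_algebra_def)
qed

end

section \<open>Group actions that are free on finite quotients\<close>

text \<open>The group is given only by the set of maps by which it acts. Composites and inverses are required up to
agreement on \<open>E\<close>, because the maps may do anything outside \<open>E\<close>.\<close>

locale ring_action =
  fixes E :: "'a::comm_ring_1 set" and \<Phi> :: "('a \<Rightarrow> 'a) set"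
  assumes E: "is_subring E"
    and act_closed: "\<And>\<phi> x. \<phi> \<in> \<Phi> \<Longrightarrow> x \<in> E \<Longrightarrow> \<phi> x \<in> E"
    and act_add: "\<And>\<phi> x y. \<phi> \<in> \<Phi> \<Longrightarrow> x \<in> E \<Longrightarrow> y \<in> E \<Longrightarrow> \<phi> (x + y) = \<phi> x + \<phi> y"
    and act_mult: "\<And>\<phi> x y. \<phi> \<in> \<Phi> \<Longrightarrow> x \<in> E \<Longrightarrow> y \<in> E \<Longrightarrow> \<phi> (x * y) = \<phi> x * \<phi> y"
    and act_1: "\<And>\<phi>. \<phi> \<in> \<Phi> \<Longrightarrow> \<phi> 1 = 1"
    and act_comp: "\<And>\<phi> \<psi>. \<phi> \<in> \<Phi> \<Longrightarrow> \<psi> \<in> \<Phi> \<Longrightarrow> \<exists>\<chi>\<in>\<Phi>. \<forall>x\<in>E. \<chi> x = \<phi> (\<psi> x)"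
    and act_id: "\<exists>\<phi>\<in>\<Phi>. \<forall>x\<in>E. \<phi> x = x"
    and act_inv: "\<And>\<phi>. \<phi> \<in> \<Phi> \<Longrightarrow> \<exists>\<psi>\<in>\<Phi>. \<forall>x\<in>E. \<phi> (\<psi> x) = x \<and> \<psi> (\<phi> x) = x"
begin

definition fixed :: "'a set"
  where "fixed = {x \<in> E. \<forall>\<phi>\<in>\<Phi>. \<phi> x = x}"

lemma act_0: "\<phi> \<in> \<Phi> \<Longrightarrow> \<phi> 0 = 0"
  using act_add[of \<phi> 0 0] is_subring_0[OF E] by simp

lemma act_diff: "\<phi> \<in> \<Phi> \<Longrightarrow> x \<in> E \<Longrightarrow> y \<in> E \<Longrightarrow> \<phi> (x - y) = \<phi> x - \<phi> y"
  using act_add[of \<phi> "x - y" y] is_subring_diff[OF E] by (simp add: algebra_simps)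

lemma act_sum: "\<phi> \<in> \<Phi> \<Longrightarrow> (\<And>i. i \<in> J \<Longrightarrow> f i \<in> E) \<Longrightarrow> \<phi> (sum f J) = (\<Sum>i\<in>J. \<phi> (f i))"
  by (induction J rule: infinite_finite_induct) (auto simp: act_0 act_add is_subring_sum[OF E])

lemma is_subring_fixed: "is_subring fixed"
  unfolding is_subring_def fixed_def using is_subringD(1,3,4)[OF E]
  by (auto simp: act_1 act_diff act_mult) metis

text \<open>The functions \<open>\<phi> \<mapsto> \<Sum> x\<^sub>i \<phi>(y\<^sub>i)\<close> with \<open>x\<^sub>i, y\<^sub>i \<in> L\<close>, as functions on the group. The \<open>x\<^sub>i\<close>
are taken distinct, so that they can index the sum. The literal identity is added to the group, which
contains only some map that agrees with it on \<open>E\<close>.\<close>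

definition representable :: "'a set \<Rightarrow> (('a \<Rightarrow> 'a) \<Rightarrow> 'a) \<Rightarrow> bool"
  where "representable L F \<longleftrightarrow> (\<exists>B y. finite B \<and> B \<subseteq> L \<and> y ` B \<subseteq> L \<and>
     (\<forall>\<phi>\<in>insert id \<Phi>. F \<phi> = (\<Sum>b\<in>B. b * \<phi> (y b))))"

context
  fixes L assumes L: "is_subring L" and LE: "L \<subseteq> E"
begin

lemma representable_monomial: "x \<in> L \<Longrightarrow> y \<in> L \<Longrightarrow> representable L (\<lambda>\<phi>. x * \<phi> y)"
  unfolding representable_def by (intro exI[of _ "{x}"] exI[of _ "\<lambda>_. y"]) simp

lemma representable_cong:
  assumes "representable L F" and eq: "\<And>\<phi>. \<phi> \<in> insert id \<Phi> \<Longrightarrow> F \<phi> = F' \<phi>"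
  shows "representable L F'"
proof -
  obtain B y where "finite B" "B \<subseteq> L" "y ` B \<subseteq> L"
    and F: "\<And>\<phi>. \<phi> \<in> insert id \<Phi> \<Longrightarrow> F \<phi> = (\<Sum>b\<in>B. b * \<phi> (y b))"
    using assms(1) unfolding representable_def by blast
  moreover have "\<forall>\<phi>\<in>insert id \<Phi>. F' \<phi> = (\<Sum>b\<in>B. b * \<phi> (y b))"
    using eq F by metis
  ultimately show ?thesis unfolding representable_def by blast
qed

lemma representable_const:
  assumes "x \<in> L" shows "representable L (\<lambda>\<phi>. x)"
  by (rule representable_cong[OF representable_monomial[OF assms is_subring_1[OF L]]]) (auto simp: act_1)

lemma representable_add:
  assumes "representable L F" "representable L F'"
  shows "representable L (\<lambda>\<phi>. F \<phi> + F' \<phi>)"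
proof -
  obtain B y where B: "finite B" "B \<subseteq> L" "y ` B \<subseteq> L"
    and F: "\<And>\<phi>. \<phi> \<in> insert id \<Phi> \<Longrightarrow> F \<phi> = (\<Sum>b\<in>B. b * \<phi> (y b))"
    using assms(1) unfolding representable_def by blast
  obtain B' y' where B': "finite B'" "B' \<subseteq> L" "y' ` B' \<subseteq> L"
    and F': "\<And>\<phi>. \<phi> \<in> insert id \<Phi> \<Longrightarrow> F' \<phi> = (\<Sum>b\<in>B'. b * \<phi> (y' b))"
    using assms(2) unfolding representable_def by blast
  define z where "z b = (if b \<in> B then y b else 0)" for b
  define z' where "z' b = (if b \<in> B' then y' b else 0)" for b
  have zL: "z b \<in> L" "z' b \<in> L" for b
    using B B' is_subring_0[OF L] by (auto simp: z_def z'_def)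
  show ?thesis unfolding representable_def
  proof (intro exI[of _ "B \<union> B'"] exI[of _ "\<lambda>b. z b + z' b"] conjI ballI)
    fix \<phi> assume \<phi>: "\<phi> \<in> insert id \<Phi>"
    then have \<phi>0: "\<phi> 0 = 0" by (auto simp: act_0)
    have add: "\<phi> (z b + z' b) = \<phi> (z b) + \<phi> (z' b)" for b
      using \<phi> zL LE by (auto simp: act_add subset_iff)
    have "F \<phi> = (\<Sum>b\<in>B \<union> B'. b * \<phi> (z b))"
      unfolding F[OF \<phi>] using B B' by (intro sum.mono_neutral_cong_left) (auto simp: z_def \<phi>0)
    moreover have "F' \<phi> = (\<Sum>b\<in>B \<union> B'. b * \<phi> (z' b))"
      unfolding F'[OF \<phi>] using B B' by (intro sum.mono_neutral_cong_left) (auto simp: z'_def \<phi>0)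
    ultimately show "F \<phi> + F' \<phi> = (\<Sum>b\<in>B \<union> B'. b * \<phi> (z b + z' b))"
      by (simp add: add distrib_left sum.distrib)
  qed (use B B' zL is_subring_add[OF L] in auto)
qed

lemma representable_sum: "(\<And>i. i \<in> J \<Longrightarrow> representable L (F i)) \<Longrightarrow> representable L (\<lambda>\<phi>. \<Sum>i\<in>J. F i \<phi>)"
  by (induction J rule: infinite_finite_induct)
     (auto intro: representable_const is_subring_0[OF L] representable_add)

text \<open>This closure under products is where multiplicativity of the action is used: it turns separation of
the identity from one map at a time into separation from finitely many maps at once.\<close>

lemma representable_mult:
  assumes "representable L F" "representable L F'"
  shows "representable L (\<lambda>\<phi>. F \<phi> * F' \<phi>)"
proof -
  obtain B y where B: "finite B" "B \<subseteq> L" "y ` B \<subseteq> L"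
    and F: "\<And>\<phi>. \<phi> \<in> insert id \<Phi> \<Longrightarrow> F \<phi> = (\<Sum>b\<in>B. b * \<phi> (y b))"
    using assms(1) unfolding representable_def by blast
  obtain B' y' where B': "finite B'" "B' \<subseteq> L" "y' ` B' \<subseteq> L"
    and F': "\<And>\<phi>. \<phi> \<in> insert id \<Phi> \<Longrightarrow> F' \<phi> = (\<Sum>b\<in>B'. b * \<phi> (y' b))"
    using assms(2) unfolding representable_def by blast
  have "representable L (\<lambda>\<phi>. \<Sum>b\<in>B. \<Sum>c\<in>B'. (b * c) * \<phi> (y b * y' c))"
    using B B' by (intro representable_sum representable_monomial is_subring_mult[OF L]) auto
  then show ?thesis
  proof (rule representable_cong)
    fix \<phi> assume \<phi>: "\<phi> \<in> insert id \<Phi>"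
    have "\<phi> (y b * y' c) = \<phi> (y b) * \<phi> (y' c)" if "b \<in> B" "c \<in> B'" for b c
      using \<phi> that B B' LE by (auto simp: act_mult subset_iff)
    then show "(\<Sum>b\<in>B. \<Sum>c\<in>B'. (b * c) * \<phi> (y b * y' c)) = F \<phi> * F' \<phi>"
      unfolding F[OF \<phi>] F'[OF \<phi>] sum_product by (intro sum.cong refl) (simp add: mult_ac)
  qed
qed

lemma representable_prod: "(\<And>i. i \<in> J \<Longrightarrow> representable L (F i)) \<Longrightarrow> representable L (\<lambda>\<phi>. \<Prod>i\<in>J. F i \<phi>)"
  by (induction J rule: infinite_finite_induct)
     (auto intro: representable_const is_subring_1[OF L] representable_mult)

lemma representable_determined:
  assumes "representable L F" "\<phi> \<in> insert id \<Phi>" "\<psi> \<in> insert id \<Phi>" "\<And>x. x \<in> L \<Longrightarrow> \<phi> x = \<psi> x"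
  shows "F \<phi> = F \<psi>"
proof -
  obtain B y where "y ` B \<subseteq> L" "\<And>\<phi>. \<phi> \<in> insert id \<Phi> \<Longrightarrow> F \<phi> = (\<Sum>b\<in>B. b * \<phi> (y b))"
    using assms(1) unfolding representable_def by blast
  then show ?thesis using assms(2-) by (auto intro!: sum.cong)
qed

text \<open>The witness is \<open>F \<psi> = 1 - u \<Sum>\<^sub>j (\<phi>\<^sup>j y - \<psi>(\<phi>\<^sup>j y))\<close> with \<open>j < m\<close>. The sum vanishes for
\<open>\<psi> = id\<close>, and for \<open>\<psi> = \<phi>\<close> it telescopes to \<open>y - \<phi>\<^sup>m y\<close>.\<close>

lemma separating_if_power_difference_unit:
  assumes \<phi>: "\<phi> \<in> \<Phi>" and stable: "\<And>x. x \<in> L \<Longrightarrow> \<phi> x \<in> L"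
    and y: "y \<in> L" and u: "u \<in> L" "u * (y - (\<phi> ^^ m) y) = 1"
  shows "\<exists>F. representable L F \<and> F id = 1 \<and> F \<phi> = 0"
proof (intro exI conjI)
  have yj: "(\<phi> ^^ j) y \<in> L" for j
    by (induction j) (auto simp: y stable)
  let ?F = "\<lambda>\<psi>. 1 + (\<Sum>j<m. (- u) * (\<phi> ^^ j) y + u * \<psi> ((\<phi> ^^ j) y))"
  show "representable L ?F"
    by (intro representable_add representable_sum representable_const representable_monomial
          is_subring_mult[OF L] is_subring_minus[OF L] is_subring_1[OF L] u yj)
  show "?F id = 1" by simp
  have "(\<Sum>j<m. (- u) * (\<phi> ^^ j) y + u * \<phi> ((\<phi> ^^ j) y)) = - u * (\<Sum>j<m. (\<phi> ^^ j) y - (\<phi> ^^ Suc j) y)"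
    by (simp add: sum_distrib_left algebra_simps)
  also have "\<dots> = - 1"
  proof -
    have "(\<Sum>j<m. (\<phi> ^^ j) y - (\<phi> ^^ Suc j) y) = y - (\<phi> ^^ m) y"
      by (induction m) simp_all
    then show ?thesis using u(2) by simp
  qed
  finally show "?F \<phi> = 0" by simp
qed

end

text \<open>The algebra \<open>S\<close> consists of the elements on which two maps agree whenever they agree on \<open>L\<close>. In
contrast to \<open>L\<close> itself it contains the fixed ring, and the group still acts on it through the same
finite quotient.\<close>

theorem strongly_separable_over_fixed:
  assumes L: "is_subring L" and LE: "L \<subseteq> E" and stable: "\<And>\<phi> x. \<phi> \<in> \<Phi> \<Longrightarrow> x \<in> L \<Longrightarrow> \<phi> x \<in> L"
    and fin: "finite ((\<lambda>\<phi>. restrict \<phi> L) ` \<Phi>)"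
    and free: "\<And>\<phi>. \<phi> \<in> \<Phi> \<Longrightarrow> \<exists>x\<in>L. \<phi> x \<noteq> x \<Longrightarrow> \<exists>F. representable L F \<and> F id = 1 \<and> F \<phi> = 0"
  shows "\<exists>S. is_subring S \<and> S \<subseteq> E \<and> fixed \<subseteq> S \<and> L \<subseteq> S \<and>
    strongly_separable_algebra (ring_on fixed) (algebra_on S)"
proof -
  define S where "S = {x \<in> E. \<forall>\<phi>\<in>\<Phi>. \<forall>\<psi>\<in>\<Phi>. (\<forall>z\<in>L. \<phi> z = \<psi> z) \<longrightarrow> \<phi> x = \<psi> x}"
  have SE: "S \<subseteq> E" and LS: "L \<subseteq> S" and KS: "fixed \<subseteq> S"
    using LE unfolding S_def fixed_def by (blast, blast, (auto; metis))
  have S: "is_subring S"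
    unfolding is_subring_def
  proof (intro conjI ballI)
    show "1 \<in> S" using is_subring_1[OF L] LS by blast
    fix x y assume "x \<in> S" "y \<in> S"
    then have xy: "x \<in> E" "y \<in> E" "\<And>\<phi> \<psi>. \<phi> \<in> \<Phi> \<Longrightarrow> \<psi> \<in> \<Phi> \<Longrightarrow> \<forall>z\<in>L. \<phi> z = \<psi> z \<Longrightarrow> \<phi> x = \<psi> x \<and> \<phi> y = \<psi> y"
      unfolding S_def by blast+
    show "x - y \<in> S" unfolding S_def
    proof (rule CollectI, rule conjI[OF is_subring_diff[OF E xy(1,2)]], intro ballI impI)
      fix \<phi> \<psi> assume "\<phi> \<in> \<Phi>" "\<psi> \<in> \<Phi>" "\<forall>z\<in>L. \<phi> z = \<psi> z"
      then show "\<phi> (x - y) = \<psi> (x - y)" using xy(3)[of \<phi> \<psi>] by (simp add: act_diff xy(1,2))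
    qed
    show "x * y \<in> S" unfolding S_def
    proof (rule CollectI, rule conjI[OF is_subring_mult[OF E xy(1,2)]], intro ballI impI)
      fix \<phi> \<psi> assume "\<phi> \<in> \<Phi>" "\<psi> \<in> \<Phi>" "\<forall>z\<in>L. \<phi> z = \<psi> z"
      then show "\<phi> (x * y) = \<psi> (x * y)" using xy(3)[of \<phi> \<psi>] by (simp add: act_mult xy(1,2))
    qed
  qed
  have S_stable: "\<phi> x \<in> S" if \<phi>: "\<phi> \<in> \<Phi>" and x: "x \<in> S" for \<phi> x
    unfolding S_def
  proof (intro CollectI conjI ballI impI)
    show "\<phi> x \<in> E" using act_closed[OF \<phi>] x SE by blast
    fix \<psi> \<psi>' assume p: "\<psi> \<in> \<Phi>" "\<psi>' \<in> \<Phi>" and eq: "\<forall>z\<in>L. \<psi> z = \<psi>' z"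
    obtain \<chi> where \<chi>: "\<chi> \<in> \<Phi>" "\<forall>x\<in>E. \<chi> x = \<psi> (\<phi> x)" using act_comp[OF p(1) \<phi>] by blast
    obtain \<chi>' where \<chi>': "\<chi>' \<in> \<Phi>" "\<forall>x\<in>E. \<chi>' x = \<psi>' (\<phi> x)" using act_comp[OF p(2) \<phi>] by blast
    have "\<forall>z\<in>L. \<chi> z = \<chi>' z" using \<chi> \<chi>' eq stable[OF \<phi>] LE by (auto simp: subset_iff)
    then have "\<chi> x = \<chi>' x" using x \<chi>(1) \<chi>'(1) unfolding S_def by blast
    then show "\<psi> (\<phi> x) = \<psi>' (\<phi> x)" using \<chi> \<chi>' x SE by auto
  qed
  define R where "R = (\<lambda>\<phi>. restrict \<phi> S) ` \<Phi>"
  have same: "restrict \<phi> S = restrict \<psi> S" if "\<phi> \<in> \<Phi>" "\<psi> \<in> \<Phi>" "\<forall>z\<in>L. \<phi> z = \<psi> z" for \<phi> \<psi>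
    using that by (intro restrict_ext) (auto simp: S_def)
  have finR: "finite R"
  proof (rule finite_imageD)
    have "(\<lambda>f. restrict f L) ` R = (\<lambda>\<phi>. restrict \<phi> L) ` \<Phi>"
      unfolding R_def image_image using LS by (simp add: restrict_restrict Int_absorb1)
    then show "finite ((\<lambda>f. restrict f L) ` R)" using fin by simp
    show "inj_on (\<lambda>f. restrict f L) R"
    proof (rule inj_onI)
      fix f g assume "f \<in> R" "g \<in> R" and eq: "restrict f L = restrict g L"
      then obtain \<phi> \<psi> where p: "\<phi> \<in> \<Phi>" "\<psi> \<in> \<Phi>" "f = restrict \<phi> S" "g = restrict \<psi> S"
        unfolding R_def by blast
      have "\<phi> z = \<psi> z" if z: "z \<in> L" for z
      proof -
        have "z \<in> S" using z LS by blast
        then show ?thesis using fun_cong[OF eq, of z] z p by simp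
      qed
      then show "f = g" unfolding p(3,4) by (intro same p ballI)
    qed
  qed
  \<comment> \<open>The unit of the finite group \<open>R\<close>; it is the image of \<open>\<epsilon>\<close>.\<close>
  define e where "e = restrict id S"
  obtain \<epsilon> where \<epsilon>: "\<epsilon> \<in> \<Phi>" "\<forall>x\<in>E. \<epsilon> x = x" using act_id by blast
  have "e = restrict \<epsilon> S" unfolding e_def using \<epsilon> SE by (intro restrict_ext) auto
  then have eR: "e \<in> R" unfolding R_def using \<epsilon>(1) by blast
  \<comment> \<open>The quotient \<open>R\<close> distinguishes exactly what \<open>L\<close> distinguishes.\<close>
  have trivial: "restrict \<phi> S = e \<longleftrightarrow> (\<forall>x\<in>L. \<phi> x = x)" if \<phi>: "\<phi> \<in> \<Phi>" for \<phi>
  proof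
    assume eq: "restrict \<phi> S = e"
    have "\<phi> x = x" if "x \<in> S" for x using fun_cong[OF eq, of x] that by (simp add: e_def)
    then show "\<forall>x\<in>L. \<phi> x = x" using LS by blast
  next
    assume "\<forall>x\<in>L. \<phi> x = x"
    then have "restrict \<phi> S = restrict \<epsilon> S" using \<epsilon> LE by (intro same \<phi>) auto
    then show "restrict \<phi> S = e" using \<open>e = restrict \<epsilon> S\<close> by simp
  qed
  have "\<exists>F. representable L F \<and> F id = 1 \<and> (\<forall>\<phi>\<in>\<Phi>. restrict \<phi> S = f \<longrightarrow> F \<phi> = 0)" if f: "f \<in> R - {e}" for f
  proof -
    obtain \<phi> where \<phi>: "\<phi> \<in> \<Phi>" "f = restrict \<phi> S" using f unfolding R_def by blast
    then obtain F where F: "representable L F" "F id = 1" "F \<phi> = 0"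
      using free[of \<phi>] trivial[of \<phi>] f by blast
    have "F \<psi> = 0" if \<psi>: "\<psi> \<in> \<Phi>" "restrict \<psi> S = f" for \<psi>
    proof -
      have "\<psi> x = \<phi> x" if "x \<in> L" for x
      proof -
        have "x \<in> S" using that LS by blast
        then show ?thesis using fun_cong[OF trans[OF \<psi>(2) \<phi>(2)], of x] by simp
      qed
      then show ?thesis using representable_determined[OF L LE F(1), of \<psi> \<phi>] \<psi> \<phi> F(3) by auto
    qed
    then show ?thesis using F by blast
  qed
  then obtain F where F: "\<And>f. f \<in> R - {e} \<Longrightarrow> representable L (F f) \<and> F f id = 1 \<and>
      (\<forall>\<phi>\<in>\<Phi>. restrict \<phi> S = f \<longrightarrow> F f \<phi> = 0)" by metis
  have "representable L (\<lambda>\<phi>. \<Prod>f\<in>R - {e}. F f \<phi>)"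
    using F by (intro representable_prod[OF L LE]) blast
  then obtain B y where B: "finite B" "B \<subseteq> L" "y ` B \<subseteq> L"
    and By: "\<And>\<phi>. \<phi> \<in> insert id \<Phi> \<Longrightarrow> (\<Prod>f\<in>R - {e}. F f \<phi>) = (\<Sum>b\<in>B. b * \<phi> (y b))"
    unfolding representable_def by blast
  have one: "(\<Sum>b\<in>B. b * y b) = 1"
    using By[of id] F by simp
  have BS: "B \<subseteq> S" and yS: "\<And>b. b \<in> B \<Longrightarrow> y b \<in> S" using B LS by auto
  have delta: "(\<Sum>b\<in>B. b * \<phi> (y b)) = (if restrict \<phi> S = e then 1 else 0)" if \<phi>: "\<phi> \<in> \<Phi>" for \<phi>
  proof (cases "restrict \<phi> S = e")
    case True
    then have "\<phi> (y b) = y b" if "b \<in> B" for b using trivial[OF \<phi>] B that by auto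
    then show ?thesis using one True by simp
  next
    case False
    then have "restrict \<phi> S \<in> R - {e}" unfolding R_def using \<phi> by blast
    then have "(\<Prod>f\<in>R - {e}. F f \<phi>) = 0"
      using F[of "restrict \<phi> S"] \<phi> finR by (intro prod_zero) auto
    then show ?thesis using By[of \<phi>] \<phi> False by simp
  qed
  have deltaR: "(\<Sum>b\<in>B. b * f (y b)) = (if f = e then 1 else 0)" if fR: "f \<in> R" for f
  proof -
    obtain \<phi> where "\<phi> \<in> \<Phi>" "f = restrict \<phi> S" using fR unfolding R_def by blast
    then show ?thesis using delta[of \<phi>] yS by simp
  qed
  \<comment> \<open>The mirror image of \<open>deltaR\<close>, obtained by applying \<open>\<phi>\<close> to \<open>delta\<close> for the inverse of \<open>\<phi>\<close>.\<close>
  have deltaR': "(\<Sum>b\<in>B. f b * y b) = (if f = e then 1 else 0)" if fR: "f \<in> R" for f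
  proof -
    obtain \<phi> where \<phi>: "\<phi> \<in> \<Phi>" "f = restrict \<phi> S" using fR unfolding R_def by blast
    obtain \<psi> where \<psi>: "\<psi> \<in> \<Phi>" "\<And>x. x \<in> E \<Longrightarrow> \<phi> (\<psi> x) = x" "\<And>x. x \<in> E \<Longrightarrow> \<psi> (\<phi> x) = x" using act_inv[OF \<phi>(1)] by blast
    have mem: "b \<in> E" "y b \<in> E" "\<psi> (y b) \<in> E" if "b \<in> B" for b
      using that BS yS SE act_closed[OF \<psi>(1)] by blast+
    have "(\<Sum>b\<in>B. f b * y b) = (\<Sum>b\<in>B. \<phi> (b * \<psi> (y b)))"
      using BS by (intro sum.cong refl) (auto simp: \<phi>(2) act_mult[OF \<phi>(1)] mem \<psi>)
    also have "\<dots> = \<phi> (\<Sum>b\<in>B. b * \<psi> (y b))"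
      by (rule act_sum[OF \<phi>(1), symmetric]) (simp add: mem is_subring_mult[OF E])
    also have "\<dots> = (if restrict \<psi> S = e then 1 else 0)"
      by (simp add: delta[OF \<psi>(1)] act_0 act_1 \<phi>(1))
    also have "restrict \<psi> S = e \<longleftrightarrow> f = e"
      unfolding \<phi>(2) trivial[OF \<psi>(1)] trivial[OF \<phi>(1)] using \<psi> LE by (metis subsetD)
    finally show ?thesis .
  qed
  define tr where "tr z = (\<Sum>f\<in>R. f z)" for z
  have R_E: "f z \<in> E" if "f \<in> R" "z \<in> S" for f z
    using that SE act_closed unfolding R_def by auto
  have R_add: "f (z + w) = f z + f w" if "f \<in> R" "z \<in> S" "w \<in> S" for f z w
    using that SE act_add is_subring_add[OF S] unfolding R_def by (auto simp: subset_iff)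
  have R_mult: "f (z * w) = f z * f w" if "f \<in> R" "z \<in> S" "w \<in> S" for f z w
    using that SE act_mult is_subring_mult[OF S] unfolding R_def by (auto simp: subset_iff)
  have R_fixed: "f z = z" if "f \<in> R" "z \<in> fixed" for f z
    using that KS unfolding R_def by (auto simp: fixed_def)
  have tr_fixed: "tr z \<in> fixed" if z: "z \<in> S" for z
    unfolding fixed_def
  proof (intro CollectI conjI ballI)
    show "tr z \<in> E" unfolding tr_def using R_E z by (intro is_subring_sum[OF E])
    fix \<phi> assume \<phi>: "\<phi> \<in> \<Phi>"
    obtain \<psi> where \<psi>: "\<psi> \<in> \<Phi>" "\<And>x. x \<in> E \<Longrightarrow> \<psi> (\<phi> x) = x" using act_inv[OF \<phi>] by blast
    let ?c = "\<lambda>f. restrict (\<phi> \<circ> f) S"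
    have into: "?c f \<in> R" if fR: "f \<in> R" for f
    proof -
      obtain \<chi> where \<chi>: "\<chi> \<in> \<Phi>" "f = restrict \<chi> S" using \<open>f \<in> R\<close> unfolding R_def by blast
      obtain \<chi>' where \<chi>': "\<chi>' \<in> \<Phi>" "\<forall>x\<in>E. \<chi>' x = \<phi> (\<chi> x)" using act_comp[OF \<phi> \<chi>(1)] by blast
      have "?c f = restrict \<chi>' S" using \<chi> \<chi>' SE by (intro restrict_ext) auto
      then show ?thesis using \<chi>'(1) unfolding R_def by blast
    qed
    have inj: "inj_on ?c R"
    proof (rule inj_onI, rule extensionalityI[of _ S])
      fix f g x assume f: "f \<in> R" and g: "g \<in> R" and eq: "?c f = ?c g"
      show "f \<in> extensional S" "g \<in> extensional S" using f g unfolding R_def by auto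
      assume x: "x \<in> S"
      have "\<phi> (f x) = \<phi> (g x)" using fun_cong[OF eq, of x] x by simp
      then show "f x = g x" using \<psi>(2) R_E f g x by metis
    qed
    \<comment> \<open>Composition with \<open>\<phi>\<close> permutes the finite group \<open>R\<close>, so the trace is invariant.\<close>
    have "bij_betw ?c R R"
      using inj into endo_inj_surj[OF finR _ inj] by (auto simp: bij_betw_def)
    then have "(\<Sum>f\<in>R. ?c f z) = tr z"
      unfolding tr_def by (rule sum.reindex_bij_betw)
    then show "\<phi> (tr z) = tr z"
      unfolding tr_def using z by (simp add: act_sum[OF \<phi>] R_E)
  qed
  have pick: "(\<Sum>f\<in>R. f z * (if f = e then 1 else 0)) = z" if "z \<in> S" for z
  proof -
    have "(\<Sum>f\<in>R. f z * (if f = e then 1 else 0)) = (\<Sum>f\<in>R. if f = e then f z else 0)"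
      by (intro sum.cong refl) simp
    then show ?thesis using that eR finR by (simp add: e_def)
  qed
  interpret X: ring_extension fixed S
    by unfold_locales (rule is_subring_fixed S KS)+
  have "strongly_separable_algebra (ring_on fixed) (algebra_on S)"
  proof (rule X.strongly_separable_algebraI[of B y tr])
    fix z assume z: "z \<in> S"
    have "(\<Sum>b\<in>B. tr (y b * z) * b) = (\<Sum>b\<in>B. \<Sum>f\<in>R. f (y b) * f z * b)"
      unfolding tr_def sum_distrib_right using z yS by (intro sum.cong refl) (simp add: R_mult)
    also have "\<dots> = (\<Sum>f\<in>R. f z * (\<Sum>b\<in>B. b * f (y b)))"
      by (subst sum.swap) (simp add: sum_distrib_left mult_ac)
    also have "\<dots> = z" using deltaR pick[OF z] by simp
    finally show "(\<Sum>b\<in>B. tr (y b * z) * b) = z" .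
    have "(\<Sum>b\<in>B. tr (z * b) * y b) = (\<Sum>b\<in>B. \<Sum>f\<in>R. f z * f b * y b)"
      unfolding tr_def sum_distrib_right using z BS by (intro sum.cong refl) (simp add: R_mult subset_iff)
    also have "\<dots> = (\<Sum>f\<in>R. f z * (\<Sum>b\<in>B. f b * y b))"
      by (subst sum.swap) (simp add: sum_distrib_left mult_ac)
    also have "\<dots> = z" using deltaR' pick[OF z] by simp
    finally show "(\<Sum>b\<in>B. tr (z * b) * y b) = z" .
  next
    fix r z assume "r \<in> fixed" "z \<in> S"
    then show "tr (r * z) = r * tr z"
      unfolding tr_def sum_distrib_left using KS by (intro sum.cong refl) (auto simp: R_mult R_fixed subset_iff)
  qed (use B BS yS one tr_fixed in \<open>auto simp: tr_def R_add sum.distrib\<close>)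
  then show ?thesis using S SE LS KS by blast
qed

end

section \<open>The action on Laurent polynomials\<close>

lemma is_subring_supported:
  fixes M :: "'b::comm_monoid_add set"
  assumes M: "0 \<in> M" "\<And>v w. v \<in> M \<Longrightarrow> w \<in> M \<Longrightarrow> v + w \<in> M"
  shows "is_subring {f :: 'b \<Rightarrow>\<^sub>0 'k::comm_ring_1. Poly_Mapping.keys f \<subseteq> M}"
  unfolding is_subring_def
proof (intro conjI ballI CollectI)
  show "Poly_Mapping.keys (1 :: 'b \<Rightarrow>\<^sub>0 'k) \<subseteq> M" using M(1) by simp
  fix f g :: "'b \<Rightarrow>\<^sub>0 'k"
  assume "f \<in> {f. Poly_Mapping.keys f \<subseteq> M}" "g \<in> {f. Poly_Mapping.keys f \<subseteq> M}"
  then show "Poly_Mapping.keys (f - g) \<subseteq> M" "Poly_Mapping.keys (f * g) \<subseteq> M"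
    using Poly_Mapping.keys_diff[of f g] keys_mult[of f g] M(2) by blast+
qed

lemma is_subring_laurent_ring: "is_subring (laurent_ring n s :: 'k::field genpoly set)"
proof -
  have "laurent_ring n s = {f :: 'k genpoly. Poly_Mapping.keys f \<subseteq>
      {v. Poly_Mapping.keys v \<subseteq> {1..n} \<and> (\<forall>i. of_nat s * Poly_Mapping.lookup v i \<in> \<int>)}}"
    by (auto simp: laurent_ring_def)
  also have "is_subring \<dots>"
  proof (rule is_subring_supported)
    fix v w :: "nat \<Rightarrow>\<^sub>0 rat"
    assume "v \<in> {v. Poly_Mapping.keys v \<subseteq> {1..n} \<and> (\<forall>i. of_nat s * Poly_Mapping.lookup v i \<in> \<int>)}"
      "w \<in> {v. Poly_Mapping.keys v \<subseteq> {1..n} \<and> (\<forall>i. of_nat s * Poly_Mapping.lookup v i \<in> \<int>)}"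
    then show "v + w \<in> {v. Poly_Mapping.keys v \<subseteq> {1..n} \<and> (\<forall>i. of_nat s * Poly_Mapping.lookup v i \<in> \<int>)}"
      using keys_add_subset[of v "{1..n}" w] by (simp add: lookup_add distrib_left)
  qed simp
  finally show ?thesis .
qed

lemma is_subring_E: "is_subring (carrier (E_ring n :: 'k::field genpoly ring))"
proof -
  let ?M = "{v. Poly_Mapping.keys v \<subseteq> {1..n} \<and> (\<forall>i. Poly_Mapping.lookup v i \<in> carrier (Zloc_group CHAR('k)))}"
  have "carrier (E_ring n) = {f :: 'k genpoly. Poly_Mapping.keys f \<subseteq> ?M}"
    unfolding set_eq_iff E_carrier by blast
  also have "is_subring \<dots>"
  proof (rule is_subring_supported)
    fix v w assume "v \<in> ?M" "w \<in> ?M"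
    then show "v + w \<in> ?M"
      using keys_add_subset[of v "{1..n}" w] by (simp add: lookup_add Zloc_add)
  qed (simp add: Zloc_Ints)
  finally show ?thesis .
qed

lemma E_ring_eq: "E_ring n = ring_on (carrier (E_ring n :: 'k::field genpoly ring))"
  by (simp add: E_ring_def)

lemma laurent_ring_subset: "prime_to_char CHAR('k) s \<Longrightarrow> laurent_ring n s \<subseteq> carrier (E_ring n :: 'k::field genpoly ring)"
  by (auto simp: E_ring_def)

lemma laurent_ring_mono:
  assumes "s dvd s'" shows "laurent_ring n s \<subseteq> (laurent_ring n s' :: 'k::field genpoly set)"
proof -
  obtain c where c: "s' = s * c" using assms by (auto elim: dvdE)
  have "of_nat s' * x \<in> \<int>" if "of_nat s * x \<in> \<int>" for x :: rat
    using Ints_mult[OF Ints_of_nat[of c] that] by (simp add: c mult_ac)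
  then show ?thesis by (auto simp: laurent_ring_def)
qed

lemma connected_ring_on:
  fixes A :: "'a::idom set"
  assumes "is_subring A" shows "connected_ring (ring_on A)"
  unfolding connected_ring_def using cring_ring_on[OF assms] by auto

lemma Sigma_action_add:
  "bij \<sigma> \<Longrightarrow> Sigma_action \<sigma> (f + g) = Sigma_action \<sigma> f + Sigma_action \<sigma> g"
  by (rule poly_mapping_eqI) (simp add: lookup_Sigma_action lookup_add)

lemma Sigma_action_sum: "bij \<sigma> \<Longrightarrow> Sigma_action \<sigma> (sum f J) = (\<Sum>i\<in>J. Sigma_action \<sigma> (f i))"
proof (induction J rule: infinite_finite_induct)
  case (insert i J)
  then show ?case by (simp add: Sigma_action_add)
qed (auto intro!: poly_mapping_eqI simp: lookup_Sigma_action)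

lemma map_key_inverse:
  fixes \<sigma> :: "nat \<Rightarrow> nat"
  assumes "bij \<sigma>"
  shows "Poly_Mapping.map_key \<sigma> (v :: nat \<Rightarrow>\<^sub>0 rat) = w \<longleftrightarrow> v = Poly_Mapping.map_key (Hilbert_Choice.inv \<sigma>) w"
proof -
  have b: "bij (Hilbert_Choice.inv \<sigma>)" by (rule bij_imp_bij_inv[OF assms])
  have l: "Poly_Mapping.lookup (Poly_Mapping.map_key \<tau> u) i = Poly_Mapping.lookup u (\<tau> i)" if "bij \<tau>"
    for \<tau> i and u :: "nat \<Rightarrow>\<^sub>0 rat"
    using that by (simp add: map_key.rep_eq bij_is_inj)
  have "Hilbert_Choice.inv \<sigma> (\<sigma> i) = i" "\<sigma> (Hilbert_Choice.inv \<sigma> i) = i" for i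
    using assms by (simp_all add: bij_is_inj bij_is_surj surj_f_inv_f)
  then show ?thesis
    unfolding poly_mapping_eq_iff fun_eq_iff l[OF assms] l[OF b] by metis
qed

text \<open>As \<open>\<sigma>\<close> sends \<open>t\<^sub>i\<close> to \<open>t\<^bsub>\<sigma> i\<^esub>\<close>, the exponent vector \<open>v\<close> becomes \<open>v \<circ> \<sigma>\<^sup>-\<^sup>1\<close>.\<close>

lemma Sigma_action_single:
  assumes "bij \<sigma>"
  shows "Sigma_action \<sigma> (Poly_Mapping.single v c) = Poly_Mapping.single (Poly_Mapping.map_key (Hilbert_Choice.inv \<sigma>) v) c"
proof (rule poly_mapping_eqI)
  fix w
  have "v = Poly_Mapping.map_key \<sigma> w \<longleftrightarrow> Poly_Mapping.map_key (Hilbert_Choice.inv \<sigma>) v = w"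
    using map_key_inverse[OF assms, of w v] by auto
  then show "Poly_Mapping.lookup (Sigma_action \<sigma> (Poly_Mapping.single v c)) w =
      Poly_Mapping.lookup (Poly_Mapping.single (Poly_Mapping.map_key (Hilbert_Choice.inv \<sigma>) v) c) w"
    by (simp add: lookup_Sigma_action[OF assms] lookup_single when_def)
qed

lemma Sigma_action_mult:
  assumes s: "bij \<sigma>"
  shows "Sigma_action \<sigma> (f * g) = Sigma_action \<sigma> f * Sigma_action \<sigma> g"
proof -
  let ?m = "\<lambda>f v. Poly_Mapping.single v (Poly_Mapping.lookup f v)"
  have i: "bij (Hilbert_Choice.inv \<sigma>)" by (rule bij_imp_bij_inv[OF s])
  have add: "Poly_Mapping.map_key (Hilbert_Choice.inv \<sigma>) (v + w) =
      Poly_Mapping.map_key (Hilbert_Choice.inv \<sigma>) v + Poly_Mapping.map_key (Hilbert_Choice.inv \<sigma>) w"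
    for v w :: "nat \<Rightarrow>\<^sub>0 rat"
    using i by (intro poly_mapping_eqI) (simp add: map_key.rep_eq bij_is_inj lookup_add)
  have fg: "f * g = (\<Sum>v\<in>Poly_Mapping.keys f. \<Sum>w\<in>Poly_Mapping.keys g. ?m f v * ?m g w)"
    unfolding sum_product[symmetric] by (simp flip: sum_monomials)
  have "Sigma_action \<sigma> (f * g) = (\<Sum>v\<in>Poly_Mapping.keys f. \<Sum>w\<in>Poly_Mapping.keys g.
      Sigma_action \<sigma> (?m f v) * Sigma_action \<sigma> (?m g w))"
    unfolding fg by (simp add: Sigma_action_sum[OF s] mult_single Sigma_action_single[OF s] add)
  also have "\<dots> = Sigma_action \<sigma> (\<Sum>v\<in>Poly_Mapping.keys f. ?m f v) * Sigma_action \<sigma> (\<Sum>w\<in>Poly_Mapping.keys g. ?m g w)"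
    by (simp add: Sigma_action_sum[OF s] sum_product)
  finally show ?thesis by (simp flip: sum_monomials)
qed

lemma Sigma_action_laurent_ring:
  assumes s: "\<sigma> permutes {1..n}" and f: "f \<in> laurent_ring n s"
  shows "Sigma_action \<sigma> f \<in> laurent_ring n s"
proof -
  have bij: "bij \<sigma>" using s by (rule permutes_bij)
  show ?thesis unfolding laurent_ring_def
  proof (intro CollectI ballI conjI subsetI allI)
    fix v assume "v \<in> Poly_Mapping.keys (Sigma_action \<sigma> f)"
    then have "Poly_Mapping.map_key \<sigma> v \<in> Poly_Mapping.keys f"
      by (simp add: in_keys_iff lookup_Sigma_action[OF bij])
    then have k: "Poly_Mapping.keys (Poly_Mapping.map_key \<sigma> v) \<subseteq> {1..n}"
      and i: "\<And>j. of_nat s * Poly_Mapping.lookup (Poly_Mapping.map_key \<sigma> v) j \<in> \<int>"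
      using f by (auto simp: laurent_ring_def)
    have l: "Poly_Mapping.lookup (Poly_Mapping.map_key \<sigma> v) j = Poly_Mapping.lookup v (\<sigma> j)" for j
      using bij by (simp add: map_key.rep_eq bij_is_inj)
    fix j
    obtain j' where j': "j = \<sigma> j'" using bij by (meson bij_pointE)
    show "of_nat s * Poly_Mapping.lookup v j \<in> \<int>" using i[of j'] by (simp add: l j')
    assume "j \<in> Poly_Mapping.keys v"
    then have "j' \<in> {1..n}" using k by (auto simp: in_keys_iff l j')
    then show "j \<in> {1..n}" using permutes_in_image[OF s] j' by blast
  qed
qed

lemma keys_Gamma_action: "Poly_Mapping.keys (Gamma_action n \<theta> a f) \<subseteq> Poly_Mapping.keys f"
  by (auto simp: in_keys_iff lookup_Gamma_action)

lemma Sigma_Gamma_carrierD: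
  assumes "(\<sigma>, a) \<in> carrier (Sigma_Gamma_group n p)"
  shows "\<sigma> permutes {1..n}" "bij \<sigma>" "a \<in> carrier (Gamma_group n p)"
  using assms by (auto simp: Sigma_Gamma_group_def sym_group_def permutes_bij)

lemma E_action_laurent_ring:
  assumes "g \<in> carrier (Sigma_Gamma_group n p)" "f \<in> laurent_ring n s"
  shows "E_action n \<theta> g f \<in> laurent_ring n s"
proof -
  obtain \<sigma> a where g: "g = (\<sigma>, a)" by force
  have "Sigma_action \<sigma> f \<in> laurent_ring n s"
    using Sigma_Gamma_carrierD(1) Sigma_action_laurent_ring assms unfolding g by blast
  then show ?thesis
    using keys_Gamma_action[of n \<theta> a "Sigma_action \<sigma> f"] unfolding g E_action_def laurent_ring_def by auto
qed

lemma E_action_closed: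
  assumes "g \<in> carrier (Sigma_Gamma_group n CHAR('k))" "f \<in> carrier (E_ring n)"
  shows "E_action n \<theta> g f \<in> carrier (E_ring n :: 'k::field genpoly ring)"
  using assms E_action_laurent_ring[OF assms(1)] unfolding E_ring_def by auto

lemma E_action_add:
  "g \<in> carrier (Sigma_Gamma_group n p) \<Longrightarrow> E_action n \<theta> g (x + y) = E_action n \<theta> g x + E_action n \<theta> g y"
  by (cases g) (simp add: E_action_def Gamma_action_plus Sigma_action_add Sigma_Gamma_carrierD)

lemma E_action_times:
  fixes \<theta> :: "rat set \<Rightarrow> 'k::field"
  assumes th: "root_isomorphism \<theta>" and g: "g \<in> carrier (Sigma_Gamma_group n CHAR('k))"
    and xy: "x \<in> carrier (E_ring n)" "y \<in> carrier (E_ring n)"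
  shows "E_action n \<theta> g (x * y) = E_action n \<theta> g x * E_action n \<theta> g y"
proof -
  obtain \<sigma> a where ga: "g = (\<sigma>, a)" by force
  note c = Sigma_Gamma_carrierD[OF g[unfolded ga]]
  show ?thesis
    by (simp add: ga E_action_def Sigma_action_mult[OF c(2)]
        Gamma_action_times[OF th c(3) Sigma_action_closed[OF c(1) xy(1)] Sigma_action_closed[OF c(1) xy(2)]])
qed

lemma Zhat_character_0: "root_isomorphism \<theta> \<Longrightarrow> Zhat_character \<theta> a 0 = 1"
  by (simp add: Zhat_character_def at_class_0)

lemma E_action_1:
  fixes \<theta> :: "rat set \<Rightarrow> 'k::field"
  assumes "root_isomorphism \<theta>" "g \<in> carrier (Sigma_Gamma_group n p)"
  shows "E_action n \<theta> g 1 = 1"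
proof -
  obtain \<sigma> a where g: "g = (\<sigma>, a)" by force
  have b: "bij \<sigma>" using Sigma_Gamma_carrierD(2) assms(2) unfolding g by blast
  have "Poly_Mapping.map_key (Hilbert_Choice.inv \<sigma>) 0 = (0 :: nat \<Rightarrow>\<^sub>0 rat)"
    by (rule poly_mapping_eqI) (simp add: map_key.rep_eq bij_is_inj bij_imp_bij_inv[OF b])
  then have "Sigma_action \<sigma> (Poly_Mapping.single 0 (1::'k)) = Poly_Mapping.single 0 1"
    by (simp only: Sigma_action_single[OF b])
  moreover have "Gamma_character n \<theta> a 0 = 1"
    by (simp add: Gamma_character_def Zhat_character_0[OF assms(1)])
  ultimately show ?thesis
    unfolding g E_action_def single_one[symmetric] by (simp only: case_prod_conv Gamma_action_single mult_1_right)
qed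

section \<open>The semidirect product\<close>

lemma group_padic_int_group:
  assumes "Factorial_Ring.prime q" shows "group (padic_int_group q)"
proof -
  let ?P = "product_group UNIV (\<lambda>j. integer_mod_group (q ^ j))"
  have q: "q > 0" using assms by (simp add: prime_gt_0_nat)
  have gP: "group ?P" by simp
  have dvd: "int (q ^ i) dvd int (q ^ j)" if "i \<le> j" for i j
    using that by (simp add: le_imp_power_dvd)
  have mod: "x mod int (q ^ j) mod int (q ^ i) = x mod int (q ^ i)" if "i \<le> j" for i j x
    using dvd[OF that] by (rule mod_mod_cancel)
  have "subgroup {a \<in> carrier ?P. \<forall>i j. i \<le> j \<longrightarrow> a j mod int (q ^ i) = a i} ?P"
  proof (rule group.subgroupI[OF gP])
    show "{a \<in> carrier ?P. \<forall>i j. i \<le> j \<longrightarrow> a j mod int (q ^ i) = a i} \<noteq> {}"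
      by (auto intro!: exI[of _ "\<lambda>_. 0"])
  next
    fix a assume a: "a \<in> {a \<in> carrier ?P. \<forall>i j. i \<le> j \<longrightarrow> a j mod int (q ^ i) = a i}"
    have "(- a j) mod int (q ^ j) mod int (q ^ i) = (- a i) mod int (q ^ i)" if "i \<le> j" for i j
    proof -
      have "(- a j) mod int (q ^ j) mod int (q ^ i) = (- (a j mod int (q ^ i))) mod int (q ^ i)"
        unfolding mod[OF that] by (rule mod_minus_eq[symmetric])
      then show ?thesis using a that by simp
    qed
    moreover have "inv\<^bsub>?P\<^esub> a = (\<lambda>j. (- a j) mod int (q ^ j))"
    proof -
      have "a j \<in> carrier (integer_mod_group (q ^ j))" for j using a by auto
      then show ?thesis using a by (subst inv_product_group) (auto simp: fun_eq_iff)
    qed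
    moreover have "inv\<^bsub>?P\<^esub> a \<in> carrier ?P" using a by (intro group.inv_closed[OF gP]) simp
    ultimately show "inv\<^bsub>?P\<^esub> a \<in> {a \<in> carrier ?P. \<forall>i j. i \<le> j \<longrightarrow> a j mod int (q ^ i) = a i}"
      by auto
  next
    fix a b assume a: "a \<in> {a \<in> carrier ?P. \<forall>i j. i \<le> j \<longrightarrow> a j mod int (q ^ i) = a i}"
      and b: "b \<in> {a \<in> carrier ?P. \<forall>i j. i \<le> j \<longrightarrow> a j mod int (q ^ i) = a i}"
    have "(a j + b j) mod int (q ^ j) mod int (q ^ i) = (a i + b i) mod int (q ^ i)" if "i \<le> j" for i j
    proof -
      have "(a j + b j) mod int (q ^ j) mod int (q ^ i) = (a j mod int (q ^ i) + b j mod int (q ^ i)) mod int (q ^ i)"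
        unfolding mod[OF that] by (simp add: mod_add_eq)
      then show ?thesis using a b that by simp
    qed
    moreover have "a \<otimes>\<^bsub>?P\<^esub> b \<in> carrier ?P"
      using a b by (intro monoid.m_closed[OF group.is_monoid[OF gP]]) simp_all
    ultimately show "a \<otimes>\<^bsub>?P\<^esub> b \<in> {a \<in> carrier ?P. \<forall>i j. i \<le> j \<longrightarrow> a j mod int (q ^ i) = a i}"
      by simp
  qed (auto)
  then show ?thesis unfolding padic_int_group_def by (rule subgroup.subgroup_is_group[OF _ gP])
qed

lemma group_Zhat_group: "group (Zhat_group p)"
  unfolding Zhat_group_def by (rule product_group) (simp add: primes_except_def group_padic_int_group)

lemma group_Gamma_group: "group (Gamma_group n p)"
  unfolding Gamma_group_def by (rule product_group) (rule group_Zhat_group)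

lemma permute_factors_closed:
  assumes "\<sigma> permutes {1..n}" "a \<in> carrier (Gamma_group n p)"
  shows "permute_factors n \<sigma> a \<in> carrier (Gamma_group n p)"
  using assms(2) permutes_in_image[OF permutes_inv[OF assms(1)]]
  unfolding Gamma_group_def permute_factors_def by (auto simp: PiE_iff)

lemma permute_factors_mult:
  assumes "\<sigma> permutes {1..n}"
  shows "permute_factors n \<sigma> (a \<otimes>\<^bsub>Gamma_group n p\<^esub> b) =
    permute_factors n \<sigma> a \<otimes>\<^bsub>Gamma_group n p\<^esub> permute_factors n \<sigma> b"
  using permutes_in_image[OF permutes_inv[OF assms]]
  unfolding Gamma_group_def permute_factors_def by (auto simp: fun_eq_iff)

lemma permute_factors_id:
  "a \<in> carrier (Gamma_group n p) \<Longrightarrow> permute_factors n id a = a"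
  unfolding Gamma_group_def permute_factors_def by (auto simp: fun_eq_iff PiE_iff extensional_def)

lemma permute_factors_comp:
  assumes "\<sigma> permutes {1..n}" "\<tau> permutes {1..n}"
  shows "permute_factors n (\<sigma> \<circ> \<tau>) a = permute_factors n \<sigma> (permute_factors n \<tau> a)"
  using permutes_in_image[OF permutes_inv[OF assms(1)]] permutes_bij[OF assms(1)] permutes_bij[OF assms(2)]
  unfolding permute_factors_def by (auto simp: fun_eq_iff o_inv_distrib)

lemma Sigma_Gamma_mult:
  "(\<sigma>, a) \<otimes>\<^bsub>Sigma_Gamma_group n p\<^esub> (\<tau>, b) = (\<sigma> \<circ> \<tau>, a \<otimes>\<^bsub>Gamma_group n p\<^esub> permute_factors n \<sigma> b)"
  by (simp add: Sigma_Gamma_group_def sym_group_def)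

lemma Sigma_Gamma_one: "\<one>\<^bsub>Sigma_Gamma_group n p\<^esub> = (id, \<one>\<^bsub>Gamma_group n p\<^esub>)"
  by (simp add: Sigma_Gamma_group_def sym_group_def)

lemma Sigma_Gamma_carrierI:
  "\<sigma> permutes {1..n} \<Longrightarrow> a \<in> carrier (Gamma_group n p) \<Longrightarrow> (\<sigma>, a) \<in> carrier (Sigma_Gamma_group n p)"
  by (simp add: Sigma_Gamma_group_def sym_group_def)

lemma group_Sigma_Gamma_group: "group (Sigma_Gamma_group n p)"
proof (rule groupI)
  interpret \<Gamma>: group "Gamma_group n p" by (rule group_Gamma_group)
  fix g assume g: "g \<in> carrier (Sigma_Gamma_group n p)"
  obtain \<sigma> a where ga: "g = (\<sigma>, a)" by force
  note cg = Sigma_Gamma_carrierD[OF g[unfolded ga]]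
  show "\<one>\<^bsub>Sigma_Gamma_group n p\<^esub> \<otimes>\<^bsub>Sigma_Gamma_group n p\<^esub> g = g"
    by (simp add: ga Sigma_Gamma_one Sigma_Gamma_mult permute_factors_id[OF cg(3)] cg)
  show "\<exists>h\<in>carrier (Sigma_Gamma_group n p). h \<otimes>\<^bsub>Sigma_Gamma_group n p\<^esub> g = \<one>\<^bsub>Sigma_Gamma_group n p\<^esub>"
  proof (rule bexI)
    have i: "Hilbert_Choice.inv \<sigma> permutes {1..n}" by (rule permutes_inv[OF cg(1)])
    let ?b = "permute_factors n (Hilbert_Choice.inv \<sigma>) a"
    have b: "?b \<in> carrier (Gamma_group n p)" by (rule permute_factors_closed[OF i cg(3)])
    show "(Hilbert_Choice.inv \<sigma>, inv\<^bsub>Gamma_group n p\<^esub> ?b) \<otimes>\<^bsub>Sigma_Gamma_group n p\<^esub> g = \<one>\<^bsub>Sigma_Gamma_group n p\<^esub>"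
      by (simp add: ga Sigma_Gamma_mult Sigma_Gamma_one \<Gamma>.l_inv[OF b] permutes_inv_o(2)[OF cg(1)])
    show "(Hilbert_Choice.inv \<sigma>, inv\<^bsub>Gamma_group n p\<^esub> ?b) \<in> carrier (Sigma_Gamma_group n p)"
      by (rule Sigma_Gamma_carrierI[OF i \<Gamma>.inv_closed[OF b]])
  qed
  fix h assume h: "h \<in> carrier (Sigma_Gamma_group n p)"
  obtain \<tau> b where hb: "h = (\<tau>, b)" by force
  note ch = Sigma_Gamma_carrierD[OF h[unfolded hb]]
  show "g \<otimes>\<^bsub>Sigma_Gamma_group n p\<^esub> h \<in> carrier (Sigma_Gamma_group n p)"
    unfolding ga hb Sigma_Gamma_mult
    by (intro Sigma_Gamma_carrierI permutes_compose cg ch \<Gamma>.m_closed permute_factors_closed)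
  fix k assume k: "k \<in> carrier (Sigma_Gamma_group n p)"
  obtain \<rho> c where kc: "k = (\<rho>, c)" by force
  note ck = Sigma_Gamma_carrierD[OF k[unfolded kc]]
  show "g \<otimes>\<^bsub>Sigma_Gamma_group n p\<^esub> h \<otimes>\<^bsub>Sigma_Gamma_group n p\<^esub> k =
      g \<otimes>\<^bsub>Sigma_Gamma_group n p\<^esub> (h \<otimes>\<^bsub>Sigma_Gamma_group n p\<^esub> k)"
    by (simp add: ga hb kc Sigma_Gamma_mult o_assoc permute_factors_mult[OF cg(1)]
        permute_factors_comp[OF cg(1) ch(1)] \<Gamma>.m_assoc[OF cg(3) permute_factors_closed[OF cg(1) ch(3)]
          permute_factors_closed[OF cg(1) permute_factors_closed[OF ch(1) ck(3)]]])
next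
  show "\<one>\<^bsub>Sigma_Gamma_group n p\<^esub> \<in> carrier (Sigma_Gamma_group n p)"
    unfolding Sigma_Gamma_one
    by (intro Sigma_Gamma_carrierI permutes_id monoid.one_closed group.is_monoid[OF group_Gamma_group])
qed

lemma Zhat_character_one_element:
  fixes \<theta> :: "rat set \<Rightarrow> 'k::field"
  assumes th: "root_isomorphism \<theta>" and x: "x \<in> carrier (Zloc_group CHAR('k))"
  shows "Zhat_character \<theta> \<one>\<^bsub>Zhat_group CHAR('k)\<^esub> x = 1"
proof -
  interpret group "Zhat_group CHAR('k)" by (rule group_Zhat_group)
  have "Zhat_character \<theta> \<one>\<^bsub>Zhat_group CHAR('k)\<^esub> x * Zhat_character \<theta> \<one>\<^bsub>Zhat_group CHAR('k)\<^esub> x =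
      Zhat_character \<theta> \<one>\<^bsub>Zhat_group CHAR('k)\<^esub> x"
    using Zhat_character_mult[OF th one_closed one_closed x] by simp
  moreover have "Zhat_character \<theta> \<one>\<^bsub>Zhat_group CHAR('k)\<^esub> x \<noteq> 0"
    unfolding Zhat_character_def by (intro at_class_root(2)[OF th] Zloc_int_mult x)
  ultimately show ?thesis by simp
qed

lemma E_action_translation:
  "E_action n \<theta> (id, a) f = Gamma_action n \<theta> a f"
proof -
  have "Poly_Mapping.map_key id w = w" for w :: "nat \<Rightarrow>\<^sub>0 rat"
    by (rule poly_mapping_eqI) (simp add: map_key.rep_eq)
  then have "Sigma_action id f = f"
    by (intro poly_mapping_eqI) (simp add: lookup_Sigma_action)
  then show ?thesis by (simp add: E_action_def)
qed

lemma E_action_one: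
  fixes \<theta> :: "rat set \<Rightarrow> 'k::field"
  assumes th: "root_isomorphism \<theta>" and f: "f \<in> carrier (E_ring n)"
  shows "E_action n \<theta> \<one>\<^bsub>Sigma_Gamma_group n CHAR('k)\<^esub> f = f"
proof (rule poly_mapping_eqI)
  fix v
  have "Gamma_character n \<theta> \<one>\<^bsub>Gamma_group n CHAR('k)\<^esub> v = 1" if "v \<in> Poly_Mapping.keys f"
    unfolding Gamma_character_def
    using that f Zhat_character_one_element[OF th] by (intro prod.neutral) (simp add: Gamma_group_def E_carrier)
  then show "Poly_Mapping.lookup (E_action n \<theta> \<one>\<^bsub>Sigma_Gamma_group n CHAR('k)\<^esub> f) v = Poly_Mapping.lookup f v"
    by (cases "v \<in> Poly_Mapping.keys f")
       (simp_all add: Sigma_Gamma_one E_action_translation lookup_Gamma_action in_keys_iff)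
qed

lemma E_action_inv:
  fixes \<theta> :: "rat set \<Rightarrow> 'k::field"
  assumes th: "root_isomorphism \<theta>" and g: "g \<in> carrier (Sigma_Gamma_group n CHAR('k))"
    and f: "f \<in> carrier (E_ring n)"
  shows "E_action n \<theta> g (E_action n \<theta> (inv\<^bsub>Sigma_Gamma_group n CHAR('k)\<^esub> g) f) = f"
    "E_action n \<theta> (inv\<^bsub>Sigma_Gamma_group n CHAR('k)\<^esub> g) (E_action n \<theta> g f) = f"
proof -
  interpret group "Sigma_Gamma_group n CHAR('k)" by (rule group_Sigma_Gamma_group)
  show "E_action n \<theta> g (E_action n \<theta> (inv\<^bsub>Sigma_Gamma_group n CHAR('k)\<^esub> g) f) = f"
    using E_action_mult[OF th g inv_closed[OF g] f] by (simp add: r_inv[OF g] E_action_one[OF th f])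
  show "E_action n \<theta> (inv\<^bsub>Sigma_Gamma_group n CHAR('k)\<^esub> g) (E_action n \<theta> g f) = f"
    using E_action_mult[OF th inv_closed[OF g] g f] by (simp add: l_inv[OF g] E_action_one[OF th f])
qed

lemma E_action_pow:
  fixes \<theta> :: "rat set \<Rightarrow> 'k::field"
  assumes th: "root_isomorphism \<theta>" and g: "g \<in> carrier (Sigma_Gamma_group n CHAR('k))"
    and f: "f \<in> carrier (E_ring n)"
  shows "E_action n \<theta> (g [^]\<^bsub>Sigma_Gamma_group n CHAR('k)\<^esub> (m::nat)) f = (E_action n \<theta> g ^^ m) f"
  using f
proof (induction m arbitrary: f)
  interpret group "Sigma_Gamma_group n CHAR('k)" by (rule group_Sigma_Gamma_group)
  case (Suc m)
  then show ?case
    using E_action_mult[OF th nat_pow_closed[OF g] g, of f m] E_action_closed[OF g, of f \<theta>]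
    by (simp add: funpow_Suc_right del: funpow.simps)
qed (simp add: E_action_one[OF th])

section \<open>Finite quotients and faithfulness\<close>

lemma Gamma_groupD: "a \<in> carrier (Gamma_group n p) \<Longrightarrow> i \<in> {1..n} \<Longrightarrow> a i \<in> carrier (Zhat_group p)"
  by (auto simp: Gamma_group_def)

lemma Gamma_character_cong_residue:
  fixes \<theta> :: "rat set \<Rightarrow> 'k::field"
  assumes th: "root_isomorphism \<theta>" and s: "prime_to_char CHAR('k) s"
    and a: "a \<in> carrier (Gamma_group n CHAR('k))" and b: "b \<in> carrier (Gamma_group n CHAR('k))"
    and eq: "\<And>i. i \<in> {1..n} \<Longrightarrow> Zhat_residue CHAR('k) (a i) s = Zhat_residue CHAR('k) (b i) s"
    and v: "\<And>i. of_nat s * Poly_Mapping.lookup v i \<in> \<int>"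
  shows "Gamma_character n \<theta> a v = Gamma_character n \<theta> b v"
  unfolding Gamma_character_def
proof (rule prod.cong[OF refl])
  fix i assume i: "i \<in> {1..n}"
  note ai = Gamma_groupD[OF a i] and bi = Gamma_groupD[OF b i]
  let ?c = "Zhat_residue CHAR('k) (a i) s"
  have c: "?c mod int s = ?c" using Zhat_residue(1,2)[OF ai s] by simp
  show "Zhat_character \<theta> (a i) (Poly_Mapping.lookup v i) = Zhat_character \<theta> (b i) (Poly_Mapping.lookup v i)"
    using Zhat_character_eq[OF th ai s v, of ?c i] Zhat_character_eq[OF th bi s v, of ?c i] c eq[OF i] by simp
qed

text \<open>On exponents with denominator \<open>s\<close> an element of the group is determined by its permutation and by the
residues modulo \<open>s\<close> of its components, of which there are finitely many.\<close>

lemma finite_restrict_E_action: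
  fixes \<theta> :: "rat set \<Rightarrow> 'k::field"
  assumes th: "root_isomorphism \<theta>" and s: "prime_to_char CHAR('k) s"
  shows "finite ((\<lambda>g. restrict (E_action n \<theta> g) (laurent_ring n s)) ` carrier (Sigma_Gamma_group n CHAR('k)))"
proof -
  let ?C = "carrier (Sigma_Gamma_group n CHAR('k))"
  let ?r = "\<lambda>g. restrict (E_action n \<theta> g) (laurent_ring n s)"
  define \<rho> where "\<rho> g = (fst g, \<lambda>i\<in>{1..n}. Zhat_residue CHAR('k) (snd g i) s)"
    for g :: "(nat \<Rightarrow> nat) \<times> (nat \<Rightarrow> nat \<Rightarrow> nat \<Rightarrow> int)"
  have same: "?r g = ?r h" if g: "g \<in> ?C" and h: "h \<in> ?C" and eq: "\<rho> g = \<rho> h" for g h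
  proof (rule restrict_ext)
    obtain \<sigma> a b where gh: "g = (\<sigma>, a)" "h = (\<sigma>, b)" using eq by (cases g; cases h) (auto simp: \<rho>_def)
    note cg = Sigma_Gamma_carrierD[OF g[unfolded gh]] and ch = Sigma_Gamma_carrierD[OF h[unfolded gh]]
    have res: "Zhat_residue CHAR('k) (a i) s = Zhat_residue CHAR('k) (b i) s" if "i \<in> {1..n}" for i
      using fun_cong[OF arg_cong[OF eq, of snd], of i] that by (simp add: \<rho>_def gh)
    fix f :: "'k genpoly" assume f: "f \<in> laurent_ring n s"
    have "Gamma_action n \<theta> a (Sigma_action \<sigma> f) = Gamma_action n \<theta> b (Sigma_action \<sigma> f)"
    proof (rule poly_mapping_eqI)
      fix v
      show "Poly_Mapping.lookup (Gamma_action n \<theta> a (Sigma_action \<sigma> f)) v =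
          Poly_Mapping.lookup (Gamma_action n \<theta> b (Sigma_action \<sigma> f)) v"
      proof (cases "v \<in> Poly_Mapping.keys (Sigma_action \<sigma> f)")
        case True
        then have "of_nat s * Poly_Mapping.lookup v i \<in> \<int>" for i
          using Sigma_action_laurent_ring[OF cg(1) f] by (auto simp: laurent_ring_def)
        from Gamma_character_cong_residue[OF th s cg(3) ch(3) res this]
        show ?thesis by (simp add: lookup_Gamma_action)
      qed (simp add: lookup_Gamma_action in_keys_iff)
    qed
    then show "E_action n \<theta> g f = E_action n \<theta> h f" by (simp add: gh E_action_def)
  qed
  have "\<rho> ` ?C \<subseteq> {\<sigma>. \<sigma> permutes {1..n}} \<times> (\<Pi>\<^sub>E i\<in>{1..n}. {0..<int s})"
  proof
    fix r assume "r \<in> \<rho> ` ?C"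
    then obtain \<sigma> a where a: "(\<sigma>, a) \<in> ?C" "r = \<rho> (\<sigma>, a)" by auto
    note c = Sigma_Gamma_carrierD[OF a(1)]
    show "r \<in> {\<sigma>. \<sigma> permutes {1..n}} \<times> (\<Pi>\<^sub>E i\<in>{1..n}. {0..<int s})"
      using c(1) Zhat_residue(1,2)[OF Gamma_groupD[OF c(3)] s] by (auto simp: a(2) \<rho>_def)
  qed
  then have fin: "finite (\<rho> ` ?C)"
    by (rule finite_subset) (intro finite_cartesian_product finite_permutations finite_PiE; simp)
  have "?r ` ?C \<subseteq> (\<lambda>x. ?r (inv_into ?C \<rho> x)) ` \<rho> ` ?C"
  proof
    fix f assume "f \<in> ?r ` ?C"
    then obtain g where g: "g \<in> ?C" "f = ?r g" by blast
    then have "f = ?r (inv_into ?C \<rho> (\<rho> g))"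
      using same[of g "inv_into ?C \<rho> (\<rho> g)"] inv_into_into[of "\<rho> g" \<rho> ?C] f_inv_into_f[of "\<rho> g" \<rho> ?C] by auto
    then show "f \<in> (\<lambda>x. ?r (inv_into ?C \<rho> x)) ` \<rho> ` ?C" using g(1) by blast
  qed
  then show ?thesis using fin by (rule finite_surj[rotated])
qed

text \<open>This is the injectivity of \<open>\<theta>\<close> on classes modulo \<open>\<int>\<close>, read on representatives.\<close>

lemma at_class_eq_1_iff:
  fixes \<theta> :: "rat set \<Rightarrow> 'k::field"
  assumes th: "root_isomorphism \<theta>" and x: "x \<in> carrier (Zloc_group CHAR('k))"
  shows "at_class \<theta> x = 1 \<longleftrightarrow> x \<in> \<int>"
proof
  let ?Z = "Zloc_group CHAR('k)"
  have g: "group ?Z" by (rule comm_group.axioms(2)[OF Zloc_comm_group])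
  have s: "subgroup \<int> ?Z" using Ints_normal normal_imp_subgroup by blast
  have inj: "inj_on \<theta> (carrier (?Z Mod \<int>))"
    using th unfolding root_isomorphism_def iso_def bij_betw_def by blast
  assume "at_class \<theta> x = 1"
  then have "\<theta> (\<int> #>\<^bsub>?Z\<^esub> x) = \<theta> (\<int> #>\<^bsub>?Z\<^esub> 0)"
    using at_class_0[OF th] by (simp add: at_class_def)
  then have "\<int> #>\<^bsub>?Z\<^esub> x = \<int> #>\<^bsub>?Z\<^esub> 0"
    by (rule inj_onD[OF inj]) (intro coset_in_Mod x Zloc_Ints Ints_0)+
  also have "\<dots> = \<int>" by (rule group.coset_join2[OF g Zloc_Ints[OF Ints_0] s Ints_0])
  finally show "x \<in> \<int>" using group.rcos_self[OF g x s] by simp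
qed (rule at_class_Ints[OF th])

lemma primes_except_power_prime_to_char:
  assumes "q \<in> primes_except CHAR('k::field)"
  shows "prime_to_char CHAR('k) (q ^ j)"
proof (cases "CHAR('k) = 0")
  case False
  then have "Factorial_Ring.prime CHAR('k)" by (simp add: prime_CHAR_semidom)
  then have "coprime q CHAR('k)" using assms by (auto simp: primes_except_def primes_coprime)
  then show ?thesis using assms by (auto simp: prime_to_char_def primes_except_def prime_gt_0_nat)
qed (use assms in \<open>auto simp: prime_to_char_def primes_except_def prime_gt_0_nat\<close>)

text \<open>A nontrivial \<open>a\<close> has a nonzero residue \<open>c\<close> modulo a prime power \<open>s = q\<^sup>j\<close> in some component \<open>i\<close>, and it
multiplies \<open>t\<^sub>i\<^sup>1\<^sup>/\<^sup>s\<close> by \<open>\<theta>(c/s) \<noteq> 1\<close>.\<close>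

lemma Gamma_character_faithful:
  fixes \<theta> :: "rat set \<Rightarrow> 'k::field"
  assumes th: "root_isomorphism \<theta>" and a: "a \<in> carrier (Gamma_group n CHAR('k))"
    and ne: "a \<noteq> \<one>\<^bsub>Gamma_group n CHAR('k)\<^esub>"
  obtains i s where "i \<in> {1..n}" "prime_to_char CHAR('k) s"
    "Gamma_character n \<theta> a (Poly_Mapping.single i (1 / of_nat s)) \<noteq> 1"
proof -
  have "\<exists>i\<in>{1..n}. \<exists>q\<in>primes_except CHAR('k). \<exists>j. a i q j \<noteq> 0"
  proof (rule ccontr)
    assume contra: "\<not> ?thesis"
    have "a i q = \<one>\<^bsub>padic_int_group q\<^esub>" if "i \<in> {1..n}" "q \<in> primes_except CHAR('k)" for i q
      using contra that by (auto simp: padic_int_group_def fun_eq_iff)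
    moreover have "a i \<in> extensional (primes_except CHAR('k))" if "i \<in> {1..n}" for i
      using Gamma_groupD[OF a that] by (simp add: Zhat_group_def PiE_iff)
    ultimately have "a i = \<one>\<^bsub>Zhat_group CHAR('k)\<^esub>" if "i \<in> {1..n}" for i
      using that by (auto simp: Zhat_group_def fun_eq_iff extensional_def)
    moreover have "a \<in> extensional {1..n}" using a by (simp add: Gamma_group_def PiE_iff)
    ultimately have "a = \<one>\<^bsub>Gamma_group n CHAR('k)\<^esub>"
      by (auto simp: Gamma_group_def fun_eq_iff extensional_def)
    then show False using ne by simp
  qed
  then obtain i q j where i: "i \<in> {1..n}" and q: "q \<in> primes_except CHAR('k)" and ne0: "a i q j \<noteq> 0" by blast
  note s = primes_except_power_prime_to_char[OF q, of j] and ai = Gamma_groupD[OF a i]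
  let ?s = "q ^ j" let ?c = "Zhat_residue CHAR('k) (a i) ?s" let ?x = "1 / of_nat ?s :: rat"
  have s0: "?s > 0" using s by (simp add: prime_to_char_def)
  have x: "of_nat ?s * ?x \<in> \<int>" "?x \<in> carrier (Zloc_group CHAR('k))"
    using s0 s by (auto simp: Zloc_carrier intro!: exI[of _ ?s])
  have "multiplicity q ?s = j" using q by (simp add: primes_except_def prime_gt_Suc_0_nat)
  then have "?c mod int ?s = a i q j" using Zhat_residue(3)[OF ai s q] by simp
  note c = this Zhat_residue(1,2)[OF ai s]
  have "Gamma_character n \<theta> a (Poly_Mapping.single i ?x) = (\<Prod>l\<in>{1..n}. if l = i then Zhat_character \<theta> (a i) ?x else 1)"
    unfolding Gamma_character_def
    by (intro prod.cong refl) (auto simp: lookup_single when_def Zhat_character_0[OF th])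
  also have "\<dots> = Zhat_character \<theta> (a i) ?x" using i by simp
  also have "\<dots> = at_class \<theta> (of_int ?c * ?x)"
    using Zhat_character_eq[OF th ai s x(1), of ?c] c by simp
  finally have ch: "Gamma_character n \<theta> a (Poly_Mapping.single i ?x) = at_class \<theta> (of_int ?c * ?x)" .
  have "of_int ?c * ?x \<notin> \<int>"
  proof
    assume "of_int ?c * ?x \<in> \<int>"
    then obtain d where "of_int ?c * ?x = of_int d" by (auto elim: Ints_cases)
    then have "of_int ?c = (of_int (d * int ?s) :: rat)" using s0 by (simp add: field_simps)
    then have "?c = d * int ?s" by (simp only: of_int_eq_iff)
    then have "?c mod int ?s = 0" by simp
    then show False using c(1) ne0 by simp
  qed
  then have "at_class \<theta> (of_int ?c * ?x) \<noteq> 1"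
    using at_class_eq_1_iff[OF th Zloc_int_mult[OF x(2)]] by blast
  then show ?thesis using that[OF i s] ch by simp
qed

lemma single_laurent_ring:
  "i \<in> {1..n} \<Longrightarrow> s > 0 \<Longrightarrow> Poly_Mapping.single (Poly_Mapping.single i (1 / of_nat s)) (c::'k::field) \<in> laurent_ring n s"
  by (auto simp: laurent_ring_def lookup_single when_def)

lemma single_eq_single_iff: "Poly_Mapping.single v c = Poly_Mapping.single v d \<longleftrightarrow> c = d"
  by (metis lookup_single_eq)

text \<open>The symmetric group has order \<open>n!\<close>, so this power lies in the kernel of the projection to it.\<close>

lemma Sigma_Gamma_pow_fact:
  assumes g: "g \<in> carrier (Sigma_Gamma_group n p)"
  obtains a where "g [^]\<^bsub>Sigma_Gamma_group n p\<^esub> (fact n :: nat) = (id, a)" "a \<in> carrier (Gamma_group n p)"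
proof -
  interpret S: group "Sigma_Gamma_group n p" by (rule group_Sigma_Gamma_group)
  interpret sym: group "sym_group n" by (rule sym_group_is_group)
  obtain \<sigma> b where gb: "g = (\<sigma>, b)" by force
  have \<sigma>: "\<sigma> \<in> carrier (sym_group n)" using g by (simp add: gb Sigma_Gamma_group_def)
  have "fst (g [^]\<^bsub>Sigma_Gamma_group n p\<^esub> m) = \<sigma> [^]\<^bsub>sym_group n\<^esub> m" for m :: nat
  proof (induction m)
    case (Suc m)
    obtain \<tau> c where "g [^]\<^bsub>Sigma_Gamma_group n p\<^esub> m = (\<tau>, c)" by force
    then show ?case using Suc by (simp add: gb Sigma_Gamma_mult sym_group_mult)
  qed (simp add: Sigma_Gamma_one sym_group_one)
  moreover have "Coset.order (sym_group n) = fact n"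
    using card_permutations[of "{1..n}" n] by (simp add: Coset.order_def sym_group_def)
  then have "\<sigma> [^]\<^bsub>sym_group n\<^esub> (fact n :: nat) = id"
    using sym.pow_order_eq_1[OF \<sigma>] by (simp add: sym_group_one)
  ultimately have "fst (g [^]\<^bsub>Sigma_Gamma_group n p\<^esub> (fact n :: nat)) = id" by simp
  moreover have "g [^]\<^bsub>Sigma_Gamma_group n p\<^esub> (fact n :: nat) \<in> carrier (Sigma_Gamma_group n p)"
    by (rule S.nat_pow_closed[OF g])
  ultimately show ?thesis using that Sigma_Gamma_carrierD(3) by (metis prod.collapse)
qed

section \<open>Compactness and a common denominator\<close>

text \<open>The \<open>q\<close>-adic integers are closed in a product of finite discrete spaces: the complement is a union of
sets that prescribe two incompatible coordinates.\<close>

lemma compact_space_padic_int_topology: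
  assumes q: "Factorial_Ring.prime q" shows "compact_space (padic_int_topology q)"
proof -
  let ?X = "product_topology (\<lambda>j. discrete_topology (carrier (integer_mod_group (q ^ j)))) UNIV"
  let ?C = "carrier (padic_int_group q)"
  have "finite (carrier (integer_mod_group (q ^ j)))" for j
    using q by (simp add: carrier_integer_mod_group prime_gt_0_nat)
  then have X: "compact_space ?X"
    by (simp add: compact_space_product_topology compact_space_discrete_topology)
  have o: "openin ?X {a \<in> topspace ?X. a j = x}" for j x
  proof -
    have "openin ?X {a \<in> topspace ?X. a j \<in> {x} \<inter> carrier (integer_mod_group (q ^ j))}"
      by (rule openin_continuous_map_preimage[OF continuous_map_product_projection]) simp_all
    moreover have "{a \<in> topspace ?X. a j \<in> {x} \<inter> carrier (integer_mod_group (q ^ j))} = {a \<in> topspace ?X. a j = x}"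
      by auto
    ultimately show ?thesis by simp
  qed
  have "topspace ?X - ?C =
      \<Union>{{a \<in> topspace ?X. a j = x} \<inter> {a \<in> topspace ?X. a i = y} | i j x y. i \<le> j \<and> x mod int (q ^ i) \<noteq> y}"
    (is "_ = \<Union>?U")
  proof (intro equalityI subsetI)
    fix a assume a: "a \<in> topspace ?X - ?C"
    then obtain i j where "i \<le> j" "a j mod int (q ^ i) \<noteq> a i"
      by (auto simp: padic_int_group_def)
    then have "{b \<in> topspace ?X. b j = a j} \<inter> {b \<in> topspace ?X. b i = a i} \<in> ?U" by blast
    then show "a \<in> \<Union>?U" using a by blast
  qed (auto simp: padic_int_group_def)
  moreover have "openin ?X (\<Union>?U)" using o by (intro openin_Union) blast
  moreover have "?C \<subseteq> topspace ?X" by (auto simp: padic_int_group_def)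
  ultimately have "closedin ?X ?C" by (simp add: closedin_def)
  then show ?thesis
    unfolding padic_int_topology_def by (intro compact_space_subtopology closedin_compact_space[OF X])
qed

lemma compact_space_Sigma_Gamma_topology: "compact_space (Sigma_Gamma_topology n p)"
proof -
  have "compact_space (Zhat_topology p)"
    unfolding Zhat_topology_def compact_space_product_topology
    using compact_space_padic_int_topology by (auto simp: primes_except_def)
  then have "compact_space (Gamma_topology n p)"
    unfolding Gamma_topology_def compact_space_product_topology by blast
  moreover have "finite (carrier (sym_group n))"
    by (simp add: sym_group_def finite_permutations)
  ultimately show ?thesis
    unfolding Sigma_Gamma_topology_def compact_space_prod_topology compact_space_discrete_topology by blast
qed

lemma openin_E_action:
  fixes \<theta> :: "rat set \<Rightarrow> 'k::field"
  assumes th: "root_isomorphism \<theta>" and f: "f \<in> carrier (E_ring n)"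
  shows "openin (Sigma_Gamma_topology n CHAR('k)) {g \<in> carrier (Sigma_Gamma_group n CHAR('k)). E_action n \<theta> g f = h}"
proof -
  let ?U = "\<lambda>\<sigma>. {\<sigma>} \<times> {a \<in> carrier (Gamma_group n CHAR('k)). Gamma_action n \<theta> a (Sigma_action \<sigma> f) = h}"
  have "{g \<in> carrier (Sigma_Gamma_group n CHAR('k)). E_action n \<theta> g f = h} = (\<Union>\<sigma>\<in>carrier (sym_group n). ?U \<sigma>)"
    by (auto simp: Sigma_Gamma_group_def E_action_def)
  moreover have "openin (Sigma_Gamma_topology n CHAR('k)) (?U \<sigma>)" if "\<sigma> \<in> carrier (sym_group n)" for \<sigma>
    unfolding Sigma_Gamma_topology_def openin_prod_Times_iff
    using that Gamma_action_continuous[OF th Sigma_action_closed[OF _ f], of \<sigma> h]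
    by (simp add: sym_group_def)
  ultimately show ?thesis by auto
qed

text \<open>The orbit \<open>f, g f, \<dots>, g\<^sup>m f\<close> can be prescribed step by step, and each step is an open condition on
\<open>g\<close>.\<close>

lemma openin_E_action_pow:
  fixes \<theta> :: "rat set \<Rightarrow> 'k::field"
  assumes th: "root_isomorphism \<theta>" and f: "f \<in> carrier (E_ring n)"
  shows "openin (Sigma_Gamma_topology n CHAR('k))
    {g \<in> carrier (Sigma_Gamma_group n CHAR('k)). (E_action n \<theta> g ^^ m) f = h}"
  using f
proof (induction m arbitrary: f)
  case 0
  have "openin (Sigma_Gamma_topology n CHAR('k)) (carrier (Sigma_Gamma_group n CHAR('k)))"
    using openin_topspace[of "Sigma_Gamma_topology n CHAR('k)"] by (simp add: topspace_Sigma_Gamma)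
  then show ?case by (cases "f = h") simp_all
next
  case (Suc m)
  let ?C = "carrier (Sigma_Gamma_group n CHAR('k))"
  have "{g \<in> ?C. (E_action n \<theta> g ^^ Suc m) f = h} =
     (\<Union>f'\<in>carrier (E_ring n). {g \<in> ?C. E_action n \<theta> g f = f'} \<inter> {g \<in> ?C. (E_action n \<theta> g ^^ m) f' = h})"
    using E_action_closed[OF _ Suc.prems] by (auto simp: funpow_Suc_right simp del: funpow.simps)
  moreover have "openin (Sigma_Gamma_topology n CHAR('k)) \<dots>"
    using Suc openin_E_action[OF th Suc.prems] by (intro openin_Union) auto
  ultimately show ?case by simp
qed

text \<open>The set \<open>W (i, s)\<close> of those \<open>g\<close> whose \<open>n!\<close>-th power moves \<open>t\<^sub>i\<^sup>1\<^sup>/\<^sup>s\<close> is open. Since \<open>G\<close> is torsion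
free and the action of \<open>\<Gamma>\<^sub>n\<close> is faithful, these sets cover the elements of \<open>G\<close> with a nontrivial
permutation, which form a compact set. The product of the \<open>s\<close> in a finite subcover is a denominator
for all of them.\<close>

lemma uniform_denominator:
  fixes \<theta> :: "rat set \<Rightarrow> 'k::field"
  assumes th: "root_isomorphism \<theta>"
    and G: "subgroup G (Sigma_Gamma_group n CHAR('k))"
    and closed: "closedin (Sigma_Gamma_topology n CHAR('k)) G"
    and tf: "torsion_free (Sigma_Gamma_group n CHAR('k)) G"
  obtains s where "prime_to_char CHAR('k) s"
    "\<And>g. g \<in> G \<Longrightarrow> fst g \<noteq> id \<Longrightarrow> \<exists>v \<chi>. Poly_Mapping.single v 1 \<in> (laurent_ring n s :: 'k genpoly set) \<and> \<chi> \<noteq> 1 \<and>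
       (E_action n \<theta> g ^^ fact n) (Poly_Mapping.single v 1) = Poly_Mapping.single v \<chi>"
proof -
  let ?SG = "Sigma_Gamma_group n CHAR('k)" and ?T = "Sigma_Gamma_topology n CHAR('k)"
  interpret SG: group ?SG by (rule group_Sigma_Gamma_group)
  define mon where "mon = (\<lambda>(i, s). Poly_Mapping.single (Poly_Mapping.single i (1 / of_nat s)) 1 :: 'k genpoly)"
  define J where "J = {1..n} \<times> {s. prime_to_char CHAR('k) s}"
  define W where "W x = {g \<in> carrier ?SG. (E_action n \<theta> g ^^ fact n) (mon x) \<noteq> mon x}" for x
  have GC: "G \<subseteq> carrier ?SG" using G by (rule subgroup.subset)
  have mon_laurent: "mon (i, s) \<in> laurent_ring n s" if "(i, s) \<in> J" for i s
    using that single_laurent_ring unfolding mon_def J_def by (auto simp: prime_to_char_def)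
  have mon_E: "mon x \<in> carrier (E_ring n)" if "x \<in> J" for x
    using that mon_laurent[of "fst x" "snd x"] laurent_ring_subset[where ?'k = 'k, of "snd x" n] by (auto simp: J_def)
  have W_open: "openin ?T (W x)" if "x \<in> J" for x
  proof -
    have "W x = (\<Union>h\<in>- {mon x}. {g \<in> carrier ?SG. (E_action n \<theta> g ^^ fact n) (mon x) = h})"
      by (auto simp: W_def)
    then show ?thesis using openin_E_action_pow[OF th mon_E[OF that]] by auto
  qed
  define C where "C = {g \<in> G. fst g \<noteq> id}"
  have "closedin ?T ((carrier (sym_group n) - {id}) \<times> carrier (Gamma_group n CHAR('k)))"
    unfolding Sigma_Gamma_topology_def closedin_prod_Times_iff
    using closedin_topspace[of "Gamma_topology n CHAR('k)"] by (simp add: topspace_Gamma)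
  then have "closedin ?T (G \<inter> ((carrier (sym_group n) - {id}) \<times> carrier (Gamma_group n CHAR('k))))"
    by (rule closedin_Int[OF closed])
  moreover have "G \<inter> ((carrier (sym_group n) - {id}) \<times> carrier (Gamma_group n CHAR('k))) = C"
    using GC by (auto simp: C_def Sigma_Gamma_group_def)
  ultimately have C: "compactin ?T C"
    using closedin_compact_space[OF compact_space_Sigma_Gamma_topology] by simp
  have translation: "\<exists>\<chi>. (E_action n \<theta> g ^^ fact n) (mon x) = Poly_Mapping.single (Poly_Mapping.single (fst x) (1 / of_nat (snd x))) \<chi> \<and>
      (\<chi> = 1 \<longleftrightarrow> g \<notin> W x)"
    if g: "g \<in> carrier ?SG" and x: "x \<in> J" for g x
  proof -
    obtain a where a: "g [^]\<^bsub>?SG\<^esub> (fact n :: nat) = (id, a)" using Sigma_Gamma_pow_fact[OF g] .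
    have "(E_action n \<theta> g ^^ fact n) (mon x) = Gamma_action n \<theta> a (mon x)"
      using E_action_pow[OF th g mon_E[OF x], of "fact n"] by (simp add: a E_action_translation)
    also have "\<dots> = Poly_Mapping.single (Poly_Mapping.single (fst x) (1 / of_nat (snd x)))
        (Gamma_character n \<theta> a (Poly_Mapping.single (fst x) (1 / of_nat (snd x))))"
      by (simp add: mon_def case_prod_beta Gamma_action_single)
    finally show ?thesis using g by (auto simp: W_def mon_def case_prod_beta single_eq_single_iff)
  qed
  have "C \<subseteq> \<Union>(W ` J)"
  proof
    fix g assume g: "g \<in> C"
    then have gC: "g \<in> carrier ?SG" "g \<in> G" "fst g \<noteq> id" using GC by (auto simp: C_def)
    obtain a where a: "g [^]\<^bsub>?SG\<^esub> (fact n :: nat) = (id, a)" "a \<in> carrier (Gamma_group n CHAR('k))"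
      using Sigma_Gamma_pow_fact[OF gC(1)] .
    have "a \<noteq> \<one>\<^bsub>Gamma_group n CHAR('k)\<^esub>"
    proof
      assume "a = \<one>\<^bsub>Gamma_group n CHAR('k)\<^esub>"
      then have "g [^]\<^bsub>?SG\<^esub> (fact n :: nat) = \<one>\<^bsub>?SG\<^esub>" by (simp add: a(1) Sigma_Gamma_one)
      then have "g = \<one>\<^bsub>?SG\<^esub>" using tf gC(2) fact_gt_zero unfolding torsion_free_def by blast
      then show False using gC(3) by (simp add: Sigma_Gamma_one)
    qed
    then obtain i s where x': "i \<in> {1..n}" "prime_to_char CHAR('k) s"
      "Gamma_character n \<theta> a (Poly_Mapping.single i (1 / of_nat s)) \<noteq> 1"
      using Gamma_character_faithful[OF th a(2)] by blast
    then have x: "(i, s) \<in> J" by (simp add: J_def)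
    have "(E_action n \<theta> g ^^ fact n) (mon (i, s)) = Gamma_action n \<theta> a (mon (i, s))"
      using E_action_pow[OF th gC(1) mon_E[OF x], of "fact n"] by (simp add: a(1) E_action_translation)
    also have "\<dots> \<noteq> mon (i, s)"
      using x'(3) by (simp add: mon_def Gamma_action_single single_eq_single_iff)
    finally have "g \<in> W (i, s)" using gC(1) by (simp add: W_def)
    then show "g \<in> \<Union>(W ` J)" using x by blast
  qed
  then obtain \<F> where "finite \<F>" "\<F> \<subseteq> W ` J" "C \<subseteq> \<Union>\<F>"
    using compactinD[OF C, of "W ` J"] W_open by blast
  then obtain J' where J': "finite J'" "J' \<subseteq> J" "C \<subseteq> \<Union>(W ` J')"
    by (metis finite_subset_image)
  define s where "s = (\<Prod>x\<in>J'. snd x)"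
  have s: "prime_to_char CHAR('k) s"
    unfolding s_def using J'(1,2)
  proof (induction J' rule: finite_induct)
    case (insert x J')
    then have "prime_to_char CHAR('k) (snd x)" by (auto simp: J_def)
    then show ?case using insert by (simp add: prime_to_char_mult)
  qed (simp add: prime_to_char_def)
  show ?thesis
  proof (rule that[OF s])
    fix g assume g: "g \<in> G" "fst g \<noteq> id"
    then obtain x where x: "x \<in> J'" "g \<in> W x" using J'(3) by (auto simp: C_def)
    let ?v = "Poly_Mapping.single (fst x) (1 / of_nat (snd x)) :: nat \<Rightarrow>\<^sub>0 rat"
    have xJ: "x \<in> J" using x J' by blast
    have "snd x dvd s" unfolding s_def using J'(1) x(1) by (rule dvd_prodI)
    then have "mon x \<in> laurent_ring n s"
      using mon_laurent[of "fst x" "snd x"] xJ laurent_ring_mono[of "snd x" s n] by auto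
    then have "Poly_Mapping.single ?v 1 \<in> (laurent_ring n s :: 'k genpoly set)" by (simp add: mon_def case_prod_beta)
    moreover obtain \<chi> where "(E_action n \<theta> g ^^ fact n) (Poly_Mapping.single ?v 1) = Poly_Mapping.single ?v \<chi>" "\<chi> \<noteq> 1"
      using translation[OF subsetD[OF GC g(1)] xJ] x(2) by (auto simp: mon_def case_prod_beta)
    ultimately show "\<exists>v \<chi>. Poly_Mapping.single v 1 \<in> (laurent_ring n s :: 'k genpoly set) \<and> \<chi> \<noteq> 1 \<and>
       (E_action n \<theta> g ^^ fact n) (Poly_Mapping.single v 1) = Poly_Mapping.single v \<chi>" by blast
  qed
qed

section \<open>The Galois extension\<close>

context ring_action
begin

text \<open>Passage from finite groups to infinite ones: every finite set of elements is only required to lie in a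
stable subring on which a finite quotient acts freely, and each map of the action is an automorphism
over the fixed ring.\<close>

theorem galois_extension_if_locally_free:
  assumes conn: "connected_ring (ring_on E)"
    and local: "\<And>F. finite F \<Longrightarrow> F \<subseteq> E \<Longrightarrow> \<exists>L. is_subring L \<and> L \<subseteq> E \<and> F \<subseteq> L \<and>
      (\<forall>\<phi>\<in>\<Phi>. \<forall>x\<in>L. \<phi> x \<in> L) \<and> finite ((\<lambda>\<phi>. restrict \<phi> L) ` \<Phi>) \<and>
      (\<forall>\<phi>\<in>\<Phi>. (\<exists>x\<in>L. \<phi> x \<noteq> x) \<longrightarrow> (\<exists>F. representable L F \<and> F id = 1 \<and> F \<phi> = 0))"
  shows "galois_extension (ring_on E) fixed"
proof -
  have FE: "fixed \<subseteq> E" by (auto simp: fixed_def)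
  have carrier_eq: "(ring_on E)\<lparr>carrier := A\<rparr> = ring_on A" for A by simp
  have algebra_eq: "subalgebra_of (ring_on E) A = algebra_on A" for A
    by (simp add: subalgebra_of_def)
  have conn': "connected_ring (ring_on fixed)"
    using conn FE cring_ring_on[OF is_subring_fixed] by (auto simp: connected_ring_def)
  have aut: "\<phi> \<in> algebra_automorphisms (ring_on E) fixed" if \<phi>: "\<phi> \<in> \<Phi>" for \<phi>
  proof -
    obtain \<psi> where \<psi>: "\<psi> \<in> \<Phi>" "\<And>x. x \<in> E \<Longrightarrow> \<phi> (\<psi> x) = x" "\<And>x. x \<in> E \<Longrightarrow> \<psi> (\<phi> x) = x"
      using act_inv[OF \<phi>] by blast
    have "bij_betw \<phi> E E"
      by (rule bij_betw_byWitness[of _ \<psi>]) (use \<psi> act_closed \<phi> in auto)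
    then show ?thesis
      unfolding algebra_automorphisms_def ring_iso_def ring_hom_def fixed_def
      using \<phi> by (auto simp: act_closed act_add act_mult act_1)
  qed
  show ?thesis
    unfolding galois_extension_def carrier_eq algebra_eq
  proof (intro conjI allI impI conn conn')
    show "subcring fixed (ring_on E)" by (rule subcring_ring_on[OF E is_subring_fixed FE])
    show "fixed = {x \<in> carrier (ring_on E). \<forall>\<phi>\<in>algebra_automorphisms (ring_on E) fixed. \<phi> x = x}"
      using aut FE by (auto simp: fixed_def algebra_automorphisms_def)
    fix F assume "finite F \<and> F \<subseteq> carrier (ring_on E)"
    then obtain L where L: "is_subring L" "L \<subseteq> E" "F \<subseteq> L" "\<And>\<phi> x. \<phi> \<in> \<Phi> \<Longrightarrow> x \<in> L \<Longrightarrow> \<phi> x \<in> L"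
      "finite ((\<lambda>\<phi>. restrict \<phi> L) ` \<Phi>)"
      "\<And>\<phi>. \<phi> \<in> \<Phi> \<Longrightarrow> \<exists>x\<in>L. \<phi> x \<noteq> x \<Longrightarrow> \<exists>F. representable L F \<and> F id = 1 \<and> F \<phi> = 0"
      using local[of F] by auto
    obtain S where S: "is_subring S" "S \<subseteq> E" "fixed \<subseteq> S" "L \<subseteq> S"
      "strongly_separable_algebra (ring_on fixed) (algebra_on S)"
    proof -
      have "\<exists>S. is_subring S \<and> S \<subseteq> E \<and> fixed \<subseteq> S \<and> L \<subseteq> S \<and>
          strongly_separable_algebra (ring_on fixed) (algebra_on S)"
        by (rule strongly_separable_over_fixed[OF L(1,2)]) (erule (1) L(4), rule L(5), erule (1) L(6))
      then show ?thesis using that by blast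
    qed
    have "subcring S (ring_on E)" by (rule subcring_ring_on[OF E S(1,2)])
    then show "\<exists>S. subcring S (ring_on E) \<and> fixed \<subseteq> S \<and> F \<subseteq> S \<and>
        strongly_separable_algebra (ring_on fixed) (algebra_on S)"
      using S L(3) by blast
  qed
qed

end

lemma ring_action_E_action:
  fixes \<theta> :: "rat set \<Rightarrow> 'k::field"
  assumes th: "root_isomorphism \<theta>" and G: "subgroup G (Sigma_Gamma_group n CHAR('k))"
  shows "ring_action (carrier (E_ring n)) (E_action n \<theta> ` G)"
proof
  let ?SG = "Sigma_Gamma_group n CHAR('k)"
  have GC: "g \<in> carrier ?SG" if "g \<in> G" for g using that subgroup.subset[OF G] by blast
  show "is_subring (carrier (E_ring n :: 'k genpoly ring))" by (rule is_subring_E)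
  show "\<exists>\<phi>\<in>E_action n \<theta> ` G. \<forall>x\<in>carrier (E_ring n). \<phi> x = x"
    using subgroup.one_closed[OF G] E_action_one[OF th] by blast
  fix \<phi> assume "\<phi> \<in> E_action n \<theta> ` G"
  then obtain g where g: "g \<in> G" "\<phi> = E_action n \<theta> g" by blast
  show "\<phi> x \<in> carrier (E_ring n)" if "x \<in> carrier (E_ring n)" for x
    unfolding g by (rule E_action_closed[OF GC[OF g(1)] that])
  show "\<phi> (x + y) = \<phi> x + \<phi> y" for x y
    unfolding g by (rule E_action_add[OF GC[OF g(1)]])
  show "\<phi> (x * y) = \<phi> x * \<phi> y" if "x \<in> carrier (E_ring n)" "y \<in> carrier (E_ring n)" for x y
    unfolding g by (rule E_action_times[OF th GC[OF g(1)] that])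
  show "\<phi> 1 = 1"
    unfolding g by (rule E_action_1[OF th GC[OF g(1)]])
  show "\<exists>\<psi>\<in>E_action n \<theta> ` G. \<forall>x\<in>carrier (E_ring n). \<phi> (\<psi> x) = x \<and> \<psi> (\<phi> x) = x"
    unfolding g using E_action_inv[OF th GC[OF g(1)]] subgroup.m_inv_closed[OF G g(1)] by blast
  fix \<psi> assume "\<psi> \<in> E_action n \<theta> ` G"
  then obtain h where h: "h \<in> G" "\<psi> = E_action n \<theta> h" by blast
  show "\<exists>\<chi>\<in>E_action n \<theta> ` G. \<forall>x\<in>carrier (E_ring n). \<chi> x = \<phi> (\<psi> x)"
    unfolding g h using E_action_mult[OF th GC[OF g(1)] GC[OF h(1)]] subgroup.m_closed[OF G g(1) h(1)] by blast
qed

text \<open>The difference \<open>t\<^sup>v - \<chi> t\<^sup>v\<close> has the inverse \<open>(1 - \<chi>)\<^sup>-\<^sup>1 t\<^sup>-\<^sup>v\<close>, in the same Laurent ring.\<close>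

lemma separating_if_power_scales_monomial:
  fixes \<Phi> :: "('k::field genpoly \<Rightarrow> 'k genpoly) set"
  assumes ra: "ring_action E \<Phi>" and LE: "laurent_ring n s \<subseteq> E"
    and \<phi>: "\<phi> \<in> \<Phi>" and stable: "\<And>x. x \<in> laurent_ring n s \<Longrightarrow> \<phi> x \<in> laurent_ring n s"
    and v: "Poly_Mapping.single v 1 \<in> (laurent_ring n s :: 'k genpoly set)"
    and \<chi>: "\<chi> \<noteq> 1" "(\<phi> ^^ m) (Poly_Mapping.single v 1) = Poly_Mapping.single v \<chi>"
  shows "\<exists>F. ring_action.representable \<Phi> (laurent_ring n s) F \<and> F id = 1 \<and> F \<phi> = 0"
proof -
  interpret ring_action E \<Phi> by (rule ra)
  let ?u = "Poly_Mapping.single (- v) (1 / (1 - \<chi>))"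
  have u: "?u \<in> laurent_ring n s"
    using v by (auto simp: laurent_ring_def split: if_splits)
  have "Poly_Mapping.single v 1 - Poly_Mapping.single v \<chi> = Poly_Mapping.single v (1 - \<chi>)"
    by (simp add: single_diff)
  then have u': "?u * (Poly_Mapping.single v 1 - (\<phi> ^^ m) (Poly_Mapping.single v 1)) = 1"
    using \<chi> by (simp add: mult_single)
  show ?thesis
    by (rule separating_if_power_difference_unit[OF is_subring_laurent_ring LE \<phi> _ v u u']) (rule stable)
qed

theorem proposition4p4:
  fixes n :: nat
    and \<theta> :: "rat set \<Rightarrow> 'k::field"
    and G :: "((nat \<Rightarrow> nat) \<times> (nat \<Rightarrow> nat \<Rightarrow> nat \<Rightarrow> int)) set"
  assumes "contains_all_roots_of_unity TYPE('k)"
    and "root_isomorphism \<theta>"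
    and "n \<ge> 1"
    and "subgroup G (Sigma_Gamma_group n CHAR('k))"
    and "closedin (Sigma_Gamma_topology n CHAR('k)) G"
    and "torsion_free (Sigma_Gamma_group n CHAR('k)) G"
  shows "galois_extension (E_ring n) (fixed_ring n \<theta> G)"
proof -
  note th = assms(2) and G = assms(4)
  let ?SG = "Sigma_Gamma_group n CHAR('k)"
  define E where "E = carrier (E_ring n :: 'k genpoly ring)"
  define \<Phi> where "\<Phi> = E_action n \<theta> ` G"
  have GC: "g \<in> carrier ?SG" if "g \<in> G" for g using that subgroup.subset[OF G] by blast
  interpret ring_action E \<Phi>
    unfolding E_def \<Phi>_def by (rule ring_action_E_action[OF th G])
  have "fixed = {x \<in> E. \<forall>\<phi>\<in>\<Phi>. \<phi> x = x}" by (rule fixed_def)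
  also have "\<dots> = fixed_ring n \<theta> G" by (auto simp: fixed_ring_def E_def \<Phi>_def)
  finally have fixed_eq: "fixed = fixed_ring n \<theta> G" .
  obtain s0 where s0: "prime_to_char CHAR('k) s0"
    and free0: "\<And>g. g \<in> G \<Longrightarrow> fst g \<noteq> id \<Longrightarrow> \<exists>v \<chi>. Poly_Mapping.single v 1 \<in> (laurent_ring n s0 :: 'k genpoly set) \<and> \<chi> \<noteq> 1 \<and>
       (E_action n \<theta> g ^^ fact n) (Poly_Mapping.single v 1) = Poly_Mapping.single v \<chi>"
    using uniform_denominator[OF th G assms(5,6)] by blast
  have "galois_extension (ring_on E) fixed"
  proof (rule galois_extension_if_locally_free)
    show "connected_ring (ring_on E)"
      unfolding E_def by (rule connected_ring_on[OF is_subring_E])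
    fix F assume F: "finite F" "F \<subseteq> E"
    have "\<exists>s. prime_to_char CHAR('k) s \<and> s0 dvd s \<and> F \<subseteq> laurent_ring n s" using F
    proof (induction F rule: finite_induct)
      case empty
      show ?case using s0 by (intro exI[of _ s0]) simp
    next
      case (insert f F)
      then obtain s where s: "prime_to_char CHAR('k) s" "s0 dvd s" "F \<subseteq> laurent_ring n s" by auto
      obtain s' where s': "prime_to_char CHAR('k) s'" "f \<in> laurent_ring n s'"
        using insert.prems by (auto simp: E_def E_ring_def)
      have "insert f F \<subseteq> laurent_ring n (s * s')"
        using s(3) s'(2) laurent_ring_mono[of s "s * s'" n] laurent_ring_mono[of s' "s * s'" n] by auto
      then show ?case using prime_to_char_mult[OF s(1) s'(1)] s(2) by (intro exI[of _ "s * s'"]) simp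
    qed
    then obtain s where s: "prime_to_char CHAR('k) s" "s0 dvd s" "F \<subseteq> laurent_ring n s" by blast
    let ?L = "laurent_ring n s :: 'k genpoly set"
    have LE: "?L \<subseteq> E" unfolding E_def by (rule laurent_ring_subset[OF s(1)])
    have stable: "E_action n \<theta> g x \<in> ?L" if "g \<in> G" "x \<in> ?L" for g x
      by (rule E_action_laurent_ring[OF GC[OF that(1)] that(2)])
    have "(\<lambda>\<phi>. restrict \<phi> ?L) ` \<Phi> \<subseteq> (\<lambda>g. restrict (E_action n \<theta> g) ?L) ` carrier ?SG"
      using GC by (auto simp: \<Phi>_def)
    then have fin: "finite ((\<lambda>\<phi>. restrict \<phi> ?L) ` \<Phi>)"
      using finite_restrict_E_action[OF th s(1)] by (rule finite_subset)
    have free: "\<exists>F. representable ?L F \<and> F id = 1 \<and> F (E_action n \<theta> g) = 0"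
      if g: "g \<in> G" and f: "f \<in> ?L" "E_action n \<theta> g f \<noteq> f" for g f
    proof -
      have "\<exists>m v \<chi>. Poly_Mapping.single v 1 \<in> ?L \<and> \<chi> \<noteq> 1 \<and>
          (E_action n \<theta> g ^^ m) (Poly_Mapping.single v 1) = Poly_Mapping.single v \<chi>"
      proof (cases "fst g = id")
        case True
        then obtain a where a: "g = (id, a)" by (metis prod.collapse)
        have "\<exists>v. Poly_Mapping.lookup (Gamma_action n \<theta> a f) v \<noteq> Poly_Mapping.lookup f v"
          using f(2) by (metis E_action_translation a poly_mapping_eqI)
        then obtain v where "Gamma_character n \<theta> a v * Poly_Mapping.lookup f v \<noteq> Poly_Mapping.lookup f v"
          by (auto simp: lookup_Gamma_action)
        then have v: "Gamma_character n \<theta> a v \<noteq> 1" "v \<in> Poly_Mapping.keys f"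
          by (auto simp: in_keys_iff)
        have "Poly_Mapping.single v 1 \<in> ?L" using f(1) v(2) by (auto simp: laurent_ring_def)
        moreover have "(E_action n \<theta> g ^^ 1) (Poly_Mapping.single v 1) = Poly_Mapping.single v (Gamma_character n \<theta> a v)"
          by (simp add: a E_action_translation Gamma_action_single)
        ultimately show ?thesis using v(1) by blast
      next
        case False
        then show ?thesis using free0[OF g] laurent_ring_mono[OF s(2)] by blast
      qed
      then obtain m v \<chi> where "Poly_Mapping.single v 1 \<in> ?L" "\<chi> \<noteq> 1"
        "(E_action n \<theta> g ^^ m) (Poly_Mapping.single v 1) = Poly_Mapping.single v \<chi>" by blast
      then show ?thesis
        using g stable by (intro separating_if_power_scales_monomial[OF ring_action_axioms LE]) (auto simp: \<Phi>_def)
    qed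
    show "\<exists>L. is_subring L \<and> L \<subseteq> E \<and> F \<subseteq> L \<and>
      (\<forall>\<phi>\<in>\<Phi>. \<forall>x\<in>L. \<phi> x \<in> L) \<and> finite ((\<lambda>\<phi>. restrict \<phi> L) ` \<Phi>) \<and>
      (\<forall>\<phi>\<in>\<Phi>. (\<exists>x\<in>L. \<phi> x \<noteq> x) \<longrightarrow> (\<exists>F. representable L F \<and> F id = 1 \<and> F \<phi> = 0))"
      using is_subring_laurent_ring LE s(3) stable fin free by (intro exI[of _ ?L]) (auto simp: \<Phi>_def)
  qed
  then show ?thesis using E_ring_eq fixed_eq unfolding E_def by metis
qed

end
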